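(* Let $n=2g+1$ be odd. Let $A_0$ be the $n\times n$ symmetric matrix with $1$'s on the anti-diagonal and $0$'s elsewhere, and let $W$ be the space of $n\times n$ symmetric matrices, with indeterminate entries $b_{ij}$ ($1\le i\le j\le n$). Then there exists a polynomial $F(B,x)\in\mathbb{Z}[\sqrt{-1}][b_{11},b_{12},\ldots,b_{nn}][x]$ of degree $2^{2g}$ in $x$ that is irreducible in $\mathbb{Q}(\sqrt{-1})(b_{11},\ldots,b_{nn})[x]$, such that for every $B_0\in W(\mathbb{Q})$ that is distinguished, the specialization $F(B_0,x)\in\mathbb{Q}(\sqrt{-1})[x]$ has a root in $\mathbb{Q}$.
   Context: For $n=2g+1$ odd, an element $B\in W(\mathbb{Q})$ with $\Delta(B)\neq 0$ (where $\Delta(B)$ is the discriminant of the polynomial $\det(xA_0-B)$) is called distinguished if there exists a $g$-dimensional subspace $Y\subset\mathbb{Q}^n$ defined over $\mathbb{Q}$ that is isotropic with respect to both quadratic forms defined by $A_0$ and by $B$. *)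

theory Defs
  imports
    Complex_Main
    "HOL-Library.Poly_Mapping"
    "HOL-Library.Nat_Bijection"
    "HOL-Computational_Algebra.Polynomial_Factorial"
    "HOL-Algebra.Ring_Divisibility"
    "Jordan_Normal_Form.VS_Connect"
    "Subresultants.Resultant_Prelim"
begin

text \<open>
  Row and column indices start at 0, so the indeterminates are
  \<open>b\<^sub>i\<^sub>j\<close> with \<open>0 \<le> i \<le> j < n\<close>.
\<close>

definition antidiag_mat :: "nat \<Rightarrow> 'a :: {zero, one} mat" where
  "antidiag_mat n = mat n n (\<lambda>(i, j). if i + j + 1 = n then 1 else 0)"

definition symmetric_mats :: "nat \<Rightarrow> 'a mat set" where
  "symmetric_mats n = {B \<in> carrier_mat n n. transpose_mat B = B}"

definition discriminant :: "'a :: field poly \<Rightarrow> 'a" where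
  "discriminant p =
     (-1) ^ (degree p * (degree p - 1) div 2) * resultant p (pderiv p) / lead_coeff p"

definition pencil_poly :: "nat \<Rightarrow> 'a :: comm_ring_1 mat \<Rightarrow> 'a poly" where
  "pencil_poly n B =
     det ([:0, 1:] \<cdot>\<^sub>m map_mat (\<lambda>a. [:a:]) (antidiag_mat n) - map_mat (\<lambda>a. [:a:]) B)"

text \<open>This is total isotropy: one vector \<open>v \<noteq> 0\<close> in \<open>Y\<close> with \<open>v\<^sup>T A v = 0\<close> is not enough.\<close>

definition isotropic :: "'a :: comm_ring_1 mat \<Rightarrow> 'a vec set \<Rightarrow> bool" where
  "isotropic A Y \<longleftrightarrow> (\<forall>v\<in>Y. v \<bullet> (A *\<^sub>v v) = 0)"

definition distinguished :: "nat \<Rightarrow> rat mat \<Rightarrow> bool" where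
  "distinguished g B \<longleftrightarrow>
     (let n = 2 * g + 1; V = module_vec TYPE(rat) n in
       B \<in> symmetric_mats n \<and>
       discriminant (pencil_poly n B) \<noteq> 0 \<and>
       (\<exists>Y. subspace class_ring Y V \<and>
            vectorspace.dim class_ring (V\<lparr>carrier := Y\<rparr>) = g \<and>
            isotropic (antidiag_mat n) Y \<and> isotropic B Y))"

text \<open>
  A multivariate polynomial maps each monomial, given by its exponents, to a coefficient.
  Its variables are natural numbers, since \<^typ>\<open>nat\<close> has the linear order that the
  \<^class>\<open>idom\<close> instance needs: \<open>b\<^sub>i\<^sub>j\<close> is the variable
  \<open>prod_encode (i, j)\<close>. All coefficients lie in \<^typ>\<open>complex\<close>, and
  \<open>\<int>[\<surd>-1]\<close>, \<open>\<rat>(\<surd>-1)\<close> and the rings built from them are subsets.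
\<close>

type_synonym mpoly = "(nat \<Rightarrow>\<^sub>0 nat) \<Rightarrow>\<^sub>0 complex"

definition gauss_ints :: "complex set" where
  "gauss_ints = {z. Re z \<in> \<int> \<and> Im z \<in> \<int>}"

definition gauss_rats :: "complex set" where
  "gauss_rats = {z. Re z \<in> \<rat> \<and> Im z \<in> \<rat>}"

definition entry_vars :: "nat \<Rightarrow> nat set" where
  "entry_vars n = {prod_encode (i, j) | i j. i \<le> j \<and> j < n}"

definition mpolys :: "complex set \<Rightarrow> nat set \<Rightarrow> mpoly set" where
  "mpolys R X = {p. (\<forall>m\<in>Poly_Mapping.keys p. Poly_Mapping.lookup p m \<in> R \<and> Poly_Mapping.keys m \<subseteq> X)}"

definition ratfuns :: "complex set \<Rightarrow> nat set \<Rightarrow> mpoly fract set" where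
  "ratfuns R X = {to_fract p / to_fract q | p q. p \<in> mpolys R X \<and> q \<in> mpolys R X \<and> q \<noteq> 0}"

definition eval_mpoly :: "(nat \<Rightarrow> complex) \<Rightarrow> mpoly \<Rightarrow> complex" where
  "eval_mpoly a p = (\<Sum>m\<in>Poly_Mapping.keys p. Poly_Mapping.lookup p m * (\<Prod>x\<in>Poly_Mapping.keys m. a x ^ Poly_Mapping.lookup m x))"

definition poly_ring_over :: "'a :: comm_ring_1 set \<Rightarrow> 'a poly ring" where
  "poly_ring_over K = class_ring\<lparr>carrier := {p. range (coeff p) \<subseteq> K}\<rparr>"

definition specialize :: "rat mat \<Rightarrow> mpoly poly \<Rightarrow> complex poly" where
  "specialize B F = map_poly (eval_mpoly (\<lambda>x. of_rat (B $$ prod_decode x))) F"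

end

theory Submission
  imports
    Defs
    "HOL-Combinatorics.Permutations"
    "HOL-Computational_Algebra.Field_as_Ring"
    "Jordan_Normal_Form.Char_Poly"
    "Subresultants.Subresultant_Gcd"
begin

text \<open>
  Let \<open>T = A\<^sub>0 B\<close> with eigenvalues \<open>\<theta>\<^sub>i\<close> and eigenvectors \<open>p\<^sub>i\<close> that are orthonormal for \<open>A\<^sub>0\<close>, let
  \<open>f\<close> be its characteristic polynomial, and let \<open>\<alpha>\<^sub>i = w\<^sub>i\<^sup>2 f'(\<theta>\<^sub>i)\<close>, where \<open>w\<^sub>i\<close> is the last coordinate of
  \<open>p\<^sub>i\<close>; \<open>\<alpha>\<^sub>i\<close> is a polynomial in \<open>\<theta>\<^sub>i\<close> over the ring generated by the entries of \<open>B\<close>. The roots of \<open>F\<close>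
  are the \<open>2 ^ (2 * g)\<close> squares \<open>(\<Sum>i<n. \<plusminus> \<beta>\<^sub>i)\<^sup>2\<close> with \<open>\<beta>\<^sub>i\<^sup>2 = \<alpha>\<^sub>i\<close>; its coefficients are symmetric in
  the \<open>\<theta>\<^sub>i\<close>, hence polynomials in the entries of \<open>B\<close>.

  Irreducibility: turning \<open>p\<^sub>k\<close> and \<open>p\<^sub>j\<close> by a half turn in their plane leads \<open>B\<close> back to itself but
  negates \<open>\<beta>\<^sub>k\<close> and \<open>\<beta>\<^sub>j\<close>. As \<open>n\<close> is odd, such sign changes act transitively on the roots, so the
  roots of a factor of \<open>F\<close> are either all roots or none.

  Rational root: a common isotropic subspace of dimension \<open>g\<close> contains a vector \<open>e\<close> with
  \<open>e\<^sup>T A\<^sub>0 T ^ k e = 0\<close> for \<open>k < 2 * g\<close>. With \<open>h = e\<^sup>T A\<^sub>0 T ^ (2 * g) e\<close> and \<open>\<gamma>\<close> the rational polynomial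
  for which \<open>\<gamma>(T) e\<close> is the first unit vector, \<open>\<alpha>\<^sub>i = h * \<gamma>(\<theta>\<^sub>i)\<^sup>2\<close>. Comparing determinants, \<open>h ^ n\<close> is
  a rational square and so is \<open>h\<close>; hence \<open>\<Sum>i<n. \<beta>\<^sub>i\<close> can be taken to be a rational multiple of the
  trace of \<open>\<gamma>(T)\<close>.
\<close>

subsection \<open>Rings of polynomial functions\<close>

text \<open>Ring elements are functions of complex points and the \<open>\<beta>\<^sub>i\<close> are
  complex numbers, so no splitting field is built. The price is genericity: identities are read off
  values, and irreducibility is decided at a single point chosen outside several zero sets.

  Squaring the sums makes the sign changes transitive. A half turn changes two signs and so
  preserves the parity of the number of minus signs; a global change of sign alters this parity, as
  \<open>n\<close> is odd, and is invisible in the square.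

  The factor \<open>f'(\<theta>\<^sub>i)\<close> serves both halves. For
  \<open>q = f / (X - \<theta>\<^sub>i)\<close> a corner entry of \<open>q(T)\<close> is
  \<open>w\<^sub>i\<^sup>2 f'(\<theta>\<^sub>i)\<close>, so \<open>\<alpha>\<^sub>i\<close> has no
  denominators. The same computation with \<open>e\<close> in place of the unit vector leaves only
  the top coefficient of \<open>q\<close>, because the lower moments of \<open>e\<close> vanish;
  hence all \<open>i\<close> share the one value \<open>h\<close>.

  The half turn needs no topology: with \<open>z = exp (\<i> * t)\<close> everything on the way from
  \<open>z = 1\<close> to \<open>z = -1\<close> is a Laurent polynomial in \<open>z\<close>, and if
  the product of two of these vanishes for all nonzero \<open>z\<close>, so does one of
  them.\<close>

inductive_set polyfuns :: "complex set \<Rightarrow> ('x \<Rightarrow> complex) set \<Rightarrow> ('x \<Rightarrow> complex) set"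
  for C :: "complex set" and G :: "('x \<Rightarrow> complex) set" where
  const: "c \<in> C \<or> c \<in> \<int> \<Longrightarrow> (\<lambda>_. c) \<in> polyfuns C G"
| base: "f \<in> G \<Longrightarrow> f \<in> polyfuns C G"
| add: "f \<in> polyfuns C G \<Longrightarrow> g \<in> polyfuns C G \<Longrightarrow> (\<lambda>x. f x + g x) \<in> polyfuns C G"
| mult: "f \<in> polyfuns C G \<Longrightarrow> g \<in> polyfuns C G \<Longrightarrow> (\<lambda>x. f x * g x) \<in> polyfuns C G"

definition projs :: "'i set \<Rightarrow> (('i \<Rightarrow> complex) \<Rightarrow> complex) set" where
  "projs X = (\<lambda>i y. y i) ` X"

lemma projs_I: "i \<in> X \<Longrightarrow> (\<lambda>y. y i) \<in> projs X"
  by (auto simp: projs_def)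

lemma polyfuns_proj: "i \<in> X \<Longrightarrow> (\<lambda>y. y i) \<in> polyfuns C (projs X)"
  by (intro polyfuns.base projs_I)

lemma polyfuns_uminus: "f \<in> polyfuns C G \<Longrightarrow> (\<lambda>x. - f x) \<in> polyfuns C G"
  using polyfuns.mult[OF polyfuns.const[of "-1" C G]] by fastforce

lemma polyfuns_diff: "f \<in> polyfuns C G \<Longrightarrow> g \<in> polyfuns C G \<Longrightarrow> (\<lambda>x. f x - g x) \<in> polyfuns C G"
  using polyfuns.add[OF _ polyfuns_uminus] by fastforce

lemma polyfuns_sum:
  "(\<And>i. i \<in> I \<Longrightarrow> f i \<in> polyfuns C G) \<Longrightarrow> (\<lambda>x. \<Sum>i\<in>I. f i x) \<in> polyfuns C G"
  by (induction I rule: infinite_finite_induct) (auto intro: polyfuns.intros)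

lemma polyfuns_prod:
  "(\<And>i. i \<in> I \<Longrightarrow> f i \<in> polyfuns C G) \<Longrightarrow> (\<lambda>x. \<Prod>i\<in>I. f i x) \<in> polyfuns C G"
  by (induction I rule: infinite_finite_induct) (auto intro: polyfuns.intros)

lemma polyfuns_power: "f \<in> polyfuns C G \<Longrightarrow> (\<lambda>x. f x ^ k) \<in> polyfuns C G"
  by (induction k) (auto intro: polyfuns.intros)

lemmas polyfuns_intros = polyfuns.const polyfuns.add polyfuns.mult polyfuns_uminus polyfuns_diff
  polyfuns_sum polyfuns_prod polyfuns_power

lemma polyfuns_subst:
  assumes "f \<in> polyfuns C G" and "\<And>g. g \<in> G \<Longrightarrow> (\<lambda>x. g (r x)) \<in> polyfuns C H"
  shows "(\<lambda>x. f (r x)) \<in> polyfuns C H"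
  using assms(1) by induction (auto intro: polyfuns.intros assms(2))

lemma polyfuns_subst_projs:
  assumes "f \<in> polyfuns C (projs X)" and "\<And>i. i \<in> X \<Longrightarrow> (\<lambda>x. r x i) \<in> polyfuns C H"
  shows "(\<lambda>x. f (r x)) \<in> polyfuns C H"
  using assms(1) by (rule polyfuns_subst) (auto simp: projs_def intro: assms(2))

lemma polyfuns_mono:
  assumes "f \<in> polyfuns C G" "C \<subseteq> D" "G \<subseteq> H"
  shows "f \<in> polyfuns D H"
  using assms(1) by induction (use assms(2,3) in \<open>auto intro: polyfuns.intros\<close>)

section \<open>Univariate polynomials whose coefficients are polynomial functions\<close>

definition coeffs_in :: "('x \<Rightarrow> complex) set \<Rightarrow> ('x \<Rightarrow> complex poly) \<Rightarrow> bool" where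
  "coeffs_in R p \<longleftrightarrow> (\<forall>k. (\<lambda>x. coeff (p x) k) \<in> R)"

lemma coeffs_inD: "coeffs_in R p \<Longrightarrow> (\<lambda>x. coeff (p x) k) \<in> R"
  by (simp add: coeffs_in_def)

lemma coeffs_in_const: "(c = 0 \<or> c = 1) \<Longrightarrow> coeffs_in (polyfuns C G) (\<lambda>_. c)"
  by (auto simp: coeffs_in_def intro!: polyfuns.const)

lemma coeffs_in_pCons:
  assumes "f \<in> polyfuns C G" "coeffs_in (polyfuns C G) p"
  shows "coeffs_in (polyfuns C G) (\<lambda>x. pCons (f x) (p x))"
  unfolding coeffs_in_def
proof
  fix k show "(\<lambda>x. coeff (pCons (f x) (p x)) k) \<in> polyfuns C G"
    using assms by (cases k) (auto simp: coeffs_in_def)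
qed

lemma coeffs_in_add:
  "coeffs_in (polyfuns C G) p \<Longrightarrow> coeffs_in (polyfuns C G) q \<Longrightarrow>
   coeffs_in (polyfuns C G) (\<lambda>x. p x + q x)"
  by (auto simp: coeffs_in_def intro!: polyfuns_intros)

lemma coeffs_in_mult:
  "coeffs_in (polyfuns C G) p \<Longrightarrow> coeffs_in (polyfuns C G) q \<Longrightarrow>
   coeffs_in (polyfuns C G) (\<lambda>x. p x * q x)"
  by (auto simp: coeffs_in_def coeff_mult intro!: polyfuns_intros)

lemma coeffs_in_linear:
  "f \<in> polyfuns C G \<Longrightarrow> coeffs_in (polyfuns C G) (\<lambda>x. [:f x, 1:])"
  by (intro coeffs_in_pCons coeffs_in_const polyfuns.const) auto

lemma coeffs_in_sum:
  "(\<And>i. i \<in> I \<Longrightarrow> coeffs_in (polyfuns C G) (p i)) \<Longrightarrow>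
   coeffs_in (polyfuns C G) (\<lambda>x. \<Sum>i\<in>I. p i x)"
  by (induction I rule: infinite_finite_induct) (auto intro: coeffs_in_const coeffs_in_add)

lemma coeffs_in_prod:
  "(\<And>i. i \<in> I \<Longrightarrow> coeffs_in (polyfuns C G) (p i)) \<Longrightarrow>
   coeffs_in (polyfuns C G) (\<lambda>x. \<Prod>i\<in>I. p i x)"
  by (induction I rule: infinite_finite_induct) (auto intro: coeffs_in_const coeffs_in_mult)

section \<open>Restriction to a line\<close>

lemma polyfuns_line:
  assumes "f \<in> polyfuns UNIV (projs UNIV)"
  shows "\<exists>p. \<forall>t. f (\<lambda>i. a i + t * (b i - a i)) = poly p t"
  using assms
proof induction
  case (const c) show ?case by (intro exI[of _ "[:c:]"]) simp
next
  case (base f)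
  then obtain i where "f = (\<lambda>y. y i)" by (auto simp: projs_def)
  then show ?case by (intro exI[of _ "[:a i, b i - a i:]"]) simp
next
  case (add f g) then show ?case by (metis poly_add)
next
  case (mult f g) then show ?case by (metis poly_mult)
qed

text \<open>On the line from \<open>a\<close> to \<open>b\<close> both functions become polynomials
  in one variable \<open>t\<close>, one nonzero at \<open>t = 0\<close> and the other at
  \<open>t = 1\<close>; their product is a nonzero polynomial.\<close>

lemma polyfuns_nonzero_common:
  assumes "f \<in> polyfuns UNIV (projs UNIV)" "g \<in> polyfuns UNIV (projs UNIV)"
    and "f a \<noteq> 0" "g b \<noteq> 0"
  shows "\<exists>y. f y \<noteq> 0 \<and> g y \<noteq> 0"
proof -
  obtain p q where p: "\<And>t. f (\<lambda>i. a i + t * (b i - a i)) = poly p t"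
    and q: "\<And>t. g (\<lambda>i. a i + t * (b i - a i)) = poly q t"
    using polyfuns_line[OF assms(1)] polyfuns_line[OF assms(2)] by metis
  have "p \<noteq> 0" "q \<noteq> 0" using p[of 0] q[of 1] assms(3,4) by auto
  then have "p * q \<noteq> 0" by simp
  then obtain t where "poly (p * q) t \<noteq> 0" using poly_all_0_iff_0 by blast
  then show ?thesis by (metis p q poly_mult mult_eq_0_iff)
qed

section \<open>Evaluation of multivariate polynomials\<close>

definition eval_monom :: "(nat \<Rightarrow> complex) \<Rightarrow> (nat \<Rightarrow>\<^sub>0 nat) \<Rightarrow> complex" where
  "eval_monom a m = (\<Prod>x\<in>Poly_Mapping.keys m. a x ^ Poly_Mapping.lookup m x)"

lemma eval_monom_superset:
  assumes "finite A" "Poly_Mapping.keys m \<subseteq> A"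
  shows "eval_monom a m = (\<Prod>x\<in>A. a x ^ Poly_Mapping.lookup m x)"
  unfolding eval_monom_def
  by (rule prod.mono_neutral_left) (use assms in \<open>auto simp: in_keys_iff\<close>)

lemma eval_monom_add: "eval_monom a (m + k) = eval_monom a m * eval_monom a k"
proof -
  let ?A = "Poly_Mapping.keys m \<union> Poly_Mapping.keys k"
  have "Poly_Mapping.keys (m + k) \<subseteq> ?A" by (rule keys_add)
  then show ?thesis
    by (simp add: eval_monom_superset[of ?A] lookup_add power_add prod.distrib)
qed

lemma eval_mpoly_superset:
  assumes "finite A" "Poly_Mapping.keys p \<subseteq> A"
  shows "eval_mpoly a p = (\<Sum>m\<in>A. Poly_Mapping.lookup p m * eval_monom a m)"
  unfolding eval_mpoly_def eval_monom_def
  by (rule sum.mono_neutral_left) (use assms in \<open>auto simp: in_keys_iff\<close>)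

lemma eval_mpoly_0 [simp]: "eval_mpoly a 0 = 0"
  by (simp add: eval_mpoly_def)

lemma eval_mpoly_single [simp]: "eval_mpoly a (Poly_Mapping.single m c) = c * eval_monom a m"
  by (subst eval_mpoly_superset[of "{m}"]) auto

lemma eval_mpoly_1 [simp]: "eval_mpoly a 1 = 1"
  using eval_mpoly_single[of a 0 1] by (simp add: eval_monom_def del: eval_mpoly_single)

lemma eval_mpoly_add [simp]: "eval_mpoly a (p + q) = eval_mpoly a p + eval_mpoly a q"
proof -
  let ?A = "Poly_Mapping.keys p \<union> Poly_Mapping.keys q"
  have "Poly_Mapping.keys (p + q) \<subseteq> ?A" by (rule keys_add)
  then show ?thesis
    by (simp add: eval_mpoly_superset[of ?A] lookup_add algebra_simps sum.distrib)
qed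

lemma eval_mpoly_sum [simp]: "eval_mpoly a (\<Sum>i\<in>I. p i) = (\<Sum>i\<in>I. eval_mpoly a (p i))"
  by (induction I rule: infinite_finite_induct) auto

lemma mpoly_sum_single:
  "(\<Sum>m\<in>Poly_Mapping.keys p. Poly_Mapping.single m (Poly_Mapping.lookup p m)) = p"
proof (rule poly_mapping_eqI)
  fix k
  show "Poly_Mapping.lookup (\<Sum>m\<in>Poly_Mapping.keys p. Poly_Mapping.single m (Poly_Mapping.lookup p m)) k
    = Poly_Mapping.lookup p k"
    by (cases "k \<in> Poly_Mapping.keys p")
      (auto simp: lookup_sum lookup_single when_def in_keys_iff sum.delta)
qed

lemma eval_mpoly_mult [simp]: "eval_mpoly a (p * q) = eval_mpoly a p * eval_mpoly a q"
proof -
  let ?s = "\<lambda>p m. Poly_Mapping.single m (Poly_Mapping.lookup p m)"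
  let ?P = "Poly_Mapping.keys p" and ?Q = "Poly_Mapping.keys q"
  have "p * q = (\<Sum>m\<in>?P. ?s p m) * (\<Sum>k\<in>?Q. ?s q k)"
    by (simp only: mpoly_sum_single)
  also have "\<dots> = (\<Sum>m\<in>?P. \<Sum>k\<in>?Q. Poly_Mapping.single (m + k) (Poly_Mapping.lookup p m * Poly_Mapping.lookup q k))"
    by (simp add: sum_product mult_single)
  also have "eval_mpoly a \<dots> = (\<Sum>m\<in>?P. Poly_Mapping.lookup p m * eval_monom a m) *
      (\<Sum>k\<in>?Q. Poly_Mapping.lookup q k * eval_monom a k)"
    by (simp add: sum_product eval_monom_add algebra_simps)
  finally show ?thesis by (simp add: eval_mpoly_superset[of ?P] eval_mpoly_superset[of ?Q])
qed

lemma eval_mpoly_polyfuns: "(\<lambda>a. eval_mpoly a p) \<in> polyfuns UNIV (projs UNIV)"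
  unfolding eval_mpoly_def
  by (intro polyfuns_intros polyfuns_proj) auto

lemma mpolys_add:
  assumes R: "\<And>x y. x \<in> R \<Longrightarrow> y \<in> R \<Longrightarrow> x + y \<in> R" and "0 \<in> R"
    and p: "p \<in> mpolys R X" and q: "q \<in> mpolys R X"
  shows "p + q \<in> mpolys R X"
proof -
  have "Poly_Mapping.lookup p m \<in> R" "Poly_Mapping.lookup q m \<in> R" for m
    using assms by (cases "m \<in> Poly_Mapping.keys p"; cases "m \<in> Poly_Mapping.keys q";
        force simp: mpolys_def in_keys_iff)+
  then show ?thesis
    using p q keys_add[of p q] by (fastforce simp: mpolys_def lookup_add intro: R)
qed

lemma mpolys_sum:
  assumes "\<And>x y. x \<in> R \<Longrightarrow> y \<in> R \<Longrightarrow> x + y \<in> R" and "0 \<in> R"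
    and "\<And>i. i \<in> I \<Longrightarrow> p i \<in> mpolys R X"
  shows "(\<Sum>i\<in>I. p i) \<in> mpolys R X"
proof -
  have "0 \<in> mpolys R X" by (simp add: mpolys_def)
  with assms(3) show ?thesis
    by (induction I rule: infinite_finite_induct) (auto intro!: mpolys_add[OF assms(1,2)])
qed

lemma mpolys_mult:
  assumes R: "\<And>x y. x \<in> R \<Longrightarrow> y \<in> R \<Longrightarrow> x + y \<in> R" "0 \<in> R" "\<And>x y. x \<in> R \<Longrightarrow> y \<in> R \<Longrightarrow> x * y \<in> R"
    and p: "p \<in> mpolys R X" and q: "q \<in> mpolys R X"
  shows "p * q \<in> mpolys R X"
proof -
  let ?s = "\<lambda>p m. Poly_Mapping.single m (Poly_Mapping.lookup p m)"
  let ?P = "Poly_Mapping.keys p" and ?Q = "Poly_Mapping.keys q"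
  have "p * q = (\<Sum>m\<in>?P. ?s p m) * (\<Sum>k\<in>?Q. ?s q k)"
    by (simp only: mpoly_sum_single)
  also have "\<dots> = (\<Sum>m\<in>?P. \<Sum>k\<in>?Q. Poly_Mapping.single (m + k) (Poly_Mapping.lookup p m * Poly_Mapping.lookup q k))"
    by (simp add: sum_product mult_single)
  also have "\<dots> \<in> mpolys R X"
  proof (intro mpolys_sum R(1,2))
    fix m k assume mk: "m \<in> ?P" "k \<in> ?Q"
    then have "Poly_Mapping.keys (m + k) \<subseteq> X"
      using p q keys_add[of m k] by (fastforce simp: mpolys_def)
    moreover have "Poly_Mapping.lookup p m * Poly_Mapping.lookup q k \<in> R"
      using mk p q R(3) by (auto simp: mpolys_def)
    ultimately show "Poly_Mapping.single (m + k) (Poly_Mapping.lookup p m * Poly_Mapping.lookup q k) \<in> mpolys R X"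
      by (auto simp: mpolys_def)
  qed
  finally show ?thesis .
qed

text \<open>The way back from functions to formal polynomials, through which the coefficients of
  \<open>F\<close> are obtained. With the set of constants empty only integers enter, and these lie
  in \<open>gauss_ints\<close>.\<close>

lemma polyfuns_imp_mpoly:
  assumes "f \<in> polyfuns {} (projs X)"
  shows "\<exists>p \<in> mpolys gauss_ints X. \<forall>a. eval_mpoly a p = f a"
  using assms
proof induction
  case (const c)
  then have "c \<in> gauss_ints" by (auto simp: gauss_ints_def elim!: Ints_cases)
  then show ?case
    by (intro bexI[of _ "Poly_Mapping.single 0 c"]) (auto simp: mpolys_def eval_monom_def)
next
  case (base f)
  then obtain i where "i \<in> X" "f = (\<lambda>y. y i)" by (auto simp: projs_def)
  then show ?case
    by (intro bexI[of _ "Poly_Mapping.single (Poly_Mapping.single i 1) 1"])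
      (auto simp: mpolys_def eval_monom_def gauss_ints_def)
next
  case (add f g)
  then obtain p q where "p \<in> mpolys gauss_ints X" "q \<in> mpolys gauss_ints X"
    "\<forall>a. eval_mpoly a p = f a" "\<forall>a. eval_mpoly a q = g a" by blast
  then show ?case
    by (intro bexI[of _ "p + q"] mpolys_add) (auto simp: gauss_ints_def)
next
  case (mult f g)
  then obtain p q where "p \<in> mpolys gauss_ints X" "q \<in> mpolys gauss_ints X"
    "\<forall>a. eval_mpoly a p = f a" "\<forall>a. eval_mpoly a q = g a" by blast
  then show ?case
    by (intro bexI[of _ "p * q"] mpolys_mult) (auto simp: gauss_ints_def)
qed

lemma digit_sum_less:
  fixes u :: "nat \<Rightarrow> nat"
  assumes "\<And>x. x < L \<Longrightarrow> u x < N"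
  shows "(\<Sum>x<L. u x * N ^ x) < N ^ L"
  using assms
proof (induction L)
  case (Suc L)
  then have "(\<Sum>x<L. u x * N ^ x) < N ^ L" by simp
  moreover have "u L * N ^ L + N ^ L \<le> N ^ Suc L"
    using mult_le_mono1[of "Suc (u L)" N "N ^ L"] Suc.prems[of L] by simp
  ultimately show ?case by simp
qed simp

text \<open>Uniqueness of digits in base \<open>N\<close>: the top digit is a quotient by
  \<open>N ^ L\<close>, the others follow by induction. It keeps distinct monomials apart in the
  substitution below.\<close>

lemma digit_sum_inject:
  fixes u v :: "nat \<Rightarrow> nat"
  assumes "\<And>x. x < L \<Longrightarrow> u x < N" "\<And>x. x < L \<Longrightarrow> v x < N"
    and "(\<Sum>x<L. u x * N ^ x) = (\<Sum>x<L. v x * N ^ x)" "x < L"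
  shows "u x = v x"
  using assms
proof (induction L)
  case (Suc L)
  let ?U = "\<Sum>x<L. u x * N ^ x" and ?V = "\<Sum>x<L. v x * N ^ x"
  have lt: "?U < N ^ L" "?V < N ^ L" using Suc.prems by (auto intro!: digit_sum_less)
  have eq: "?U + u L * N ^ L = ?V + v L * N ^ L" using Suc.prems(3) by simp
  have "(a + b * N ^ L) div N ^ L = b" if "a < N ^ L" for a b
  proof -
    have "N ^ L \<noteq> 0" using that by linarith
    then show ?thesis using that div_mult_self1[of "N ^ L" a b] by (simp del: power_eq_0_iff)
  qed
  then have "u L = (?U + u L * N ^ L) div N ^ L" "v L = (?V + v L * N ^ L) div N ^ L"
    using lt by simp_all
  then have "u L = v L" using eq by simp
  with eq have "?U = ?V" by simp
  with Suc \<open>u L = v L\<close> show ?case by (cases "x = L") auto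
qed simp

text \<open>Kronecker substitution: \<open>x\<^sub>i \<mapsto> t ^ (N ^ i)\<close> with \<open>N\<close> above all exponents.\<close>

lemma mpoly_nonzero_eval:
  assumes "p \<noteq> (0 :: mpoly)"
  shows "\<exists>a. eval_mpoly a p \<noteq> 0"
proof -
  let ?K = "Poly_Mapping.keys p"
  have "finite (\<Union>m\<in>?K. Poly_Mapping.keys m)" by simp
  then obtain L where L: "\<And>m x. m \<in> ?K \<Longrightarrow> x \<in> Poly_Mapping.keys m \<Longrightarrow> x < L"
    unfolding finite_nat_set_iff_bounded by blast
  have "finite (\<Union>m\<in>?K. Poly_Mapping.lookup m ` {..<L})" by simp
  then obtain N where N: "\<And>m x. m \<in> ?K \<Longrightarrow> x < L \<Longrightarrow> Poly_Mapping.lookup m x < N"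
    unfolding finite_nat_set_iff_bounded by blast
  define e :: "(nat \<Rightarrow>\<^sub>0 nat) \<Rightarrow> nat" where "e m = (\<Sum>x<L. Poly_Mapping.lookup m x * N ^ x)" for m
  have inj: "inj_on e ?K"
  proof (rule inj_onI, rule poly_mapping_eqI)
    fix m k x assume mk: "m \<in> ?K" "k \<in> ?K" "e m = e k"
    show "Poly_Mapping.lookup m x = Poly_Mapping.lookup k x"
    proof (cases "x < L")
      case True
      then show ?thesis using digit_sum_inject[of L "Poly_Mapping.lookup m" N "Poly_Mapping.lookup k" x] N mk
        by (auto simp: e_def)
    next
      case False
      then show ?thesis using L[OF mk(1), of x] L[OF mk(2), of x] by (metis in_keys_iff)
    qed
  qed
  define Q where "Q = (\<Sum>m\<in>?K. Polynomial.monom (Poly_Mapping.lookup p m) (e m))"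
  have ev: "eval_mpoly (\<lambda>x. t ^ (N ^ x)) p = poly Q t" for t
  proof -
    have "eval_monom (\<lambda>x. t ^ (N ^ x)) m = t ^ e m" if "m \<in> ?K" for m
    proof -
      have "Poly_Mapping.keys m \<subseteq> {..<L}" using L that by blast
      then show ?thesis
        by (simp add: eval_monom_superset[of "{..<L}"] e_def power_sum flip: power_mult)
          (simp add: mult.commute)
    qed
    then show ?thesis
      by (simp add: eval_mpoly_superset[of ?K] Q_def poly_sum poly_monom)
  qed
  obtain m0 where m0: "m0 \<in> ?K" using assms by (auto simp flip: keys_eq_empty)
  have "coeff Q (e m0) = (\<Sum>m\<in>?K. if m = m0 then Poly_Mapping.lookup p m else 0)"
    unfolding Q_def coeff_sum using inj m0 by (intro sum.cong) (auto simp: inj_on_def)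
  also have "\<dots> \<noteq> 0" using m0 by (simp add: in_keys_iff)
  finally have "Q \<noteq> 0" by auto
  then show ?thesis using ev poly_all_0_iff_0 by metis
qed

subsection \<open>Symmetric functions\<close>

definition root_poly :: "nat \<Rightarrow> (nat \<Rightarrow> 'a :: comm_ring_1) \<Rightarrow> 'a poly" where
  "root_poly n y = (\<Prod>i<n. [:- y i, 1:])"

lemma root_poly_Suc: "root_poly (Suc n) y = [:- y n, 1:] * root_poly n y"
  by (simp add: root_poly_def mult.commute)

lemma root_poly_permutes:
  assumes "\<sigma> permutes {..<n}"
  shows "root_poly n (\<lambda>i. y (\<sigma> i)) = root_poly n y"
  unfolding root_poly_def using prod.permute[OF assms, of "\<lambda>i. [:- y i, 1:]"] by (simp add: o_def)

lemma degree_root_poly: "degree (root_poly n (y :: nat \<Rightarrow> 'a :: idom)) = n"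
  unfolding root_poly_def by (simp add: degree_prod_eq_sum_degree)

lemma lead_coeff_root_poly: "coeff (root_poly n (y :: nat \<Rightarrow> 'a :: idom)) n = 1"
proof -
  have "lead_coeff (root_poly n y) = 1" unfolding root_poly_def by (simp add: lead_coeff_prod)
  then show ?thesis by (simp add: degree_root_poly)
qed

lemma poly_root_poly: "i < n \<Longrightarrow> poly (root_poly n y) (y i) = 0"
  by (auto simp: root_poly_def poly_prod intro!: prod_zero)

lemma root_power_reduce:
  assumes "i < n"
  shows "(y i :: complex) ^ n = (\<Sum>j<n. - coeff (root_poly n y) j * y i ^ j)"
proof -
  have "0 = (\<Sum>j\<le>n. coeff (root_poly n y) j * y i ^ j)"
    using poly_root_poly[OF assms, of y] by (simp add: poly_altdef degree_root_poly)
  then show ?thesis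
    by (simp add: lessThan_Suc_atMost[symmetric] lead_coeff_root_poly sum_negf eq_neg_iff_add_eq_0)
      (simp add: add.commute)
qed

text \<open>Up to sign the coefficients are the elementary symmetric functions of the first
  \<open>n\<close> variables. The variables from \<open>n\<close> on are parameters untouched by the
  permutations; they will carry the moments of the pencil.\<close>

definition sym_gens :: "nat \<Rightarrow> ((nat \<Rightarrow> complex) \<Rightarrow> complex) set" where
  "sym_gens n = range (\<lambda>k y. coeff (root_poly n y) k) \<union> projs {n..}"

lemma sym_gens_cases:
  assumes "g \<in> sym_gens n"
  obtains k where "g = (\<lambda>y. coeff (root_poly n y) k)" | i where "i \<ge> n" "g = (\<lambda>y. y i)"
  using assms by (auto simp: sym_gens_def projs_def)

lemma sym_gens_coeff: "(\<lambda>y. coeff (root_poly n y) k) \<in> polyfuns C (sym_gens n)"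
  by (intro polyfuns.base) (auto simp: sym_gens_def)

lemma sym_gens_proj: "i \<ge> n \<Longrightarrow> (\<lambda>y. y i) \<in> polyfuns C (sym_gens n)"
  by (intro polyfuns.base) (auto simp: sym_gens_def projs_def)

lemma polyfuns_sym_gens_permutes:
  assumes "f \<in> polyfuns C (sym_gens n)" "\<sigma> permutes {..<n}"
  shows "f (\<lambda>i. y (\<sigma> i)) = f y"
  using assms(1)
proof induction
  case (base g)
  then show ?case using assms(2)
    by (cases rule: sym_gens_cases) (auto simp: root_poly_permutes permutes_not_in)
qed auto

lemma polyfuns_sym_gens_projs:
  assumes "f \<in> polyfuns C (sym_gens n)"
  shows "f \<in> polyfuns C (projs UNIV)"
proof -
  have c: "coeffs_in (polyfuns C (projs UNIV)) (\<lambda>y. root_poly n y)"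
    unfolding root_poly_def
    by (intro coeffs_in_prod coeffs_in_linear polyfuns_intros polyfuns_proj) auto
  show ?thesis
    using polyfuns_subst[OF assms, where r = id and H = "projs UNIV"]
    by (auto elim!: sym_gens_cases intro: coeffs_inD[OF c] polyfuns_proj)
qed

text \<open>The elements of the ring generated by the symmetric functions of one more variable
  \<open>y\<^sub>n\<close> and by \<open>y\<^sub>n\<close> itself have degree at most \<open>n\<close> in \<open>y\<^sub>n\<close>.\<close>

definition reduced :: "complex set \<Rightarrow> nat \<Rightarrow> ((nat \<Rightarrow> complex) \<Rightarrow> complex) set" where
  "reduced C n = {f. \<exists>q. (\<forall>j. q j \<in> polyfuns C (sym_gens (Suc n))) \<and> f = (\<lambda>y. \<Sum>j\<le>n. q j y * y n ^ j)}"

lemma reducedI: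
  "(\<And>j. q j \<in> polyfuns C (sym_gens (Suc n))) \<Longrightarrow> (\<And>y. f y = (\<Sum>j\<le>n. q j y * y n ^ j)) \<Longrightarrow> f \<in> reduced C n"
  by (auto simp: reduced_def)

lemma reduced_base:
  assumes "f \<in> polyfuns C (sym_gens (Suc n))"
  shows "f \<in> reduced C n"
proof (rule reducedI)
  show "(if j = 0 then f else (\<lambda>_. 0)) \<in> polyfuns C (sym_gens (Suc n))" for j
    using assms by (auto intro: polyfuns.const)
  show "f y = (\<Sum>j\<le>n. (if j = 0 then f else (\<lambda>_. 0)) y * y n ^ j)" for y
    by (simp add: if_distrib if_distribR sum.delta cong: if_cong)
qed

lemma reduced_add: "f \<in> reduced C n \<Longrightarrow> g \<in> reduced C n \<Longrightarrow> (\<lambda>y. f y + g y) \<in> reduced C n"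
proof -
  assume "f \<in> reduced C n" "g \<in> reduced C n"
  then obtain p q where p: "\<And>j. p j \<in> polyfuns C (sym_gens (Suc n))" "f = (\<lambda>y. \<Sum>j\<le>n. p j y * y n ^ j)"
    and q: "\<And>j. q j \<in> polyfuns C (sym_gens (Suc n))" "g = (\<lambda>y. \<Sum>j\<le>n. q j y * y n ^ j)"
    unfolding reduced_def by auto
  show ?thesis
    by (rule reducedI[of "\<lambda>j y. p j y + q j y"])
      (auto simp: p(2) q(2) sum.distrib algebra_simps intro: polyfuns.add p(1) q(1))
qed

lemma reduced_scale:
  assumes "c \<in> polyfuns C (sym_gens (Suc n))" "f \<in> reduced C n"
  shows "(\<lambda>y. c y * f y) \<in> reduced C n"
proof -
  obtain p where p: "\<And>j. p j \<in> polyfuns C (sym_gens (Suc n))" "f = (\<lambda>y. \<Sum>j\<le>n. p j y * y n ^ j)"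
    using assms(2) unfolding reduced_def by auto
  show ?thesis
    by (rule reducedI[of "\<lambda>j y. c y * p j y"])
      (auto simp: p(2) sum_distrib_left algebra_simps intro: polyfuns.mult p(1) assms(1))
qed

text \<open>\<open>y n\<close> is a root of the monic \<open>root_poly (Suc n) y\<close>, so its
  power \<open>n + 1\<close> can be traded for lower powers.\<close>

lemma reduced_shift:
  assumes "f \<in> reduced C n"
  shows "(\<lambda>y. y n * f y) \<in> reduced C n"
proof -
  obtain p where p: "\<And>j. p j \<in> polyfuns C (sym_gens (Suc n))" "f = (\<lambda>y. \<Sum>j\<le>n. p j y * y n ^ j)"
    using assms unfolding reduced_def by auto
  define q where "q j = (\<lambda>y. (if j = 0 then 0 else p (j - 1) y) - p n y * coeff (root_poly (Suc n) y) j)" for j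
  show ?thesis
  proof (rule reducedI[of q])
    show "q j \<in> polyfuns C (sym_gens (Suc n))" for j
      unfolding q_def
      by (cases "j = 0") (auto intro!: polyfuns_intros p(1) sym_gens_coeff)
    show "y n * f y = (\<Sum>j\<le>n. q j y * y n ^ j)" for y
    proof -
      have "y n * f y = (\<Sum>j\<le>n. p j y * y n ^ Suc j)"
        unfolding p(2) by (simp add: sum_distrib_left algebra_simps)
      also have "\<dots> = (\<Sum>j<n. p j y * y n ^ Suc j) + p n y * y n ^ Suc n"
        by (simp flip: lessThan_Suc_atMost)
      also have "y n ^ Suc n = (\<Sum>j\<le>n. - coeff (root_poly (Suc n) y) j * y n ^ j)"
        using root_power_reduce[of n "Suc n" y] by (simp add: lessThan_Suc_atMost)
      also have "(\<Sum>j<n. p j y * y n ^ Suc j) = (\<Sum>j\<le>n. (if j = 0 then 0 else p (j - 1) y) * y n ^ j)"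
        by (subst lessThan_Suc_atMost[symmetric], subst sum.lessThan_Suc_shift) simp
      finally show ?thesis
        unfolding q_def by (simp add: algebra_simps sum.distrib sum_subtractf sum_distrib_left sum_negf)
    qed
  qed
qed

lemma reduced_mult:
  assumes "f \<in> reduced C n" "g \<in> reduced C n"
  shows "(\<lambda>y. f y * g y) \<in> reduced C n"
proof -
  obtain p where p: "\<And>j. p j \<in> polyfuns C (sym_gens (Suc n))" "f = (\<lambda>y. \<Sum>j\<le>n. p j y * y n ^ j)"
    using assms(1) unfolding reduced_def by auto
  have pw: "(\<lambda>y. y n ^ j * g y) \<in> reduced C n" for j
  proof (induction j)
    case (Suc j)
    then show ?case using reduced_shift[OF Suc] by (simp add: algebra_simps)
  qed (simp add: assms(2))
  have "(\<lambda>y. \<Sum>j\<in>J. p j y * (y n ^ j * g y)) \<in> reduced C n" if "finite J" for J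
    using that
  proof induction
    case empty
    show ?case using reduced_base[OF polyfuns.const[of 0]] by simp
  next
    case (insert j J)
    then show ?case using reduced_add[OF reduced_scale[OF p(1) pw]] by simp
  qed
  from this[of "{..n}"] show ?thesis
    by (simp add: p(2) sum_distrib_right mult.assoc)
qed

lemma reduced_proj: "(\<lambda>y. y n) \<in> reduced C n"
  using reduced_shift[OF reduced_base[OF polyfuns.const[of 1]]] by simp

lemma coeff_root_poly_Suc:
  "coeff (root_poly n y) k = coeff (root_poly (Suc n) y) (Suc k) + y n * coeff (root_poly n y) (Suc k)"
  by (simp add: root_poly_Suc)

text \<open>Synthetic division of \<open>root_poly (Suc n) y\<close> by the factor of the root
  \<open>y n\<close>: each coefficient of the quotient comes from the next higher one, so the
  induction descends from the leading coefficient.\<close>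

lemma reduced_coeff: "(\<lambda>y. coeff (root_poly n y) k) \<in> reduced C n"
proof (induction "n - k" arbitrary: k)
  case 0
  have "(\<lambda>y :: nat \<Rightarrow> complex. coeff (root_poly n y) k) = (\<lambda>y. if k = n then 1 else 0)"
    using 0 lead_coeff_root_poly by (auto simp: fun_eq_iff degree_root_poly intro!: coeff_eq_0)
  then show ?case by (auto intro!: reduced_base polyfuns.const)
next
  case (Suc d)
  then have "(\<lambda>y. coeff (root_poly n y) (Suc k)) \<in> reduced C n" by simp
  then show ?case
    by (subst coeff_root_poly_Suc)
      (intro reduced_add reduced_shift reduced_base[OF sym_gens_coeff])
qed

lemma polyfuns_sym_gens_reduced:
  assumes "f \<in> polyfuns C (sym_gens n)"
  shows "f \<in> reduced C n"
  using assms
proof induction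
  case (const c) then show ?case by (intro reduced_base polyfuns.const)
next
  case (base g)
  then show ?case
  proof (cases rule: sym_gens_cases)
    case (2 i)
    then show ?thesis
      by (cases "i = n") (auto intro!: reduced_proj reduced_base[OF sym_gens_proj])
  qed (auto intro: reduced_coeff)
qed (auto intro: reduced_add reduced_mult)

definition vandermonde :: "nat \<Rightarrow> (nat \<Rightarrow> complex) \<Rightarrow> complex" where
  "vandermonde n y = (\<Prod>j<n. \<Prod>i<j. y j - y i)"

lemma vandermonde_nonzero: "vandermonde n y \<noteq> 0 \<longleftrightarrow> inj_on y {..<n}"
proof
  assume v: "vandermonde n y \<noteq> 0"
  have "False" if "i < j" "j < n" "y i = y j" for i j
  proof -
    have "(\<Prod>i<j. y j - y i) = 0" using that by (intro prod_zero) (auto intro!: bexI[of _ i])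
    then have "vandermonde n y = 0" unfolding vandermonde_def using that by (intro prod_zero) auto
    then show False using v by simp
  qed
  then show "inj_on y {..<n}" by (metis inj_onI lessThan_iff linorder_neqE_nat)
next
  assume "inj_on y {..<n}"
  then show "vandermonde n y \<noteq> 0" unfolding vandermonde_def by (auto dest!: inj_onD)
qed

lemma vandermonde_polyfuns: "vandermonde n \<in> polyfuns C (projs {..<n})"
  unfolding vandermonde_def[abs_def]
  by (intro polyfuns_intros polyfuns_proj) auto

text \<open>\<open>f = \<Sum>j\<le>n. q j * y\<^sub>n ^ j\<close> with \<open>q j\<close> symmetric; if \<open>f\<close> is symmetric too, then \<open>y\<^sub>n\<close> may be
  replaced by any \<open>y\<^sub>i\<close>, so the polynomial \<open>f - \<Sum>j\<le>n. q j X ^ j\<close> has too many roots.\<close>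

theorem symmetric_functions:
  assumes "f \<in> polyfuns C (projs UNIV)"
    and "\<And>\<sigma> y. \<sigma> permutes {..<n} \<Longrightarrow> f (\<lambda>i. y (\<sigma> i)) = f y"
  shows "f \<in> polyfuns C (sym_gens n)"
  using assms(2)
proof (induction n)
  case 0
  show ?case
    by (rule polyfuns_mono[OF assms(1)]) (auto simp: sym_gens_def projs_def)
next
  case (Suc n)
  have "f \<in> polyfuns C (sym_gens n)"
    by (rule Suc.IH) (auto intro!: Suc.prems elim: permutes_subset)
  then obtain q where q: "\<And>j. q j \<in> polyfuns C (sym_gens (Suc n))"
    and f: "f = (\<lambda>y. \<Sum>j\<le>n. q j y * y n ^ j)"
    using polyfuns_sym_gens_reduced unfolding reduced_def by blast
  have f': "f y = (\<Sum>j\<le>n. q j y * y i ^ j)" if i: "i \<le> n" for i y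
  proof -
    define \<sigma> where "\<sigma> = transpose i n"
    have \<sigma>: "\<sigma> permutes {..<Suc n}" unfolding \<sigma>_def using i by (intro permutes_swap_id) auto
    have "f y = f (\<lambda>i. y (\<sigma> i))" using Suc.prems[OF \<sigma>] by simp
    also have "\<dots> = (\<Sum>j\<le>n. q j (\<lambda>i. y (\<sigma> i)) * y i ^ j)" by (simp add: f \<sigma>_def)
    also have "\<dots> = (\<Sum>j\<le>n. q j y * y i ^ j)"
      using polyfuns_sym_gens_permutes[OF q \<sigma>] by simp
    finally show ?thesis .
  qed
  have eq: "f y = q 0 y" if inj: "inj_on y {..<Suc n}" for y
  proof -
    define P where "P = (\<Sum>j\<le>n. Polynomial.monom (q j y) j) - [:f y:]"
    have "degree P \<le> n" unfolding P_def
      by (intro degree_diff_le degree_sum_le) (auto intro: order.trans[OF degree_monom_le])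
    moreover have "poly P x = 0" if "x \<in> y ` {..n}" for x
      using that f' by (auto simp: P_def poly_sum poly_monom)
    moreover have "card (y ` {..n}) = Suc n"
      using inj by (simp add: card_image lessThan_Suc_atMost)
    ultimately have "P = 0"
      using poly_roots_finite[of P] card_poly_roots_bound[of P]
        card_mono[of "{x. poly P x = 0}" "y ` {..n}"] by fastforce
    then have "coeff P 0 = 0" by simp
    then show ?thesis by (simp add: P_def coeff_sum sum.delta)
  qed
  \<comment> \<open>At points with repeated coordinates the count of roots fails. But a nonzero
    value of \<open>f - q 0\<close> somewhere would give one at a point with nonzero Vandermonde
    product as well; \<open>of_nat\<close> is a point with distinct coordinates.\<close>
  have "f y = q 0 y" for y
  proof (rule ccontr)
    assume ne: "f y \<noteq> q 0 y"
    have "f \<in> polyfuns UNIV (projs UNIV)" "q 0 \<in> polyfuns UNIV (projs UNIV)"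
      by (rule polyfuns_mono[OF assms(1)] polyfuns_mono[OF polyfuns_sym_gens_projs[OF q]]; simp)+
    then have "(\<lambda>y. f y - q 0 y) \<in> polyfuns UNIV (projs UNIV)" by (rule polyfuns_diff)
    moreover have "vandermonde (Suc n) \<in> polyfuns UNIV (projs UNIV)"
      by (rule polyfuns_mono[OF vandermonde_polyfuns]) (auto simp: projs_def)
    moreover have "vandermonde (Suc n) of_nat \<noteq> 0" by (simp add: vandermonde_nonzero)
    ultimately obtain z where "f z - q 0 z \<noteq> 0" "vandermonde (Suc n) z \<noteq> 0"
      using polyfuns_nonzero_common[of "\<lambda>y. f y - q 0 y" "vandermonde (Suc n)" y of_nat] ne by auto
    then show False using eq[of z] by (simp add: vandermonde_nonzero)
  qed
  then have "f = q 0" by blast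
  then show ?case using q by simp
qed

section \<open>Functions even in each of the first variables\<close>

definition even_gens :: "nat \<Rightarrow> ((nat \<Rightarrow> complex) \<Rightarrow> complex) set" where
  "even_gens n = (\<lambda>i y. if i < n then (y i)\<^sup>2 else y i) ` UNIV"

lemma even_gens_I: "(\<lambda>y. if i < n then (y i)\<^sup>2 else y i) \<in> polyfuns C (even_gens n)"
  by (intro polyfuns.base) (auto simp: even_gens_def)

text \<open>\<open>p\<close> and \<open>q * y n\<close> are the even and the odd part in
  \<open>y n\<close>. A product of two odd parts is even because the square of \<open>y n\<close> is
  among the new generators.\<close>

lemma even_step:
  assumes "f \<in> polyfuns C (even_gens n)"
  shows "\<exists>p q. p \<in> polyfuns C (even_gens (Suc n)) \<and> q \<in> polyfuns C (even_gens (Suc n)) \<and>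
    f = (\<lambda>y. p y + q y * y n)"
  using assms
proof induction
  case (const c)
  then show ?case
    by (intro exI[of _ "\<lambda>_. c"] exI[of _ "\<lambda>_. 0"]) (auto intro: polyfuns.const)
next
  case (base f)
  then obtain i where f: "f = (\<lambda>y. if i < n then (y i)\<^sup>2 else y i)" by (auto simp: even_gens_def)
  show ?case
  proof (cases "i = n")
    case True
    then show ?thesis
      by (intro exI[of _ "\<lambda>_. 0"] exI[of _ "\<lambda>_. 1"]) (auto simp: f intro: polyfuns.const)
  next
    case False
    then have "f = (\<lambda>y. if i < Suc n then (y i)\<^sup>2 else y i)" by (auto simp: f)
    then show ?thesis
      using even_gens_I[of i "Suc n" C]
      by (intro exI[of _ f] exI[of _ "\<lambda>_. 0"]) (auto intro: polyfuns.const)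
  qed
next
  case (add f g)
  then obtain p q p' q' where *: "p \<in> polyfuns C (even_gens (Suc n))" "q \<in> polyfuns C (even_gens (Suc n))"
    "p' \<in> polyfuns C (even_gens (Suc n))" "q' \<in> polyfuns C (even_gens (Suc n))"
    "f = (\<lambda>y. p y + q y * y n)" "g = (\<lambda>y. p' y + q' y * y n)" by blast
  show ?case
    by (intro exI[of _ "\<lambda>y. p y + p' y"] exI[of _ "\<lambda>y. q y + q' y"])
      (auto simp: *(5,6) algebra_simps intro!: polyfuns_intros *(1-4))
next
  case (mult f g)
  then obtain p q p' q' where *: "p \<in> polyfuns C (even_gens (Suc n))" "q \<in> polyfuns C (even_gens (Suc n))"
    "p' \<in> polyfuns C (even_gens (Suc n))" "q' \<in> polyfuns C (even_gens (Suc n))"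
    "f = (\<lambda>y. p y + q y * y n)" "g = (\<lambda>y. p' y + q' y * y n)" by blast
  have sq: "(\<lambda>y. (y n)\<^sup>2) \<in> polyfuns C (even_gens (Suc n))" using even_gens_I[of n "Suc n"] by simp
  let ?p = "\<lambda>y. p y * p' y + q y * q' y * (y n)\<^sup>2" and ?q = "\<lambda>y. p y * q' y + q y * p' y"
  have "?p \<in> polyfuns C (even_gens (Suc n))" "?q \<in> polyfuns C (even_gens (Suc n))"
    by (intro polyfuns.add polyfuns.mult *(1-4) sq)+
  moreover have "(\<lambda>y. f y * g y) = (\<lambda>y. ?p y + ?q y * y n)"
    by (auto simp: *(5,6) algebra_simps power2_eq_square)
  ultimately show ?case by blast
qed

text \<open>One variable at a time: negating \<open>y n\<close> turns \<open>p + q * y n\<close>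
  into \<open>p - q * y n\<close>, so invariance kills the odd part.\<close>

lemma even_functions_aux:
  assumes "f \<in> polyfuns C (projs UNIV)"
    and "\<And>i y. i < n \<Longrightarrow> f (y(i := - y i)) = f y"
  shows "f \<in> polyfuns C (even_gens n)"
  using assms(2)
proof (induction n)
  case 0
  show ?case
    by (rule polyfuns_mono[OF assms(1)]) (auto simp: even_gens_def projs_def)
next
  case (Suc n)
  have "f \<in> polyfuns C (even_gens n)" using Suc by simp
  from even_step[OF this] obtain p q where p: "p \<in> polyfuns C (even_gens (Suc n))"
    and q: "q \<in> polyfuns C (even_gens (Suc n))" and f: "f = (\<lambda>y. p y + q y * y n)" by blast
  have ev: "h (y(n := - y n)) = h y" if "h \<in> polyfuns C (even_gens (Suc n))" for h y
    using that by induction (auto simp: even_gens_def)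
  have "f y = p y" for y
  proof -
    have "f y = f (y(n := - y n))" by (rule Suc.prems[symmetric]) simp
    also have "\<dots> = p y - q y * y n" unfolding f by (simp only: ev[OF p] ev[OF q] fun_upd_same) simp
    finally show ?thesis by (simp add: f)
  qed
  then have "f = p" by blast
  with p show ?case by simp
qed

theorem even_functions:
  fixes n :: nat
  assumes "f \<in> polyfuns C (projs UNIV)"
    and "\<And>i y. i < n \<Longrightarrow> f (y(i := - y i)) = f y"
  shows "\<exists>h \<in> polyfuns C (projs UNIV). \<forall>y. f y = h (\<lambda>i. if i < n then (y i)\<^sup>2 else y i)"
proof -
  have "f \<in> polyfuns C (even_gens n)"
    by (rule even_functions_aux[OF assms(1)]) (rule assms(2))
  then show ?thesis
  proof induction
    case (base f)
    then obtain i where "f = (\<lambda>y. if i < n then (y i)\<^sup>2 else y i)" by (auto simp: even_gens_def)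
    then show ?case by (intro bexI[of _ "\<lambda>y. y i"] polyfuns_proj) auto
  next
    case (const c)
    then show ?case by (intro bexI[of _ "\<lambda>_. c"]) (auto intro: polyfuns.const)
  next
    case (add f g)
    then obtain h k where *: "h \<in> polyfuns C (projs UNIV)" "k \<in> polyfuns C (projs UNIV)"
      "\<forall>y. f y = h (\<lambda>i. if i < n then (y i)\<^sup>2 else y i)" "\<forall>y. g y = k (\<lambda>i. if i < n then (y i)\<^sup>2 else y i)" by blast
    show ?case by (intro bexI[of _ "\<lambda>y. h y + k y"] polyfuns_intros) (auto simp: *)
  next
    case (mult f g)
    then obtain h k where *: "h \<in> polyfuns C (projs UNIV)" "k \<in> polyfuns C (projs UNIV)"
      "\<forall>y. f y = h (\<lambda>i. if i < n then (y i)\<^sup>2 else y i)" "\<forall>y. g y = k (\<lambda>i. if i < n then (y i)\<^sup>2 else y i)" by blast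
    show ?case by (intro bexI[of _ "\<lambda>y. h y * k y"] polyfuns_intros) (auto simp: *)
  qed
qed

subsection \<open>The orbit polynomial\<close>

definition signed_sum :: "nat \<Rightarrow> nat set \<Rightarrow> (nat \<Rightarrow> 'a :: comm_ring_1) \<Rightarrow> 'a" where
  "signed_sum n I \<beta> = (\<Sum>i<n. if i \<in> I then - \<beta> i else \<beta> i)"

lemma signed_sum_cong:
  "(\<And>i. i < n \<Longrightarrow> \<beta> i = \<gamma> i) \<Longrightarrow> signed_sum n I \<beta> = signed_sum n I \<gamma>"
  unfolding signed_sum_def by (intro sum.cong) auto

lemma signed_sum_compl: "signed_sum n ({..<n} - I) \<beta> = - signed_sum n I \<beta>"
  unfolding signed_sum_def sum_negf[symmetric] by (intro sum.cong) auto

lemma signed_sum_flip: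
  "signed_sum n I (\<beta>(i := - \<beta> i)) = signed_sum n (sym_diff I {i}) \<beta>"
  unfolding signed_sum_def by (intro sum.cong) auto

lemma signed_sum_permutes:
  assumes "\<sigma> permutes {..<n}"
  shows "signed_sum n I (\<lambda>i. \<beta> (\<sigma> i)) = signed_sum n (\<sigma> ` I) \<beta>"
proof -
  have "\<sigma> i \<in> \<sigma> ` I \<longleftrightarrow> i \<in> I" for i
    using permutes_inj[OF assms] by (auto dest: injD)
  then show ?thesis
    unfolding signed_sum_def
    by (subst sum.permute[OF assms, of "\<lambda>i. if i \<in> \<sigma> ` I then - \<beta> i else \<beta> i"]) (simp add: o_def)
qed

text \<open>A sign vector up to a global sign is a set \<open>I\<close> of negative signs not containing \<open>n - 1\<close>.\<close>

definition orbit_poly :: "nat \<Rightarrow> (nat \<Rightarrow> 'a :: comm_ring_1) \<Rightarrow> 'a poly" where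
  "orbit_poly n \<beta> = (\<Prod>I\<in>Pow {..<n-1}. [:- (signed_sum n I \<beta>)\<^sup>2, 1:])"

lemma orbit_poly_cong:
  "(\<And>i. i < n \<Longrightarrow> \<beta> i = \<gamma> i) \<Longrightarrow> orbit_poly n \<beta> = orbit_poly n \<gamma>"
  unfolding orbit_poly_def using signed_sum_cong[of n \<beta> \<gamma>] by (intro prod.cong) auto

lemma degree_orbit_poly: "degree (orbit_poly n (\<beta> :: nat \<Rightarrow> 'a :: idom)) = 2 ^ (n - 1)"
  unfolding orbit_poly_def by (simp add: degree_prod_eq_sum_degree card_Pow)

lemma lead_coeff_orbit_poly: "lead_coeff (orbit_poly n (\<beta> :: nat \<Rightarrow> 'a :: idom)) = 1"
  unfolding orbit_poly_def by (simp add: lead_coeff_prod)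

text \<open>Complementary sets have opposite sums and equal squares, and exactly one of the two
  contains \<open>n - 1\<close>. The product over all subsets is visibly stable under sign changes
  and permutations, which the defining product over representatives is not.\<close>

lemma orbit_poly_square:
  assumes "n > 0"
  shows "(orbit_poly n \<beta>)\<^sup>2 = (\<Prod>I\<in>Pow {..<n}. [:- (signed_sum n I \<beta>)\<^sup>2, 1:])"
proof -
  let ?f = "\<lambda>I. [:- (signed_sum n I \<beta>)\<^sup>2, 1:]" and ?c = "\<lambda>I. {..<n} - I"
  have less: "i < n - 1 \<longleftrightarrow> i < n \<and> i \<noteq> n - 1" for i using assms by linarith
  have eq: "Pow {..<n} = Pow {..<n-1} \<union> ?c ` Pow {..<n-1}"
  proof (rule equalityI, rule subsetI)
    fix I assume I: "I \<in> Pow {..<n}"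
    show "I \<in> Pow {..<n-1} \<union> ?c ` Pow {..<n-1}"
    proof (cases "n - 1 \<in> I")
      case True
      have "?c I \<subseteq> {..<n-1}"
      proof
        fix i assume "i \<in> ?c I"
        then have "i < n" "i \<noteq> n - 1" using True by (simp, metis DiffD2)
        then show "i \<in> {..<n-1}" using less by simp
      qed
      moreover have "I = ?c (?c I)" using I by (simp add: double_diff)
      ultimately show ?thesis by (metis PowI UnI2 imageI)
    next
      case False
      have "I \<subseteq> {..<n-1}"
      proof
        fix i assume i: "i \<in> I"
        then have "i \<noteq> n - 1" using False by metis
        moreover have "i < n" using i I by blast
        ultimately show "i \<in> {..<n-1}" using less by simp
      qed
      then show ?thesis by (metis PowI UnI1)
    qed
  next
    show "Pow {..<n-1} \<union> ?c ` Pow {..<n-1} \<subseteq> Pow {..<n}"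
      by (intro Un_least Pow_mono image_subsetI PowI Diff_subset) auto
  qed
  have disj: "Pow {..<n-1} \<inter> ?c ` Pow {..<n-1} = {}"
  proof -
    have "n - 1 \<in> ?c I" "n - 1 \<notin> I" if "I \<in> Pow {..<n-1}" for I
    proof -
      show "n - 1 \<notin> I" using that by blast
      then show "n - 1 \<in> ?c I" using assms by simp
    qed
    then show ?thesis by blast
  qed
  have "inj_on ?c (Pow {..<n-1})"
    by (rule inj_on_inverseI[of _ ?c]) auto
  then have "prod ?f (?c ` Pow {..<n-1}) = (\<Prod>I\<in>Pow {..<n-1}. ?f (?c I))"
    by (rule prod.reindex_cong) simp_all
  also have "\<dots> = orbit_poly n \<beta>"
    unfolding orbit_poly_def by (simp only: signed_sum_compl power2_minus)
  finally have "prod ?f (?c ` Pow {..<n-1}) = orbit_poly n \<beta>" .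
  moreover have "prod ?f (Pow {..<n}) = prod ?f (Pow {..<n-1}) * prod ?f (?c ` Pow {..<n-1})"
    by (subst eq, rule prod.union_disjoint[OF _ _ disj]) simp_all
  ultimately show ?thesis unfolding orbit_poly_def power2_eq_square[of "prod _ _"] by simp
qed

text \<open>The squares agree because \<open>h\<close> only permutes the factors; both polynomials
  being monic, the square root has no sign ambiguity.\<close>

lemma orbit_poly_eqI:
  fixes \<beta> \<gamma> :: "nat \<Rightarrow> 'a :: {idom, ring_char_0}"
  assumes "n > 0" and "bij_betw h (Pow {..<n}) (Pow {..<n})"
    and "\<And>I. I \<subseteq> {..<n} \<Longrightarrow> signed_sum n I \<gamma> = signed_sum n (h I) \<beta>"
  shows "orbit_poly n \<gamma> = orbit_poly n \<beta>"
proof -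
  have "(orbit_poly n \<gamma>)\<^sup>2 = (\<Prod>I\<in>Pow {..<n}. [:- (signed_sum n (h I) \<beta>)\<^sup>2, 1:])"
    unfolding orbit_poly_square[OF assms(1)] using assms(3) by (intro prod.cong) auto
  also have "\<dots> = (orbit_poly n \<beta>)\<^sup>2"
    unfolding orbit_poly_square[OF assms(1)]
    by (rule prod.reindex_bij_betw[OF assms(2), of "\<lambda>I. [:- (signed_sum n I \<beta>)\<^sup>2, 1:]"])
  finally have "orbit_poly n \<gamma> = orbit_poly n \<beta> \<or> orbit_poly n \<gamma> = - orbit_poly n \<beta>"
    by (simp add: power2_eq_iff)
  moreover have "orbit_poly n \<gamma> \<noteq> - orbit_poly n \<beta>"
  proof
    assume "orbit_poly n \<gamma> = - orbit_poly n \<beta>"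
    then have "lead_coeff (orbit_poly n \<gamma>) = - lead_coeff (orbit_poly n \<beta>)" by simp
    then show False by (simp add: lead_coeff_orbit_poly)
  qed
  ultimately show ?thesis by blast
qed

lemma orbit_poly_flip:
  fixes \<beta> :: "nat \<Rightarrow> 'a :: {idom, ring_char_0}"
  assumes "i < n"
  shows "orbit_poly n (\<beta>(i := - \<beta> i)) = orbit_poly n \<beta>"
proof (rule orbit_poly_eqI[where h = "\<lambda>I. sym_diff I {i}"])
  show "bij_betw (\<lambda>I. sym_diff I {i}) (Pow {..<n}) (Pow {..<n})"
    by (rule bij_betw_byWitness[where f' = "\<lambda>I. sym_diff I {i}"]) (use assms in auto)
qed (use assms in \<open>auto simp: signed_sum_flip\<close>)

lemma orbit_poly_permutes:
  fixes \<beta> :: "nat \<Rightarrow> 'a :: {idom, ring_char_0}"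
  assumes "n > 0" "\<sigma> permutes {..<n}"
  shows "orbit_poly n (\<lambda>i. \<beta> (\<sigma> i)) = orbit_poly n \<beta>"
proof (rule orbit_poly_eqI[where h = "image \<sigma>"])
  have "bij_betw \<sigma> {..<n} {..<n}" by (rule permutes_imp_bij[OF assms(2)])
  then show "bij_betw (image \<sigma>) (Pow {..<n}) (Pow {..<n})" by (rule bij_betw_Pow)
qed (use assms in \<open>auto simp: signed_sum_permutes\<close>)

lemma coeffs_in_orbit_poly: "coeffs_in (polyfuns C (projs UNIV)) (orbit_poly n)"
proof -
  have s: "signed_sum n I \<in> polyfuns C (projs UNIV)" for I
  proof -
    have "(\<lambda>\<beta> :: nat \<Rightarrow> complex. if i \<in> I then - \<beta> i else \<beta> i) \<in> polyfuns C (projs UNIV)" for i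
      by (cases "i \<in> I", simp_all only: if_True if_False)
        (rule polyfuns_uminus polyfuns_proj UNIV_I)+
    then show ?thesis
      unfolding signed_sum_def[abs_def] by (rule polyfuns_sum)
  qed
  show ?thesis
    unfolding orbit_poly_def[abs_def]
    by (intro coeffs_in_prod coeffs_in_linear polyfuns_uminus polyfuns_power s)
qed

text \<open>Evenness in every \<open>\<beta> i\<close> turns the coefficients into functions of the
  squares, so the choice of the square roots does not matter.\<close>

lemma coeff_orbit_poly_squares:
  "\<exists>H \<in> polyfuns C (projs {..<n}). \<forall>a \<beta>. (\<forall>i<n. (\<beta> i)\<^sup>2 = a i) \<longrightarrow> coeff (orbit_poly n \<beta>) k = H a"
proof -
  have "\<exists>h \<in> polyfuns C (projs UNIV). \<forall>\<beta>. coeff (orbit_poly n \<beta>) k = h (\<lambda>i. if i < n then (\<beta> i)\<^sup>2 else \<beta> i)"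
    by (rule even_functions[OF coeffs_inD[OF coeffs_in_orbit_poly]]) (simp add: orbit_poly_flip)
  then obtain h where h: "h \<in> polyfuns C (projs UNIV)"
    "\<And>\<beta>. coeff (orbit_poly n \<beta>) k = h (\<lambda>i. if i < n then (\<beta> i)\<^sup>2 else \<beta> i)" by blast
  \<comment> \<open>\<open>orbit_poly n\<close> does not see the variables from \<open>n\<close> on,
    so they may be set to 0.\<close>
  define H where "H a = h (\<lambda>i. if i < n then a i else 0)" for a
  have "H \<in> polyfuns C (projs {..<n})"
    unfolding H_def[abs_def]
  proof (rule polyfuns_subst_projs[OF h(1)])
    fix i show "(\<lambda>x :: nat \<Rightarrow> complex. if i < n then x i else 0) \<in> polyfuns C (projs {..<n})"
      by (cases "i < n") (auto intro: polyfuns_proj polyfuns.const)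
  qed
  moreover have "coeff (orbit_poly n \<beta>) k = H a" if "\<forall>i<n. (\<beta> i)\<^sup>2 = a i" for a \<beta>
  proof -
    have "orbit_poly n \<beta> = orbit_poly n (\<lambda>i. if i < n then \<beta> i else 0)"
      by (rule orbit_poly_cong) simp
    also have "coeff \<dots> k = H a"
      unfolding h(2) H_def using that by (intro arg_cong[of _ _ h]) auto
    finally show ?thesis .
  qed
  ultimately show ?thesis by blast
qed

text \<open>For \<open>y\<^sub>0, \<dots>, y\<^sub>n\<^sub>-\<^sub>1\<close> the roots of a polynomial \<open>f\<close> and \<open>y\<^sub>n\<^sub>+\<^sub>l = \<Sum>i<n. \<mu>\<^sub>i * y\<^sub>i ^ l\<close> this is
  \<open>\<mu>\<^sub>i * f' y\<^sub>i\<close>.\<close>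

definition residue_at :: "nat \<Rightarrow> (nat \<Rightarrow> complex) \<Rightarrow> nat \<Rightarrow> complex" where
  "residue_at n y i = (\<Sum>l<n. coeff (\<Prod>j\<in>{..<n} - {i}. [:- y j, 1:]) l * y (n + l))"

text \<open>Summing the coefficients of a polynomial against the moments gives the sum of
  \<open>\<mu> m\<close> times its value at \<open>y m\<close>. The polynomial here vanishes at
  every \<open>y m\<close> except \<open>y i\<close>.\<close>

lemma residue_at_eq:
  assumes "\<And>l. l < n \<Longrightarrow> y (n + l) = (\<Sum>m<n. \<mu> m * y m ^ l)" "i < n"
  shows "residue_at n y i = \<mu> i * (\<Prod>j\<in>{..<n} - {i}. y i - y j)"
proof -
  let ?g = "\<Prod>j\<in>{..<n} - {i}. [:- y j, 1:]"
  have "degree ?g = n - 1"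
    using assms(2) by (subst degree_prod_eq_sum_degree) auto
  then have deg: "degree ?g < n" using assms(2) by simp
  have ev: "(\<Sum>l<n. coeff ?g l * y m ^ l) = poly ?g (y m)" for m
    unfolding poly_altdef by (rule sum.mono_neutral_right) (use deg in \<open>auto simp: coeff_eq_0\<close>)
  have "residue_at n y i = (\<Sum>l<n. \<Sum>m<n. \<mu> m * (coeff ?g l * y m ^ l))"
    unfolding residue_at_def
  proof (rule sum.cong[OF refl])
    fix l assume "l \<in> {..<n}"
    then have "y (n + l) = (\<Sum>m<n. \<mu> m * y m ^ l)" using assms(1) by simp
    then show "coeff ?g l * y (n + l) = (\<Sum>m<n. \<mu> m * (coeff ?g l * y m ^ l))"
      by (simp only: sum_distrib_left mult.left_commute)
  qed
  also have "\<dots> = (\<Sum>m<n. \<mu> m * poly ?g (y m))"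
    by (subst sum.swap) (simp only: ev sum_distrib_left[symmetric])
  also have "\<dots> = (\<Sum>m<n. if m = i then \<mu> i * poly ?g (y i) else 0)"
  proof (rule sum.cong[OF refl])
    fix m assume "m \<in> {..<n}"
    then have "poly ?g (y m) = 0" if "m \<noteq> i"
      using that unfolding poly_prod by (intro prod_zero) auto
    then show "\<mu> m * poly ?g (y m) = (if m = i then \<mu> i * poly ?g (y i) else 0)" by auto
  qed
  also have "\<dots> = \<mu> i * (\<Prod>j\<in>{..<n} - {i}. y i - y j)"
    using assms(2) by (simp add: poly_prod)
  finally show ?thesis .
qed

lemma residue_at_permutes:
  assumes "\<sigma> permutes {..<n}"
  shows "residue_at n (\<lambda>j. y (\<sigma> j)) i = residue_at n y (\<sigma> i)"
proof -
  have bij: "bij \<sigma>" by (rule permutes_bij[OF assms])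
  have "\<sigma> ` ({..<n} - {i}) = {..<n} - {\<sigma> i}"
    using bij permutes_image[OF assms] by (simp add: bij_is_inj image_set_diff)
  then have "bij_betw \<sigma> ({..<n} - {i}) ({..<n} - {\<sigma> i})"
    using inj_on_subset[OF bij_is_inj[OF bij] subset_UNIV] by (metis bij_betw_imageI)
  then have "(\<Prod>j\<in>{..<n} - {i}. [:- y (\<sigma> j), 1:]) = (\<Prod>j\<in>{..<n} - {\<sigma> i}. [:- y j, 1:])"
    by (rule prod.reindex_bij_betw)
  moreover have "\<sigma> (n + l) = n + l" for l
    using assms by (simp add: permutes_not_in)
  ultimately show ?thesis by (simp add: residue_at_def)
qed

lemma residue_at_polyfuns: "(\<lambda>y. residue_at n y i) \<in> polyfuns C (projs UNIV)"
proof -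
  have "coeffs_in (polyfuns C (projs UNIV)) (\<lambda>y. \<Prod>j\<in>{..<n} - {i}. [:- y j, 1:])"
    by (intro coeffs_in_prod coeffs_in_linear polyfuns_uminus polyfuns_proj) auto
  then show ?thesis
    unfolding residue_at_def
    by (intro polyfuns_sum polyfuns.mult coeffs_inD polyfuns_proj) auto
qed

text \<open>A permutation of the \<open>y i\<close> permutes the residues and with them their square
  roots, which \<open>orbit_poly\<close> ignores. The principal roots serve only to express
  \<open>H\<close> through \<open>orbit_poly\<close>.\<close>

lemma coeff_orbit_poly_residues:
  assumes "n > 0"
  shows "\<exists>H \<in> polyfuns C (sym_gens n).
    \<forall>y \<beta>. (\<forall>i<n. (\<beta> i)\<^sup>2 = residue_at n y i) \<longrightarrow> coeff (orbit_poly n \<beta>) k = H y"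
proof -
  from coeff_orbit_poly_squares[of C n k] obtain H where H: "H \<in> polyfuns C (projs {..<n})"
    "\<forall>a \<beta>. (\<forall>i<n. (\<beta> i)\<^sup>2 = a i) \<longrightarrow> coeff (orbit_poly n \<beta>) k = H a"
    by (elim bexE)
  have "(\<lambda>y. H (residue_at n y)) \<in> polyfuns C (sym_gens n)"
  proof (rule symmetric_functions)
    show "(\<lambda>y. H (residue_at n y)) \<in> polyfuns C (projs UNIV)"
      by (rule polyfuns_subst_projs[OF H(1) residue_at_polyfuns])
    fix \<sigma> y assume \<sigma>: "\<sigma> permutes {..<n}"
    define \<beta> where "\<beta> i = csqrt (residue_at n y i)" for i
    have "H (residue_at n (\<lambda>i. y (\<sigma> i))) = coeff (orbit_poly n (\<lambda>i. \<beta> (\<sigma> i))) k"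
      by (rule H(2)[rule_format, symmetric]) (simp add: \<beta>_def residue_at_permutes[OF \<sigma>])
    also have "\<dots> = coeff (orbit_poly n \<beta>) k"
      by (simp add: orbit_poly_permutes[OF assms \<sigma>])
    also have "\<dots> = H (residue_at n y)"
      by (rule H(2)[rule_format]) (simp add: \<beta>_def)
    finally show "H (residue_at n (\<lambda>i. y (\<sigma> i))) = H (residue_at n y)" .
  qed
  with H(2) show ?thesis by (intro bexI[of _ "\<lambda>y. H (residue_at n y)"]) simp_all
qed

text \<open>An expression in the generators becomes a function of \<open>b\<close> once the
  generators do. The point \<open>y\<close> is quantified because the roots are determined by
  \<open>b\<close> only up to their order.\<close>

lemma polyfuns_sym_gens_subst:
  assumes "f \<in> polyfuns C (sym_gens n)"
    and "\<And>k. c k \<in> polyfuns C G" "\<And>l. h l \<in> polyfuns C G"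
  shows "\<exists>p \<in> polyfuns C G. \<forall>b y. (\<forall>k. coeff (root_poly n y) k = c k b) \<longrightarrow>
    (\<forall>l. y (n + l) = h l b) \<longrightarrow> f y = p b"
proof -
  define hyp where "hyp b y \<longleftrightarrow> (\<forall>k. coeff (root_poly n y) k = c k b) \<and> (\<forall>l. y (n + l) = h l b)" for b y
  have "\<exists>p \<in> polyfuns C G. \<forall>b y. hyp b y \<longrightarrow> f y = p b"
    using assms(1)
  proof induction
    case (const a)
    then show ?case by (intro bexI[of _ "\<lambda>_. a"] polyfuns.const) auto
  next
    case (base g)
    then show ?case
    proof (cases rule: sym_gens_cases)
      case (1 k)
      then show ?thesis by (intro bexI[of _ "c k"] assms(2)) (simp add: hyp_def)
    next
      case (2 i)
      then obtain l where "i = n + l" by (metis le_add_diff_inverse)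
      with 2 show ?thesis by (intro bexI[of _ "h l"] assms(3)) (simp add: hyp_def)
    qed
  next
    case (add f g)
    then obtain p q where "p \<in> polyfuns C G" "q \<in> polyfuns C G"
      "\<forall>b y. hyp b y \<longrightarrow> f y = p b" "\<forall>b y. hyp b y \<longrightarrow> g y = q b" by blast
    then show ?case by (intro bexI[of _ "\<lambda>b. p b + q b"] polyfuns.add) simp_all
  next
    case (mult f g)
    then obtain p q where "p \<in> polyfuns C G" "q \<in> polyfuns C G"
      "\<forall>b y. hyp b y \<longrightarrow> f y = p b" "\<forall>b y. hyp b y \<longrightarrow> g y = q b" by blast
    then show ?case by (intro bexI[of _ "\<lambda>b. p b * q b"] polyfuns.mult) simp_all
  qed
  then show ?thesis unfolding hyp_def by (simp only: imp_conjL)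
qed

theorem orbit_mpoly_exists:
  assumes "n > 0"
    and c: "\<And>k. c k \<in> polyfuns {} (projs X)" and h: "\<And>l. h l \<in> polyfuns {} (projs X)"
  shows "\<exists>F :: mpoly poly. range (coeff F) \<subseteq> mpolys gauss_ints X \<and> degree F = 2 ^ (n - 1) \<and>
    (\<forall>b y \<beta>. (\<forall>k. coeff (root_poly n y) k = c k b) \<longrightarrow> (\<forall>l. y (n + l) = h l b) \<longrightarrow>
      (\<forall>i<n. (\<beta> i)\<^sup>2 = residue_at n y i) \<longrightarrow> map_poly (eval_mpoly b) F = orbit_poly n \<beta>)"
proof -
  let ?N = "2 ^ (n - 1) :: nat"
  define hyp where "hyp b y \<beta> \<longleftrightarrow> (\<forall>k. coeff (root_poly n y) k = c k b) \<and> (\<forall>l. y (n + l) = h l b) \<and>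
      (\<forall>i<n. (\<beta> i)\<^sup>2 = residue_at n y i)" for b y \<beta>
  have "\<exists>P \<in> mpolys gauss_ints X. \<forall>b y \<beta>. hyp b y \<beta> \<longrightarrow> eval_mpoly b P = coeff (orbit_poly n \<beta>) k" for k
  proof -
    from coeff_orbit_poly_residues[OF assms(1), of "{}" k]
    obtain H where H: "H \<in> polyfuns {} (sym_gens n)"
      "\<forall>y \<beta>. (\<forall>i<n. (\<beta> i)\<^sup>2 = residue_at n y i) \<longrightarrow> coeff (orbit_poly n \<beta>) k = H y"
      by (elim bexE)
    from polyfuns_sym_gens_subst[OF H(1), of c "projs X" h, OF c h] obtain p where p: "p \<in> polyfuns {} (projs X)"
      "\<forall>b y. (\<forall>k. coeff (root_poly n y) k = c k b) \<longrightarrow> (\<forall>l. y (n + l) = h l b) \<longrightarrow> H y = p b"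
      by (elim bexE)
    obtain P where "P \<in> mpolys gauss_ints X" "\<And>b. eval_mpoly b P = p b"
      using polyfuns_imp_mpoly[OF p(1)] by blast
    moreover have "p b = coeff (orbit_poly n \<beta>) k" if "hyp b y \<beta>" for b y \<beta>
    proof -
      have "p b = H y"
        by (rule p(2)[rule_format, symmetric]) (use that in \<open>simp_all add: hyp_def\<close>)
      also have "\<dots> = coeff (orbit_poly n \<beta>) k"
        by (rule H(2)[rule_format, symmetric]) (use that in \<open>simp add: hyp_def\<close>)
      finally show ?thesis .
    qed
    ultimately show ?thesis by (intro bexI[of _ P]) simp_all
  qed
  then obtain P where P: "\<And>k. P k \<in> mpolys gauss_ints X"
    "\<And>k b y \<beta>. hyp b y \<beta> \<Longrightarrow> eval_mpoly b (P k) = coeff (orbit_poly n \<beta>) k" by metis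
  \<comment> \<open>\<open>P ?N\<close> is only known to take the value 1 at points satisfying
    \<open>hyp\<close>; putting in the constant 1 fixes the degree and keeps all
    specializations.\<close>
  define F where "F = (\<Sum>k\<le>?N. Polynomial.monom (if k = ?N then 1 else P k) k)"
  have coeff_F: "coeff F k = (if k < ?N then P k else if k = ?N then 1 else 0)" for k
    unfolding F_def by (simp add: coeff_sum sum.delta)
  have deg: "degree F = ?N"
    by (rule antisym[OF degree_le le_degree]) (auto simp: coeff_F)
  have "0 \<in> mpolys gauss_ints X" "1 \<in> mpolys gauss_ints X"
    by (auto simp: mpolys_def gauss_ints_def lookup_one when_def)
  then have ran: "range (coeff F) \<subseteq> mpolys gauss_ints X"
    using P(1) by (auto simp: coeff_F)
  have "map_poly (eval_mpoly b) F = orbit_poly n \<beta>" if "hyp b y \<beta>" for b y \<beta>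
  proof (rule poly_eqI)
    fix k
    show "coeff (map_poly (eval_mpoly b) F) k = coeff (orbit_poly n \<beta>) k"
      using P(2)[OF that, of k] lead_coeff_orbit_poly[of n \<beta>]
      by (cases k ?N rule: linorder_cases)
        (auto simp: coeff_map_poly coeff_F degree_orbit_poly coeff_eq_0)
  qed
  then show ?thesis by (intro exI[of _ F] conjI deg ran) (simp add: hyp_def)
qed

text \<open>The product \<open>D\<close> of all differences of roots is the discriminant up to sign.
  It is symmetric, hence a polynomial in the coefficients.\<close>

lemma discriminant_polyfun:
  assumes c: "\<And>k. c k \<in> polyfuns C G"
  shows "\<exists>D \<in> polyfuns C G. \<forall>b y. (\<forall>k. coeff (root_poly n y) k = c k b) \<longrightarrow>
    (D b \<noteq> 0 \<longleftrightarrow> inj_on y {..<n})"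
proof -
  define D :: "(nat \<Rightarrow> complex) \<Rightarrow> complex" where
    "D y = (\<Prod>i<n. \<Prod>j\<in>{..<n} - {i}. y i - y j)" for y
  have "D \<in> polyfuns C (sym_gens n)"
  proof (rule symmetric_functions)
    show "D \<in> polyfuns C (projs UNIV)"
      unfolding D_def[abs_def] by (intro polyfuns_prod polyfuns_diff polyfuns_proj) auto
    fix \<sigma> and y :: "nat \<Rightarrow> complex" assume \<sigma>: "\<sigma> permutes {..<n}"
    have bij: "bij \<sigma>" by (rule permutes_bij[OF \<sigma>])
    have "(\<Prod>j\<in>{..<n} - {i}. y (\<sigma> i) - y (\<sigma> j)) = (\<Prod>j\<in>{..<n} - {\<sigma> i}. y (\<sigma> i) - y j)" for i
    proof -
      have "\<sigma> ` ({..<n} - {i}) = {..<n} - {\<sigma> i}"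
        using bij permutes_image[OF \<sigma>] by (simp add: bij_is_inj image_set_diff)
      then have "bij_betw \<sigma> ({..<n} - {i}) ({..<n} - {\<sigma> i})"
        using inj_on_subset[OF bij_is_inj[OF bij] subset_UNIV] by (metis bij_betw_imageI)
      then show ?thesis by (rule prod.reindex_bij_betw)
    qed
    then have "D (\<lambda>i. y (\<sigma> i)) = (\<Prod>i<n. \<Prod>j\<in>{..<n} - {\<sigma> i}. y (\<sigma> i) - y j)" by (simp add: D_def)
    also have "\<dots> = D y"
      unfolding D_def by (rule prod.permute[OF \<sigma>, symmetric, unfolded o_def])
    finally show "D (\<lambda>i. y (\<sigma> i)) = D y" .
  qed
  from polyfuns_sym_gens_subst[of D C n c G "\<lambda>_ _. 0", OF this c] polyfuns.const[of 0 C G]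
  obtain p where p: "p \<in> polyfuns C G" "\<forall>b y. (\<forall>k. coeff (root_poly n y) k = c k b) \<longrightarrow>
      (\<forall>l. y (n + l) = 0) \<longrightarrow> D y = p b" by auto
  have "p b \<noteq> 0 \<longleftrightarrow> inj_on y {..<n}" if "\<forall>k. coeff (root_poly n y) k = c k b" for b y
  proof -
    \<comment> \<open>The moments are not involved here, so the variables from \<open>n\<close> on
      are set to 0, matching the choice of the parameters above.\<close>
    define z where "z i = (if i < n then y i else 0)" for i
    have "root_poly n z = root_poly n y"
      unfolding root_poly_def z_def by (intro prod.cong) auto
    then have "D z = p b" using that by (intro p(2)[rule_format]) (auto simp: z_def)
    moreover have "D z \<noteq> 0 \<longleftrightarrow> inj_on y {..<n}"
      by (auto simp: D_def z_def inj_on_def)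
    ultimately show ?thesis by simp
  qed
  with p(1) show ?thesis by (intro bexI[of _ p]) simp_all
qed

subsection \<open>Orthonormal frames\<close>

text \<open>The operator \<open>A\<^sub>0 B\<close>, as \<open>A\<^sub>0\<close> is its own inverse.\<close>

definition flip_rows :: "nat \<Rightarrow> 'a mat \<Rightarrow> 'a mat" where
  "flip_rows n B = mat n n (\<lambda>(i, j). B $$ (n - 1 - i, j))"

lemma flip_rows_carrier [simp]: "flip_rows n B \<in> carrier_mat n n"
  "dim_row (flip_rows n B) = n" "dim_col (flip_rows n B) = n"
  by (simp_all add: flip_rows_def)

text \<open>The bilinear form of \<open>antidiag_mat n\<close>, on coordinate functions.\<close>

definition aform :: "nat \<Rightarrow> (nat \<Rightarrow> 'a :: comm_ring_1) \<Rightarrow> (nat \<Rightarrow> 'a) \<Rightarrow> 'a" where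
  "aform n u v = (\<Sum>a<n. u a * v (n - 1 - a))"

definition frame :: "nat \<Rightarrow> (nat \<Rightarrow> nat \<Rightarrow> 'a :: comm_ring_1) \<Rightarrow> bool" where
  "frame n p \<longleftrightarrow> (\<forall>i<n. \<forall>j<n. aform n (p i) (p j) = (if i = j then 1 else 0))"

text \<open>The spectral decomposition: the sum of \<open>\<theta> i\<close> times the square
  \<open>v v\<^sup>T\<close> of the vector \<open>v = A\<^sub>0 p\<^sub>i\<close>. For a frame this
  is the symmetric \<open>B\<close> for which \<open>A\<^sub>0 B\<close> has eigenvectors
  \<open>p i\<close> and eigenvalues \<open>\<theta> i\<close>.\<close>

definition frame_entry :: "nat \<Rightarrow> (nat \<Rightarrow> 'a :: comm_ring_1) \<Rightarrow> (nat \<Rightarrow> nat \<Rightarrow> 'a) \<Rightarrow> nat \<Rightarrow> nat \<Rightarrow> 'a" where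
  "frame_entry n \<theta> p a b = (\<Sum>i<n. \<theta> i * p i (n - 1 - a) * p i (n - 1 - b))"

lemma sum_flip: "(\<Sum>a<n. f (n - 1 - a)) = (\<Sum>a<n :: nat. f a)"
  by (rule sum.reindex_bij_witness[of _ "\<lambda>a. n - 1 - a" "\<lambda>a. n - 1 - a"]) auto

lemma aform_commute: "aform n u v = aform n v u"
proof -
  have "aform n u v = (\<Sum>a<n. (\<lambda>a. v a * u (n - 1 - a)) (n - 1 - a))"
    unfolding aform_def by (intro sum.cong) auto
  also have "\<dots> = aform n v u" unfolding aform_def by (rule sum_flip)
  finally show ?thesis .
qed

lemma aform_sum_left: "aform n (\<lambda>a. \<Sum>i\<in>I. f i a) v = (\<Sum>i\<in>I. aform n (f i) v)"
  unfolding aform_def sum_distrib_right by (rule sum.swap)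

lemma aform_scale_left: "aform n (\<lambda>a. c * u a) v = c * aform n u v"
  by (simp add: aform_def sum_distrib_left mult.assoc)

lemma aform_add_left: "aform n (\<lambda>a. u a + w a) v = aform n u v + aform n w v"
  by (simp add: aform_def sum.distrib algebra_simps)

text \<open>Orthonormality says that \<open>Q = P\<^sup>T A\<^sub>0\<close> is a left inverse of the
  matrix \<open>P\<close> of the frame; for square matrices it is then a right inverse too.\<close>

lemma frame_complete:
  fixes p :: "nat \<Rightarrow> nat \<Rightarrow> 'a :: field"
  assumes "frame n p" "a < n" "b < n"
  shows "(\<Sum>i<n. p i a * p i (n - 1 - b)) = (if a = b then 1 else 0)"
proof -
  define P Q where "P = mat n n (\<lambda>(a, i). p i a)" and "Q = mat n n (\<lambda>(i, b). p i (n - 1 - b))"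
  have c: "P \<in> carrier_mat n n" "Q \<in> carrier_mat n n" by (auto simp: P_def Q_def)
  have "Q * P = 1\<^sub>m n"
  proof (rule eq_matI)
    fix i j assume "i < dim_row (1\<^sub>m n :: 'a mat)" "j < dim_col (1\<^sub>m n :: 'a mat)"
    then have ij: "i < n" "j < n" by auto
    then have "(Q * P) $$ (i, j) = aform n (p j) (p i)"
      by (simp add: P_def Q_def scalar_prod_def aform_def mult.commute atLeast0LessThan)
    then show "(Q * P) $$ (i, j) = 1\<^sub>m n $$ (i, j)"
      using assms(1) ij by (auto simp: frame_def)
  qed (auto simp: P_def Q_def)
  then have "P * Q = 1\<^sub>m n" using mat_mult_left_right_inverse[OF c(2,1)] by simp
  then have "(P * Q) $$ (a, b) = (if a = b then 1 else 0)" using assms(2,3) by simp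
  then show ?thesis using assms(2,3)
    by (simp add: P_def Q_def scalar_prod_def atLeast0LessThan)
qed

lemma frame_similar:
  fixes p :: "nat \<Rightarrow> nat \<Rightarrow> 'a :: field"
  assumes "frame n p" and B: "\<And>a b. a < n \<Longrightarrow> b < n \<Longrightarrow> B $$ (a, b) = frame_entry n \<theta> p a b"
  shows "similar_mat_wit (flip_rows n B) (mat_diag n \<theta>)
    (mat n n (\<lambda>(a, i). p i a)) (mat n n (\<lambda>(i, b). p i (n - 1 - b)))"
proof -
  define P Q where "P = mat n n (\<lambda>(a, i). p i a)" and "Q = mat n n (\<lambda>(i, b). p i (n - 1 - b))"
  have c: "P \<in> carrier_mat n n" "Q \<in> carrier_mat n n" by (auto simp: P_def Q_def)
  have PQ: "P * Q = 1\<^sub>m n"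
    by (rule eq_matI) (use frame_complete[OF assms(1)] in
        \<open>auto simp: P_def Q_def scalar_prod_def atLeast0LessThan\<close>)
  then have QP: "Q * P = 1\<^sub>m n" using mat_mult_left_right_inverse[OF c] by simp
  have eq: "flip_rows n B = P * mat_diag n \<theta> * Q"
  proof (rule eq_matI)
    fix a b assume "a < dim_row (P * mat_diag n \<theta> * Q)" "b < dim_col (P * mat_diag n \<theta> * Q)"
    then have ab: "a < n" "b < n" using c by auto
    have "(P * mat_diag n \<theta> * Q) $$ (a, b) = (\<Sum>i<n. p i a * \<theta> i * p i (n - 1 - b))"
      using ab unfolding mat_diag_mult_right[OF c(1)]
      by (simp add: P_def Q_def scalar_prod_def atLeast0LessThan)
    also have "\<dots> = flip_rows n B $$ (a, b)"
      using ab by (simp add: flip_rows_def B frame_entry_def mult.commute)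
    finally show "flip_rows n B $$ (a, b) = (P * mat_diag n \<theta> * Q) $$ (a, b)" by simp
  qed (use c in auto)
  show ?thesis
    unfolding P_def[symmetric] Q_def[symmetric]
    by (rule similar_mat_witI[OF PQ QP eq]) (use c in auto)
qed

lemma mat_diag_pow: "mat_diag n \<theta> ^\<^sub>m l = mat_diag n (\<lambda>i. (\<theta> i :: 'a :: comm_ring_1) ^ l)"
proof (induction l)
  case (Suc l)
  then show ?case by (simp add: mult.commute)
qed (simp add: mat_diag_def)

lemma frame_char_poly:
  fixes p :: "nat \<Rightarrow> nat \<Rightarrow> 'a :: field"
  assumes "frame n p" and B: "\<And>a b. a < n \<Longrightarrow> b < n \<Longrightarrow> B $$ (a, b) = frame_entry n \<theta> p a b"
  shows "char_poly (flip_rows n B) = root_poly n \<theta>"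
proof -
  have "similar_mat (flip_rows n B) (mat_diag n \<theta>)"
    using frame_similar[OF assms] unfolding similar_mat_def by blast
  then have "char_poly (flip_rows n B) = char_poly (mat_diag n \<theta>)" by (rule char_poly_similar)
  also have "\<dots> = (\<Prod>a\<leftarrow>diag_mat (mat_diag n \<theta>). [:- a, 1:])"
    by (rule char_poly_upper_triangular[of _ n]) (auto simp: mat_diag_def)
  also have "diag_mat (mat_diag n \<theta>) = map \<theta> [0..<n]"
    by (auto simp: diag_mat_def mat_diag_def)
  also have "(\<Prod>a\<leftarrow>map \<theta> [0..<n]. [:- a, 1:]) = root_poly n \<theta>"
    by (simp add: root_poly_def o_def prod.list_conv_set_nth atLeast0LessThan)
  finally show ?thesis .
qed

text \<open>In \<open>P D\<^sup>l Q\<close> the last row of \<open>P\<close> and the first column of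
  \<open>Q\<close> both consist of the last coordinates of the \<open>p i\<close>. So this corner of
  the powers of \<open>A\<^sub>0 B\<close> yields the moments with weights
  \<open>w\<^sub>i\<^sup>2\<close>.\<close>

lemma frame_moments:
  fixes p :: "nat \<Rightarrow> nat \<Rightarrow> 'a :: field"
  assumes "frame n p" and B: "\<And>a b. a < n \<Longrightarrow> b < n \<Longrightarrow> B $$ (a, b) = frame_entry n \<theta> p a b" and "n > 0"
  shows "(flip_rows n B ^\<^sub>m l) $$ (n - 1, 0) = (\<Sum>i<n. (p i (n - 1))\<^sup>2 * \<theta> i ^ l)"
proof -
  let ?P = "mat n n (\<lambda>(a, i). p i a)" and ?Q = "mat n n (\<lambda>(i, b). p i (n - 1 - b))"
  have "flip_rows n B ^\<^sub>m l = ?P * mat_diag n (\<lambda>i. \<theta> i ^ l) * ?Q"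
    using similar_mat_wit_pow_id[OF frame_similar[OF assms(1,2)], of l] by (simp add: mat_diag_pow)
  then show ?thesis using assms(3)
    by (simp add: mat_diag_mult_right[of _ n n] scalar_prod_def atLeast0LessThan power2_eq_square mult.commute mult.left_commute)
qed

lemma eigen_independent:
  fixes x :: "nat \<Rightarrow> 'a :: field vec"
  assumes T: "T \<in> carrier_mat n n" and "finite I" and "inj_on \<theta> I"
    and x: "\<And>i. i \<in> I \<Longrightarrow> x i \<in> carrier_vec n" "\<And>i. i \<in> I \<Longrightarrow> T *\<^sub>v x i = \<theta> i \<cdot>\<^sub>v x i"
      "\<And>i. i \<in> I \<Longrightarrow> x i \<noteq> 0\<^sub>v n"
    and "\<And>a. a < n \<Longrightarrow> (\<Sum>i\<in>I. c i * x i $ a) = 0"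
  shows "\<forall>i\<in>I. c i = 0"
  using assms(2-)
proof (induction I arbitrary: c)
  case (insert j I)
  have T_comp: "(\<Sum>b<n. T $$ (a, b) * x i $ b) = \<theta> i * x i $ a" if "a < n" "i \<in> insert j I" for a i
  proof -
    have "(T *\<^sub>v x i) $ a = (\<Sum>b<n. T $$ (a, b) * x i $ b)"
      using that T insert.prems(2)[OF that(2)] by (auto simp: scalar_prod_def atLeast0LessThan)
    then show ?thesis using insert.prems(2,3)[OF that(2)] that by simp
  qed
  \<comment> \<open>Apply \<open>T\<close> to the relation and subtract \<open>\<theta> j\<close>
    times the relation: the term of \<open>j\<close> drops out.\<close>
  have rel: "(\<Sum>i\<in>I. c i * (\<theta> i - \<theta> j) * x i $ a) = 0" if a: "a < n" for a
  proof -
    have "0 = (\<Sum>b<n. T $$ (a, b) * (\<Sum>i\<in>insert j I. c i * x i $ b))"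
      using insert.prems(5) by simp
    also have "\<dots> = (\<Sum>i\<in>insert j I. c i * (\<Sum>b<n. T $$ (a, b) * x i $ b))"
      unfolding sum_distrib_left by (subst sum.swap) (simp add: mult.left_commute)
    also have "\<dots> = (\<Sum>i\<in>insert j I. c i * (\<theta> i * x i $ a))"
      using T_comp[OF a] by (intro sum.cong) auto
    finally have "0 = (\<Sum>i\<in>insert j I. c i * (\<theta> i * x i $ a)) - \<theta> j * (\<Sum>i\<in>insert j I. c i * x i $ a)"
      using insert.prems(5)[OF a] by simp
    also have "\<dots> = (\<Sum>i\<in>insert j I. c i * (\<theta> i - \<theta> j) * x i $ a)"
      unfolding sum_distrib_left sum_subtractf[symmetric]
      by (intro sum.cong) (auto simp: algebra_simps)
    also have "\<dots> = (\<Sum>i\<in>I. c i * (\<theta> i - \<theta> j) * x i $ a)"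
      using insert.hyps by simp
    finally show ?thesis by simp
  qed
  have "\<forall>i\<in>I. c i * (\<theta> i - \<theta> j) = 0"
    by (rule insert.IH) (use insert.prems rel in \<open>auto intro: inj_on_subset\<close>)
  moreover have "\<theta> i \<noteq> \<theta> j" if "i \<in> I" for i
    using insert.prems(1) insert.hyps that by (metis inj_on_contraD insertCI)
  ultimately have I: "\<forall>i\<in>I. c i = 0" by simp
  have "c j * x j $ a = 0" if "a < n" for a
    using insert.prems(5)[OF that] insert.hyps I by simp
  moreover obtain a where "a < n" "x j $ a \<noteq> 0"
    using insert.prems(2,4)[of j] by (metis carrier_vecD eq_vecI index_zero_vec insertI1)
  ultimately show ?case using I by auto
qed simp

lemma aform_flip_rows:
  assumes "\<And>a b. a < n \<Longrightarrow> b < n \<Longrightarrow> B $$ (a, b) = B $$ (b, a)" and "u \<in> carrier_vec n" "v \<in> carrier_vec n"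
  shows "aform n (\<lambda>a. u $ a) (\<lambda>a. (flip_rows n B *\<^sub>v v) $ a) = (\<Sum>a<n. \<Sum>b<n. u $ a * B $$ (a, b) * v $ b)"
    and "aform n (\<lambda>a. u $ a) (\<lambda>a. (flip_rows n B *\<^sub>v v) $ a) = aform n (\<lambda>a. (flip_rows n B *\<^sub>v u) $ a) (\<lambda>a. v $ a)"
proof -
  have *: "aform n (\<lambda>a. u $ a) (\<lambda>a. (flip_rows n B *\<^sub>v v) $ a) = (\<Sum>a<n. \<Sum>b<n. u $ a * B $$ (a, b) * v $ b)"
    if "u \<in> carrier_vec n" "v \<in> carrier_vec n" for u v
    unfolding aform_def
  proof (rule sum.cong[OF refl])
    fix a assume "a \<in> {..<n}"
    then have a: "n - 1 - a < n" "n - 1 - (n - 1 - a) = a" by auto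
    then have "(flip_rows n B *\<^sub>v v) $ (n - 1 - a) = (\<Sum>b<n. B $$ (a, b) * v $ b)"
      using that by (auto simp: flip_rows_def scalar_prod_def atLeast0LessThan)
    then show "u $ a * (flip_rows n B *\<^sub>v v) $ (n - 1 - a) = (\<Sum>b<n. u $ a * B $$ (a, b) * v $ b)"
      by (simp add: sum_distrib_left mult.assoc)
  qed
  show "aform n (\<lambda>a. u $ a) (\<lambda>a. (flip_rows n B *\<^sub>v v) $ a) = (\<Sum>a<n. \<Sum>b<n. u $ a * B $$ (a, b) * v $ b)"
    by (rule *[OF assms(2,3)])
  also have "\<dots> = (\<Sum>a<n. \<Sum>b<n. v $ a * B $$ (a, b) * u $ b)"
    by (subst sum.swap) (intro sum.cong, auto simp: assms(1) mult.commute mult.left_commute)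
  also have "\<dots> = aform n (\<lambda>a. (flip_rows n B *\<^sub>v u) $ a) (\<lambda>a. v $ a)"
    unfolding *[OF assms(3,2), symmetric] by (rule aform_commute)
  finally show "aform n (\<lambda>a. u $ a) (\<lambda>a. (flip_rows n B *\<^sub>v v) $ a) = aform n (\<lambda>a. (flip_rows n B *\<^sub>v u) $ a) (\<lambda>a. v $ a)" .
qed

text \<open>\<open>A\<^sub>0 B\<close> is self-adjoint for the form, so eigenvectors of distinct
  eigenvalues are orthogonal. They form a basis, so by nondegeneracy none of them is isotropic, and
  over the complex numbers each can be normalized.\<close>

theorem frame_exists:
  fixes B :: "complex mat"
  assumes B: "\<And>a b. a < n \<Longrightarrow> b < n \<Longrightarrow> B $$ (a, b) = B $$ (b, a)"
    and char: "char_poly (flip_rows n B) = root_poly n \<theta>" and inj: "inj_on \<theta> {..<n}"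
  obtains p where "frame n p" "\<And>a b. a < n \<Longrightarrow> b < n \<Longrightarrow> B $$ (a, b) = frame_entry n \<theta> p a b"
proof -
  let ?T = "flip_rows n B"
  have "\<exists>x. x \<in> carrier_vec n \<and> x \<noteq> 0\<^sub>v n \<and> ?T *\<^sub>v x = \<theta> i \<cdot>\<^sub>v x" if "i < n" for i
  proof -
    have "eigenvalue ?T (\<theta> i)"
      using eigenvalue_root_char_poly[of ?T n "\<theta> i"] poly_root_poly[OF that, of \<theta>] char by simp
    then show ?thesis by (auto simp: eigenvalue_def eigenvector_def)
  qed
  then obtain x where x: "\<And>i. i < n \<Longrightarrow> x i \<in> carrier_vec n" "\<And>i. i < n \<Longrightarrow> x i \<noteq> 0\<^sub>v n"
    "\<And>i. i < n \<Longrightarrow> ?T *\<^sub>v x i = \<theta> i \<cdot>\<^sub>v x i" by metis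
  let ?f = "\<lambda>i j. aform n (\<lambda>a. x i $ a) (\<lambda>a. x j $ a)"
  have orth: "?f i j = 0" if "i < n" "j < n" "i \<noteq> j" for i j
  proof -
    have "aform n (\<lambda>a. (?T *\<^sub>v x i) $ a) (\<lambda>a. x j $ a) = \<theta> i * ?f i j" if "i < n" "j < n" for i j
    proof -
      have "aform n (\<lambda>a. (?T *\<^sub>v x i) $ a) (\<lambda>a. x j $ a) = aform n (\<lambda>a. \<theta> i * x i $ a) (\<lambda>a. x j $ a)"
        unfolding aform_def x(3)[OF that(1)] using x(1)[OF that(1)] by (intro sum.cong) auto
      then show ?thesis by (simp add: aform_scale_left)
    qed
    from this[of i j] this[of j i] have "\<theta> i * ?f i j = \<theta> j * ?f i j"
      using aform_flip_rows(2)[OF B x(1) x(1), of j i] that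
      by (metis aform_commute)
    then show ?thesis using inj that by (auto dest: inj_onD)
  qed
  define X where "X = mat n n (\<lambda>(a, i). x i $ a)"
  have X: "X \<in> carrier_mat n n" by (simp add: X_def)
  have "det X \<noteq> 0"
  proof
    assume "det X = 0"
    then obtain v where v: "v \<in> carrier_vec n" "v \<noteq> 0\<^sub>v n" "X *\<^sub>v v = 0\<^sub>v n"
      using det_0_iff_vec_prod_zero[OF X] by blast
    have "(\<Sum>i<n. v $ i * x i $ a) = 0" if "a < n" for a
    proof -
      have "(X *\<^sub>v v) $ a = (\<Sum>i<n. v $ i * x i $ a)"
        using that v(1) by (auto simp: X_def scalar_prod_def atLeast0LessThan mult.commute)
      then show ?thesis using v(3) that by simp
    qed
    then have "\<forall>i\<in>{..<n}. v $ i = 0"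
      by (intro eigen_independent[of ?T n "{..<n}" \<theta> x]) (use inj x in auto)
    then show False using v(1,2) by (metis carrier_vecD eq_vecI index_zero_vec lessThan_iff)
  qed
  \<comment> \<open>An isotropic \<open>x i\<close> would be orthogonal to the whole basis; its
    reversal \<open>u\<close> would then lie in the kernel of the transpose of the invertible
    \<open>X\<close>.\<close>
  have ne: "?f i i \<noteq> 0" if i: "i < n" for i
  proof
    assume "?f i i = 0"
    then have 0: "?f j i = 0" if "j < n" for j using orth that i by metis
    define u where "u = vec n (\<lambda>a. x i $ (n - 1 - a))"
    have "transpose_mat X *\<^sub>v u = 0\<^sub>v n"
    proof (rule eq_vecI)
      fix j assume "j < dim_vec (0\<^sub>v n :: complex vec)"
      then have j: "j < n" by simp
      then have "(transpose_mat X *\<^sub>v u) $ j = ?f j i"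
        by (simp add: X_def u_def scalar_prod_def aform_def atLeast0LessThan)
      then show "(transpose_mat X *\<^sub>v u) $ j = 0\<^sub>v n $ j" using 0 j by simp
    qed (simp add: X_def)
    moreover have "u \<noteq> 0\<^sub>v n"
    proof
      assume "u = 0\<^sub>v n"
      then have "x i $ (n - 1 - a) = 0" if "a < n" for a using that by (simp add: u_def vec_eq_iff)
      then have "x i $ a = 0" if "a < n" for a using that
        by (metis diff_diff_cancel diff_less_Suc Suc_pred' less_Suc_eq_le not_gr_zero not_less_zero)
      then show False using x(1,2)[OF i] by (metis carrier_vecD eq_vecI index_zero_vec)
    qed
    moreover have "u \<in> carrier_vec n" "transpose_mat X \<in> carrier_mat n n" by (auto simp: u_def X_def)
    ultimately have "det (transpose_mat X) = 0" using det_0_iff_vec_prod_zero by blast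
    then show False using \<open>det X \<noteq> 0\<close> det_transpose[OF X] by simp
  qed
  define s where "s i = csqrt (?f i i)" for i
  define p where "p i a = x i $ a / s i" for i a
  have s: "s i * s i = ?f i i" "s i \<noteq> 0" if "i < n" for i
    using ne[OF that] power2_csqrt[of "?f i i"] by (auto simp: s_def power2_eq_square)
  have fr: "frame n p"
    unfolding frame_def
  proof (intro allI impI)
    fix i j assume ij: "i < n" "j < n"
    have "aform n (p i) (p j) = ?f i j / (s i * s j)"
      by (simp add: aform_def p_def sum_divide_distrib)
    then show "aform n (p i) (p j) = (if i = j then 1 else 0)"
      using orth[OF ij] s[OF ij(1)] by auto
  qed
  have "B $$ (a, b) = frame_entry n \<theta> p a b" if ab: "a < n" "b < n" for a b
  proof -
    let ?a = "n - 1 - a"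
    have a: "?a < n" "n - 1 - ?a = a" using ab by auto
    have ev: "(\<Sum>c<n. B $$ (a, c) * p i c) = \<theta> i * p i ?a" if i: "i < n" for i
    proof -
      have "(?T *\<^sub>v x i) $ ?a = (\<Sum>c<n. B $$ (a, c) * x i $ c)"
        using a x(1)[OF i] by (auto simp: flip_rows_def scalar_prod_def atLeast0LessThan)
      then have "(\<Sum>c<n. B $$ (a, c) * x i $ c) = \<theta> i * x i $ ?a"
        using x(1,3)[OF i] a by simp
      then show ?thesis by (simp add: p_def flip: sum_divide_distrib)
    qed
    have "frame_entry n \<theta> p a b = (\<Sum>i<n. (\<Sum>c<n. B $$ (a, c) * p i c) * p i (n - 1 - b))"
      unfolding frame_entry_def using ev by (intro sum.cong) auto
    also have "\<dots> = (\<Sum>c<n. B $$ (a, c) * (\<Sum>i<n. p i c * p i (n - 1 - b)))"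
      unfolding sum_distrib_right sum_distrib_left by (subst sum.swap) (simp add: mult.assoc)
    also have "\<dots> = (\<Sum>c<n. if c = b then B $$ (a, c) else 0)"
      using frame_complete[OF fr _ ab(2)] by (intro sum.cong) auto
    also have "\<dots> = B $$ (a, b)" using ab by simp
    finally show ?thesis by simp
  qed
  with fr show ?thesis by (rule that)
qed

subsection \<open>The orbit polynomial of a pencil\<close>

definition entry_mat :: "nat \<Rightarrow> (nat \<Rightarrow> 'a) \<Rightarrow> 'a mat" where
  "entry_mat n b = mat n n (\<lambda>(i, j). b (prod_encode (min i j, max i j)))"

lemma entry_mat_carrier [simp]: "entry_mat n b \<in> carrier_mat n n"
  by (simp add: entry_mat_def)

lemma entry_mat_sym: "i < n \<Longrightarrow> j < n \<Longrightarrow> entry_mat n b $$ (i, j) = entry_mat n b $$ (j, i)"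
  by (simp add: entry_mat_def min.commute max.commute)

lemma flip_rows_entry_polyfuns:
  assumes "i < n" "j < n"
  shows "(\<lambda>b. flip_rows n (entry_mat n b) $$ (i, j)) \<in> polyfuns C (projs (entry_vars n))"
proof -
  let ?x = "prod_encode (min (n - 1 - i) j, max (n - 1 - i) j)"
  have "?x \<in> entry_vars n"
    unfolding entry_vars_def
    by (intro CollectI exI[of _ "min (n - 1 - i) j"] exI[of _ "max (n - 1 - i) j"]) (use assms in auto)
  then have "(\<lambda>b. b ?x) \<in> polyfuns C (projs (entry_vars n))" by (rule polyfuns_proj)
  then show ?thesis using assms by (simp add: flip_rows_def entry_mat_def)
qed

lemma pow_mat_polyfuns:
  assumes M: "\<And>x. M x \<in> carrier_mat n n"
    and "\<And>i j. i < n \<Longrightarrow> j < n \<Longrightarrow> (\<lambda>x. M x $$ (i, j)) \<in> polyfuns C G"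
    and "i < n" "j < n"
  shows "(\<lambda>x. (M x ^\<^sub>m l) $$ (i, j)) \<in> polyfuns C G"
  using assms(3,4)
proof (induction l arbitrary: i j)
  case 0
  have "dim_row (M x) = n" for x using M[of x] by auto
  then show ?case using 0 by (auto intro: polyfuns.const)
next
  case (Suc l)
  have c: "M x ^\<^sub>m l \<in> carrier_mat n n" "dim_row (M x ^\<^sub>m l) = n" "dim_col (M x ^\<^sub>m l) = n"
    "dim_row (M x) = n" "dim_col (M x) = n" for x
    using M[of x] pow_carrier_mat[OF M[of x], of l] by auto
  have eq: "(M x ^\<^sub>m Suc l) $$ (i, j) = (\<Sum>k<n. (M x ^\<^sub>m l) $$ (i, k) * M x $$ (k, j))" for x
    using Suc.prems by (simp add: c scalar_prod_def atLeast0LessThan)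
  show ?case
    unfolding eq using Suc.prems by (intro polyfuns_sum polyfuns.mult Suc.IH assms(2)) auto
qed

lemma char_poly_polyfuns:
  assumes M: "\<And>x. M x \<in> carrier_mat n n"
    and "\<And>i j. i < n \<Longrightarrow> j < n \<Longrightarrow> (\<lambda>x. M x $$ (i, j)) \<in> polyfuns C G"
  shows "coeffs_in (polyfuns C G) (\<lambda>x. char_poly (M x))"
proof -
  have e: "coeffs_in (polyfuns C G) (\<lambda>x. char_poly_matrix (M x) $$ (i, j))" if "i < n" "j < n" for i j
  proof -
    have "char_poly_matrix (M x) $$ (i, j) = (if i = j then [:- M x $$ (i, j), 1:] else [:- M x $$ (i, j):])" for x
      using that M[of x] by (auto simp: char_poly_matrix_def)
    then show ?thesis using assms(2)[OF that]
      by (cases "i = j") (simp_all add: coeffs_in_pCons coeffs_in_const coeffs_in_linear polyfuns_uminus)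
  qed
  have "char_poly (M x) = (\<Sum>p\<in>{p. p permutes {0..<n}}. signof p * (\<Prod>i=0..<n. char_poly_matrix (M x) $$ (i, p i)))" for x
    unfolding char_poly_def using char_poly_matrix_closed[OF M[of x]] by (rule det_def')
  moreover have "coeffs_in (polyfuns C G) (\<lambda>x. signof p)" for p :: "nat \<Rightarrow> nat"
    by (auto simp: coeffs_in_def sign_def coeff_pCons split: nat.splits intro!: polyfuns.const)
  ultimately show ?thesis
    by (simp only:) (intro coeffs_in_sum coeffs_in_mult coeffs_in_prod e, auto dest: permutes_in_image)
qed

definition pencil_coeff :: "nat \<Rightarrow> nat \<Rightarrow> (nat \<Rightarrow> complex) \<Rightarrow> complex" where
  "pencil_coeff n k b = coeff (char_poly (flip_rows n (entry_mat n b))) k"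

lemma pencil_coeff_polyfuns: "pencil_coeff n k \<in> polyfuns C (projs (entry_vars n))"
  unfolding pencil_coeff_def[abs_def]
  by (rule coeffs_inD[OF char_poly_polyfuns[where n = n]]) (auto intro: flip_rows_entry_polyfuns)

text \<open>The parameters are the coefficients of the characteristic polynomial and the corner
  entries of the powers of \<open>A\<^sub>0 B\<close>, both polynomial in the entries. A frame
  exhibits the roots and the weights of these moments.\<close>

theorem orbit_mpoly_frames:
  assumes "n > 0"
  shows "\<exists>F :: mpoly poly. range (coeff F) \<subseteq> mpolys gauss_ints (entry_vars n) \<and> degree F = 2 ^ (n - 1) \<and>
    (\<forall>b \<theta> p \<beta>. frame n p \<longrightarrow> (\<forall>i<n. \<forall>j<n. entry_mat n b $$ (i, j) = frame_entry n \<theta> p i j) \<longrightarrow>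
      (\<forall>i<n. (\<beta> i)\<^sup>2 = (p i (n - 1))\<^sup>2 * (\<Prod>j\<in>{..<n} - {i}. \<theta> i - \<theta> j)) \<longrightarrow>
      map_poly (eval_mpoly b) F = orbit_poly n \<beta>)"
proof -
  define h where "h l b = (flip_rows n (entry_mat n b) ^\<^sub>m l) $$ (n - 1, 0)" for l and b :: "nat \<Rightarrow> complex"
  have "h l \<in> polyfuns {} (projs (entry_vars n))" for l
    unfolding h_def[abs_def]
    by (rule pow_mat_polyfuns[where n = n]) (use assms in \<open>auto intro: flip_rows_entry_polyfuns\<close>)
  from orbit_mpoly_exists[of n "pencil_coeff n" "entry_vars n" h, OF assms pencil_coeff_polyfuns this]
  obtain F where F: "range (coeff F) \<subseteq> mpolys gauss_ints (entry_vars n)" "degree F = 2 ^ (n - 1)"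
    "\<And>b y \<beta>. (\<forall>k. coeff (root_poly n y) k = pencil_coeff n k b) \<Longrightarrow> (\<forall>l. y (n + l) = h l b) \<Longrightarrow>
      (\<forall>i<n. (\<beta> i)\<^sup>2 = residue_at n y i) \<Longrightarrow> map_poly (eval_mpoly b) F = orbit_poly n \<beta>"
    by (elim exE conjE) metis
  have "map_poly (eval_mpoly b) F = orbit_poly n \<beta>"
    if p: "frame n p" and B: "\<forall>i<n. \<forall>j<n. entry_mat n b $$ (i, j) = frame_entry n \<theta> p i j"
      and \<beta>: "\<forall>i<n. (\<beta> i)\<^sup>2 = (p i (n - 1))\<^sup>2 * (\<Prod>j\<in>{..<n} - {i}. \<theta> i - \<theta> j)" for b \<theta> p \<beta>
  proof (rule F(3))
    \<comment> \<open>Roots first, moments from index \<open>n\<close> on, as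
      \<open>residue_at\<close> expects.\<close>
    define y where "y i = (if i < n then \<theta> i else h (i - n) b)" for i
    have "root_poly n y = root_poly n \<theta>"
      unfolding root_poly_def y_def by (intro prod.cong) auto
    then show "\<forall>k. coeff (root_poly n y) k = pencil_coeff n k b"
      using frame_char_poly[OF p, of "entry_mat n b" \<theta>] B by (simp add: pencil_coeff_def)
    show h: "\<forall>l. y (n + l) = h l b" by (simp add: y_def)
    have "h l b = (\<Sum>i<n. (p i (n - 1))\<^sup>2 * \<theta> i ^ l)" for l
      unfolding h_def by (rule frame_moments[OF p]) (use B assms in auto)
    then have "y (n + l) = (\<Sum>i<n. (p i (n - 1))\<^sup>2 * y i ^ l)" for l
      using h by (simp add: y_def)
    then have "residue_at n y i = (p i (n - 1))\<^sup>2 * (\<Prod>j\<in>{..<n} - {i}. y i - y j)" if "i < n" for i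
      using that by (intro residue_at_eq) auto
    moreover have "(\<Prod>j\<in>{..<n} - {i}. y i - y j) = (\<Prod>j\<in>{..<n} - {i}. \<theta> i - \<theta> j)" if "i < n" for i
      using that by (intro prod.cong) (auto simp: y_def)
    ultimately show "\<forall>i<n. (\<beta> i)\<^sup>2 = residue_at n y i" using \<beta> by simp
  qed
  with F(1,2) show ?thesis by (intro exI[of _ F] conjI allI impI)
qed

lemma char_poly_roots:
  fixes T :: "complex mat"
  assumes "T \<in> carrier_mat n n"
  obtains \<theta> where "char_poly T = root_poly n \<theta>"
proof -
  obtain as where as: "char_poly T = (\<Prod>a\<leftarrow>as. [:- a, 1:])" "length as = n"
    using char_poly_factorized[OF assms] by blast
  have "(\<Prod>a\<leftarrow>as. [:- a, 1:]) = root_poly n (\<lambda>i. as ! i)"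
    by (subst prod.list_conv_set_nth) (simp add: as(2) root_poly_def atLeast0LessThan)
  with as(1) show ?thesis by (intro that) simp
qed

text \<open>For the cyclic shift \<open>T\<close> every \<open>n\<close>-th root of unity is an eigenvalue.\<close>

lemma separable_pencil_exists:
  assumes "n > 0"
  shows "\<exists>(b :: nat \<Rightarrow> complex) \<theta>.
    char_poly (flip_rows n (entry_mat n b)) = root_poly n \<theta> \<and> inj_on \<theta> {..<n}"
proof -
  \<comment> \<open>Reversing the rows replaces \<open>i\<close> by \<open>n - 1 - i\<close>, so the
    condition becomes that \<open>j\<close> is congruent to \<open>i - 1\<close> modulo
    \<open>n\<close>.\<close>
  define b :: "nat \<Rightarrow> complex" where
    "b x = (case prod_decode x of (i, j) \<Rightarrow> if (i + j + 2) mod n = 0 then 1 else 0)" for x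
  let ?T = "flip_rows n (entry_mat n b)"
  obtain \<theta> where \<theta>: "char_poly ?T = root_poly n \<theta>" using char_poly_roots[of ?T n] by auto
  have T: "?T $$ (i, j) = (if j = (if i = 0 then n - 1 else i - 1) then 1 else 0)" if "i < n" "j < n" for i j
  proof -
    have "(n - 1 - i + j + 2) mod n = 0 \<longleftrightarrow> j = (if i = 0 then n - 1 else i - 1)"
    proof
      assume "(n - 1 - i + j + 2) mod n = 0"
      then obtain k where k: "n - 1 - i + j + 2 = n * k" by auto
      have "0 < n * k" "n * k \<le> n * 2" using k that by linarith+
      then have "k = 1 \<or> k = 2" using assms by auto
      then show "j = (if i = 0 then n - 1 else i - 1)" using k that by auto
    next
      assume "j = (if i = 0 then n - 1 else i - 1)"
      then have "n - 1 - i + j + 2 = n * (if i = 0 then 2 else 1)" using that by auto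
      then show "(n - 1 - i + j + 2) mod n = 0" by simp
    qed
    moreover have "min (n - 1 - i) j + max (n - 1 - i) j = n - 1 - i + j" by (auto simp only: min_def max_def split: if_splits)
    ultimately show ?thesis using that by (simp add: flip_rows_def entry_mat_def b_def)
  qed
  have "poly (root_poly n \<theta>) z = 0" if z: "z ^ n = 1" for z
  proof -
    \<comment> \<open>The inverse of \<open>z\<close>. The shift maps the vector of the powers of
      \<open>w\<close> to itself divided by \<open>w\<close>, up to wrapping around, which
      \<open>w ^ n = 1\<close> makes consistent.\<close>
    define w where "w = z ^ (n - 1)"
    have zw: "z * w = 1" using z assms by (simp add: w_def flip: power_Suc)
    define x where "x = vec n (\<lambda>i. w ^ i)"
    have "?T *\<^sub>v x = z \<cdot>\<^sub>v x"
    proof (rule eq_vecI)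
      fix i assume "i < dim_vec (z \<cdot>\<^sub>v x)"
      then have i: "i < n" by (simp add: x_def)
      let ?k = "if i = 0 then n - 1 else i - 1"
      have "(?T *\<^sub>v x) $ i = (\<Sum>j<n. (if j = ?k then 1 else 0) * w ^ j)"
        using i by (simp add: scalar_prod_def x_def atLeast0LessThan T)
      also have "\<dots> = (\<Sum>j<n. if j = ?k then w ^ j else 0)"
        by (intro sum.cong) auto
      also have "\<dots> = w ^ ?k" using i by (subst sum.delta) auto
      also have "\<dots> = z * w ^ i"
      proof (cases "i = 0")
        case True
        have "w ^ n = (z ^ n) ^ (n - 1)" by (simp only: w_def power_mult[symmetric] mult.commute)
        then have "w * w ^ (n - 1) = 1" using z assms by (simp flip: power_Suc)
        then have "w ^ (n - 1) = z" using zw by (metis mult.assoc mult.commute mult_1)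
        then show ?thesis using True by simp
      next
        case False
        then have "w ^ i = w * w ^ (i - 1)" by (simp flip: power_Suc)
        then show ?thesis using False zw by (simp flip: mult.assoc)
      qed
      finally show "(?T *\<^sub>v x) $ i = (z \<cdot>\<^sub>v x) $ i" using i by (simp add: x_def)
    qed (simp add: x_def)
    moreover have "x \<noteq> 0\<^sub>v n"
    proof
      assume "x = 0\<^sub>v n"
      then have "x $ 0 = 0" using assms by simp
      then show False using assms by (simp add: x_def)
    qed
    ultimately have "eigenvalue ?T z"
      unfolding eigenvalue_def eigenvector_def by (intro exI[of _ x]) (simp add: x_def)
    then show ?thesis using eigenvalue_root_char_poly[of ?T n z] \<theta> by simp
  qed
  then have "{z. z ^ n = 1} \<subseteq> \<theta> ` {..<n}"
    by (auto simp: root_poly_def poly_prod)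
  then have "n \<le> card (\<theta> ` {..<n})"
    using card_mono[of "\<theta> ` {..<n}" "{z. z ^ n = 1}"] card_roots_unity_eq[OF assms] by simp
  then have "inj_on \<theta> {..<n}"
    using card_image_le[of "{..<n}" \<theta>] by (intro eq_card_imp_inj_on) auto
  with \<theta> show ?thesis by blast
qed

text \<open>The discriminant of the pencil is a nonzero polynomial function because of the cyclic
  shift, so it and \<open>q\<close> are nonzero at some common point; there the eigenvalues are
  distinct and an eigenframe exists.\<close>

theorem generic_frame:
  assumes "n > 0" and "q \<in> polyfuns UNIV (projs UNIV)" and "q b0 \<noteq> 0"
  obtains b \<theta> p where "q b \<noteq> 0" "inj_on \<theta> {..<n}" "frame n p"
    "\<And>i j. i < n \<Longrightarrow> j < n \<Longrightarrow> entry_mat n b $$ (i, j) = frame_entry n \<theta> p i j"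
proof -
  obtain D where D: "D \<in> polyfuns UNIV (projs (entry_vars n))"
    "\<forall>b y. (\<forall>k. coeff (root_poly n y) k = pencil_coeff n k b) \<longrightarrow> (D b \<noteq> 0 \<longleftrightarrow> inj_on y {..<n})"
    using discriminant_polyfun[of "pencil_coeff n" UNIV "projs (entry_vars n)" n, OF pencil_coeff_polyfuns]
    by (elim bexE)
  have D': "D b \<noteq> 0 \<longleftrightarrow> inj_on y {..<n}" if "char_poly (flip_rows n (entry_mat n b)) = root_poly n y" for b y
    by (rule D(2)[rule_format]) (simp only: pencil_coeff_def that)
  obtain b1 \<theta>1 :: "nat \<Rightarrow> complex" where "char_poly (flip_rows n (entry_mat n b1)) = root_poly n \<theta>1" "inj_on \<theta>1 {..<n}"
    using separable_pencil_exists[OF assms(1)] by blast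
  then have "D b1 \<noteq> 0" using D' by simp
  moreover have "D \<in> polyfuns UNIV (projs UNIV)"
    by (rule polyfuns_mono[OF D(1)]) (auto simp: projs_def)
  ultimately obtain b where b: "q b \<noteq> 0" "D b \<noteq> 0"
    using polyfuns_nonzero_common[OF assms(2), of D b0 b1] assms(3) by blast
  obtain \<theta> where \<theta>: "char_poly (flip_rows n (entry_mat n b)) = root_poly n \<theta>"
    using char_poly_roots[of "flip_rows n (entry_mat n b)" n] by auto
  then have inj: "inj_on \<theta> {..<n}"
    using b(2) D' by simp
  obtain p where "frame n p" "\<And>i j. i < n \<Longrightarrow> j < n \<Longrightarrow> entry_mat n b $$ (i, j) = frame_entry n \<theta> p i j"
    by (rule frame_exists[of n "entry_mat n b" \<theta>, OF entry_mat_sym \<theta> inj])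
      (assumption+, erule that, simp)
  with b(1) inj show ?thesis by (rule that)
qed

subsection \<open>Rotating a frame\<close>

text \<open>The value at 0 is left open, so that \<open>inverse\<close> is included. Clearing the
  pole by a power of \<open>z\<close> reduces zeros to those of a polynomial.\<close>

definition laurent :: "(complex \<Rightarrow> complex) \<Rightarrow> bool" where
  "laurent f \<longleftrightarrow> (\<exists>N p. \<forall>z. z \<noteq> 0 \<longrightarrow> z ^ N * f z = poly p z)"

lemma laurent_const [intro]: "laurent (\<lambda>_. c)"
  unfolding laurent_def by (intro exI[of _ 0] exI[of _ "[:c:]"]) simp

lemma laurent_id [intro]: "laurent (\<lambda>z. z)"
  unfolding laurent_def by (intro exI[of _ 0] exI[of _ "[:0, 1:]"]) simp

lemma laurent_inverse [intro]: "laurent (\<lambda>z. inverse z)"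
  unfolding laurent_def by (intro exI[of _ 1] exI[of _ "[:1:]"]) simp

lemma laurent_add [intro]:
  assumes "laurent f" "laurent g"
  shows "laurent (\<lambda>z. f z + g z)"
proof -
  obtain N p M q where *: "\<And>z. z \<noteq> 0 \<Longrightarrow> z ^ N * f z = poly p z" "\<And>z. z \<noteq> 0 \<Longrightarrow> z ^ M * g z = poly q z"
    using assms unfolding laurent_def by metis
  have "z ^ (N + M) * (f z + g z) = poly (Polynomial.monom 1 M * p + Polynomial.monom 1 N * q) z" if "z \<noteq> 0" for z
    by (simp add: poly_monom power_add algebra_simps flip: *[OF that])
  then show ?thesis unfolding laurent_def by blast
qed

lemma laurent_mult [intro]:
  assumes "laurent f" "laurent g"
  shows "laurent (\<lambda>z. f z * g z)"
proof -
  obtain N p M q where *: "\<And>z. z \<noteq> 0 \<Longrightarrow> z ^ N * f z = poly p z" "\<And>z. z \<noteq> 0 \<Longrightarrow> z ^ M * g z = poly q z"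
    using assms unfolding laurent_def by metis
  have "z ^ (N + M) * (f z * g z) = poly (p * q) z" if "z \<noteq> 0" for z
    by (simp add: power_add algebra_simps flip: *[OF that])
  then show ?thesis unfolding laurent_def by blast
qed

lemma laurent_uminus [intro]: "laurent f \<Longrightarrow> laurent (\<lambda>z. - f z)"
  using laurent_mult[OF laurent_const[of "-1"]] by fastforce

lemma laurent_sum [intro]: "(\<And>i. i \<in> I \<Longrightarrow> laurent (f i)) \<Longrightarrow> laurent (\<lambda>z. \<Sum>i\<in>I. f i z)"
  by (induction I rule: infinite_finite_induct) auto

lemma laurent_power [intro]: "laurent f \<Longrightarrow> laurent (\<lambda>z. f z ^ k)"
  by (induction k) auto

lemma laurent_polyfuns:
  assumes "f \<in> polyfuns UNIV (projs UNIV)" and "\<And>i. laurent (\<lambda>z. r z i)"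
  shows "laurent (\<lambda>z. f (r z))"
  using assms(1) by induction (auto simp: projs_def intro: assms(2))

lemma laurent_zeros_finite:
  assumes "laurent f" "z1 \<noteq> 0" "f z1 \<noteq> 0"
  shows "finite {z. z \<noteq> 0 \<and> f z = 0}"
proof -
  obtain N p where *: "\<And>z. z \<noteq> 0 \<Longrightarrow> z ^ N * f z = poly p z"
    using assms(1) unfolding laurent_def by blast
  have "p \<noteq> 0" using *[OF assms(2)] assms(2,3) by auto
  moreover have "{z. z \<noteq> 0 \<and> f z = 0} \<subseteq> {z. poly p z = 0}"
    using * by (auto simp flip: *)
  ultimately show ?thesis using poly_roots_finite finite_subset by blast
qed

text \<open>Each function has finitely many zeros, so a single parameter avoids them all. This
  serves both as a choice of a generic rotation and as the absence of zero divisors.\<close>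

lemma laurent_nonzero_common:
  assumes "finite S" and "\<And>f. f \<in> S \<Longrightarrow> laurent f" and "\<And>f. f \<in> S \<Longrightarrow> \<exists>z. z \<noteq> 0 \<and> f z \<noteq> 0"
  shows "\<exists>z. z \<noteq> 0 \<and> (\<forall>f\<in>S. f z \<noteq> 0)"
proof -
  have "finite ({0} \<union> (\<Union>f\<in>S. {z. z \<noteq> 0 \<and> f z = 0}))"
  proof (intro finite_UnI finite_UN_I assms(1))
    fix f assume "f \<in> S"
    then show "finite {z. z \<noteq> 0 \<and> f z = 0}" using assms(2,3) laurent_zeros_finite by metis
  qed simp
  then obtain z where "z \<notin> {0} \<union> (\<Union>f\<in>S. {z. z \<noteq> 0 \<and> f z = 0})"
    using ex_new_if_finite[OF infinite_UNIV_char_0] by blast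
  then show ?thesis by auto
qed

text \<open>With \<open>z = exp (\<i> * t)\<close> these are the cosine and the sine of
  \<open>t\<close>. The circle identity persists for every nonzero complex \<open>z\<close>.\<close>

definition rot_cos :: "complex \<Rightarrow> complex" where
  "rot_cos z = (z + inverse z) / 2"

definition rot_sin :: "complex \<Rightarrow> complex" where
  "rot_sin z = (inverse z + - z) * (\<i> / 2)"

lemma rot_values [simp]:
  "rot_cos 1 = 1" "rot_sin 1 = 0" "rot_cos (-1) = -1" "rot_sin (-1) = 0" "rot_cos \<i> = 0" "rot_sin \<i> = 1"
  by (simp_all add: rot_cos_def rot_sin_def)

lemma rot_cos_sin:
  assumes "z \<noteq> 0"
  shows "rot_cos z * rot_cos z + rot_sin z * rot_sin z = 1"
proof -
  have sin: "rot_sin z * rot_sin z = - ((inverse z - z) * (inverse z - z) / 4)"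
  proof -
    have "rot_sin z * rot_sin z = ((inverse z - z) * (inverse z - z)) * (\<i> / 2 * (\<i> / 2))"
      unfolding rot_sin_def by (simp only: mult_ac diff_conv_add_uminus)
    then show ?thesis by simp
  qed
  have "(z + w) / 2 * ((z + w) / 2) - (w - z) * (w - z) / 4 = z * w" for w :: complex
    by (simp add: algebra_simps add_divide_distrib diff_divide_distrib)
  from this[of "inverse z"] show ?thesis
    using assms by (simp only: sin rot_cos_def) simp
qed

lemma laurent_rot: "laurent rot_cos" "laurent rot_sin"
proof -
  have "laurent (\<lambda>z. (z + inverse z) * (1 / 2))" "laurent (\<lambda>z. (inverse z + - z) * (\<i> / 2))"
    by (intro laurent_add laurent_mult laurent_const laurent_id laurent_inverse laurent_uminus)+
  then show "laurent rot_cos" "laurent rot_sin"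
    unfolding rot_cos_def[abs_def] rot_sin_def[abs_def] by simp_all
qed

text \<open>The value \<open>z = 1\<close> changes nothing, \<open>z = -1\<close> is the half turn
  negating both vectors, and the quarter turn \<open>z = \<i>\<close> puts \<open>p j\<close> in
  place \<open>k\<close>.\<close>

definition rotate_frame :: "nat \<Rightarrow> nat \<Rightarrow> complex \<Rightarrow> (nat \<Rightarrow> nat \<Rightarrow> complex) \<Rightarrow> nat \<Rightarrow> nat \<Rightarrow> complex" where
  "rotate_frame k j z p =
     (\<lambda>i a. if i = j then - rot_sin z * p k a + rot_cos z * p j a
            else if i = k then rot_cos z * p k a + rot_sin z * p j a else p i a)"

lemma rotate_frame_1: "rotate_frame k j 1 p = p"
  by (auto simp: rotate_frame_def fun_eq_iff)

lemma rotate_frame_minus_1: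
  "k \<noteq> j \<Longrightarrow> rotate_frame k j (-1) p i a = (if i = k \<or> i = j then - p i a else p i a)"
  by (auto simp: rotate_frame_def)

lemma laurent_rotate_frame: "laurent (\<lambda>z. rotate_frame k j z p i a)"
proof -
  have "laurent (\<lambda>z. - rot_sin z * p k a + rot_cos z * p j a)" "laurent (\<lambda>z. rot_cos z * p k a + rot_sin z * p j a)"
    by (intro laurent_add laurent_mult laurent_uminus laurent_rot laurent_const)+
  then show ?thesis
    by (cases "i = j"; cases "i = k") (simp_all add: rotate_frame_def laurent_const)
qed

lemma aform_lincomb:
  "aform n (\<lambda>a. c * u a + s * v a) w = c * aform n u w + s * aform n v w"
  "aform n w (\<lambda>a. c * u a + s * v a) = c * aform n w u + s * aform n w v"
  by (simp_all add: aform_def sum_distrib_left sum.distrib algebra_simps)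

lemma frame_rotate_frame:
  assumes "frame n p" "k < n" "j < n" "k \<noteq> j" "z \<noteq> 0"
  shows "frame n (rotate_frame k j z p)"
proof -
  define m where "m = - rot_sin z"
  have cs: "rot_cos z * rot_cos z + rot_sin z * rot_sin z = 1" "m * m + rot_cos z * rot_cos z = 1"
    "m * rot_cos z + rot_cos z * rot_sin z = 0"
    using rot_cos_sin[OF assms(5)] by (simp_all add: m_def algebra_simps)
  have r: "rotate_frame k j z p i = (if i = j then \<lambda>a. m * p k a + rot_cos z * p j a
      else if i = k then \<lambda>a. rot_cos z * p k a + rot_sin z * p j a else p i)" for i
    by (auto simp: rotate_frame_def fun_eq_iff m_def)
  have f: "aform n (p i) (p i') = (if i = i' then 1 else 0)" if "i < n" "i' < n" for i i'
    using assms(1) that by (simp add: frame_def)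
  show ?thesis
    unfolding frame_def
  proof (intro allI impI)
    fix i i' assume i: "i < n" "i' < n"
    show "aform n (rotate_frame k j z p i) (rotate_frame k j z p i') = (if i = i' then 1 else 0)"
      unfolding r using i assms(2-4) cs
      by (cases "i = j"; cases "i = k"; cases "i' = j"; cases "i' = k")
        (simp_all add: aform_lincomb f algebra_simps)
  qed
qed

text \<open>The eigenvalues stay fixed while the frame moves. Variables that are no entries keep
  their values from \<open>b\<close>, so that the frame of \<open>b\<close> gives back exactly
  \<open>b\<close>.\<close>

definition frame_assign :: "nat \<Rightarrow> (nat \<Rightarrow> complex) \<Rightarrow> (nat \<Rightarrow> complex) \<Rightarrow> (nat \<Rightarrow> nat \<Rightarrow> complex) \<Rightarrow> nat \<Rightarrow> complex" where
  "frame_assign n \<theta> b p x = (case prod_decode x of (i, j) \<Rightarrow>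
     if i \<le> j \<and> j < n then frame_entry n \<theta> p i j else b x)"

lemma frame_entry_commute: "frame_entry n \<theta> p i j = frame_entry n \<theta> p j i"
  by (simp add: frame_entry_def mult.commute mult.left_commute)

lemma entry_mat_frame_assign:
  "i < n \<Longrightarrow> j < n \<Longrightarrow> entry_mat n (frame_assign n \<theta> b p) $$ (i, j) = frame_entry n \<theta> p i j"
  by (auto simp: entry_mat_def frame_assign_def min_def max_def frame_entry_commute)

lemma frame_assign_same:
  assumes "\<And>i j. i < n \<Longrightarrow> j < n \<Longrightarrow> entry_mat n b $$ (i, j) = frame_entry n \<theta> p i j"
  shows "frame_assign n \<theta> b p = b"
proof
  fix x
  obtain i j where x: "prod_decode x = (i, j)" by fastforce
  then have "x = prod_encode (i, j)" by (metis prod_decode_inverse)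
  then show "frame_assign n \<theta> b p x = b x"
    using assms[of i j] x by (auto simp: frame_assign_def entry_mat_def min_def max_def)
qed

lemma frame_assign_rotate_minus_1:
  "k \<noteq> j \<Longrightarrow> frame_assign n \<theta> b (rotate_frame k j (-1) p) = frame_assign n \<theta> b p"
proof -
  assume "k \<noteq> j"
  then have "frame_entry n \<theta> (rotate_frame k j (-1) p) i i' = frame_entry n \<theta> p i i'" for i i'
    unfolding frame_entry_def by (intro sum.cong) (auto simp: rotate_frame_minus_1)
  then show ?thesis by (auto simp: frame_assign_def fun_eq_iff split: prod.split)
qed

lemma laurent_frame_assign: "laurent (\<lambda>z. frame_assign n \<theta> b (rotate_frame k j z p) x)"
proof -
  obtain i i' where x: "prod_decode x = (i, i')" by fastforce
  have "laurent (\<lambda>z. frame_entry n \<theta> (rotate_frame k j z p) i i')"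
    unfolding frame_entry_def
    by (intro laurent_sum laurent_mult laurent_const laurent_rotate_frame)
  then show ?thesis
    by (cases "i \<le> i' \<and> i' < n") (auto simp: frame_assign_def x)
qed

subsection \<open>Transitivity on signs\<close>

text \<open>Pairs toggle every set of even size. Toggling the single \<open>k\<close> amounts to
  toggling the other \<open>n - 1\<close> indices, an even number, and then passing to the
  complement.\<close>

lemma toggle_closed:
  fixes Z :: "nat set \<Rightarrow> bool"
  assumes n: "odd n"
    and pair: "\<And>I k j. Z I \<Longrightarrow> k < n \<Longrightarrow> j < n \<Longrightarrow> k \<noteq> j \<Longrightarrow> Z (sym_diff (sym_diff I {k}) {j})"
    and compl: "\<And>I. Z I \<Longrightarrow> Z ({..<n} - I)"
    and sub: "\<And>I. Z I \<Longrightarrow> I \<subseteq> {..<n}"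
    and "Z I" "J \<subseteq> {..<n}"
  shows "Z J"
proof -
  have even: "Z (sym_diff I K)" if "Z I" "K \<subseteq> {..<n}" "card K = 2 * m" for I K m
    using that(2,3)
  proof (induction m arbitrary: K)
    case 0
    then have "K = {}" using finite_subset by fastforce
    then show ?case using that(1) by simp
  next
    case (Suc m)
    then have fin: "finite K" using finite_subset by blast
    from Suc have "K \<noteq> {}" by auto
    then obtain k where k: "k \<in> K" by blast
    then have c: "card (K - {k}) = Suc (2 * m)" using Suc fin by simp
    then have "K - {k} \<noteq> {}" by force
    then obtain j where j: "j \<in> K - {k}" by blast
    have "Z (sym_diff I (K - {k} - {j}))"
      by (rule Suc.IH) (use Suc.prems c j fin in auto)
    then have "Z (sym_diff (sym_diff (sym_diff I (K - {k} - {j})) {k}) {j})"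
      using k j Suc.prems by (intro pair) auto
    also have "sym_diff (sym_diff (sym_diff I (K - {k} - {j})) {k}) {j} = sym_diff I K"
      using k j by blast
    finally show ?case .
  qed
  have single: "Z (sym_diff I {k})" if "Z I" "k < n" for I k
  proof -
    obtain m where m: "n = 2 * m + 1" using n by (elim oddE)
    have "card ({..<n} - {k}) = 2 * m" using that(2) m by simp
    then have "Z (sym_diff I ({..<n} - {k}))" by (intro even[OF that(1)]) auto
    then have "Z ({..<n} - sym_diff I ({..<n} - {k}))" by (rule compl)
    also have "{..<n} - sym_diff I ({..<n} - {k}) = sym_diff I {k}"
      using sub[OF that(1)] that(2) by blast
    finally show ?thesis .
  qed
  have "Z (sym_diff I K)" if "finite K" "K \<subseteq> {..<n}" for K
    using that
  proof induction
    case (insert k K)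
    then have "Z (sym_diff (sym_diff I K) {k})" by (intro single) auto
    also have "sym_diff (sym_diff I K) {k} = sym_diff I (insert k K)" using insert.hyps by blast
    finally show ?case .
  qed (use assms(5) in simp)
  from this[of "sym_diff I J"] have "Z (sym_diff I (sym_diff I J))"
    using sub[OF assms(5)] assms(6) finite_subset by (metis Diff_subset Un_least dual_order.trans finite_lessThan)
  also have "sym_diff I (sym_diff I J) = J" by blast
  finally show ?thesis .
qed

definition partial_sum :: "nat set \<Rightarrow> nat set \<Rightarrow> (nat \<Rightarrow> complex) \<Rightarrow> complex" where
  "partial_sum I J \<beta> = (\<Sum>i\<in>I. if i \<in> J then - \<beta> i else \<beta> i)"

lemma signed_sum_diff:
  assumes "I \<subseteq> {..<n}" "J \<subseteq> {..<n}"
  shows "signed_sum n I \<beta> - signed_sum n J \<beta> = 2 * partial_sum (sym_diff I J) (I - J) \<beta>"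
proof -
  have "signed_sum n I \<beta> - signed_sum n J \<beta> =
      (\<Sum>i<n. if i \<in> sym_diff I J then 2 * (if i \<in> I - J then - \<beta> i else \<beta> i) else 0)"
    unfolding signed_sum_def sum_subtractf[symmetric] by (intro sum.cong) auto
  also have "\<dots> = (\<Sum>i\<in>{..<n} \<inter> sym_diff I J. 2 * (if i \<in> I - J then - \<beta> i else \<beta> i))"
    by (subst sum.inter_restrict) auto
  also have "{..<n} \<inter> sym_diff I J = sym_diff I J" using assms by blast
  finally show ?thesis by (simp add: partial_sum_def sum_distrib_left)
qed

text \<open>Equal squares mean that the sum of \<open>I\<close> equals that of \<open>J\<close> or
  of its complement, and the difference is twice a partial sum over a symmetric difference. Since
  \<open>n - 1\<close> lies in neither set and they differ, that set is nonempty and proper in both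
  cases.\<close>

lemma signed_squares_distinct:
  assumes "n > 0" and nz: "\<And>I J. I \<subseteq> {..<n} \<Longrightarrow> J \<subseteq> I \<Longrightarrow> I \<noteq> {} \<Longrightarrow> I \<noteq> {..<n} \<Longrightarrow> partial_sum I J \<beta> \<noteq> 0"
  shows "inj_on (\<lambda>I. (signed_sum n I \<beta>)\<^sup>2) (Pow {..<n-1})"
proof (rule inj_onI, rule ccontr)
  fix I J assume IJ: "I \<in> Pow {..<n-1}" "J \<in> Pow {..<n-1}" "I \<noteq> J"
    and eq: "(signed_sum n I \<beta>)\<^sup>2 = (signed_sum n J \<beta>)\<^sup>2"
  have sub: "I \<subseteq> {..<n}" "J \<subseteq> {..<n}" "{..<n} - J \<subseteq> {..<n}" using IJ by (auto dest!: subsetD)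
  have n1: "n - 1 \<notin> I" "n - 1 \<notin> J" "n - 1 < n" using IJ assms(1) by auto
  have "signed_sum n I \<beta> - signed_sum n J \<beta> \<noteq> 0"
    unfolding signed_sum_diff[OF sub(1,2)]
    using nz[of "sym_diff I J" "I - J"] sub n1 IJ(3) by auto
  moreover have "signed_sum n I \<beta> - signed_sum n ({..<n} - J) \<beta> \<noteq> 0"
  proof -
    have "n - 1 \<in> sym_diff I ({..<n} - J)" using n1 by auto
    moreover have "sym_diff I ({..<n} - J) \<noteq> {..<n}"
    proof
      assume "sym_diff I ({..<n} - J) = {..<n}"
      then have "I = J" using sub by blast
      then show False using IJ(3) by simp
    qed
    moreover have "sym_diff I ({..<n} - J) \<subseteq> {..<n}" using sub by blast
    ultimately have "partial_sum (sym_diff I ({..<n} - J)) (I - ({..<n} - J)) \<beta> \<noteq> 0"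
      by (intro nz) auto
    then show ?thesis unfolding signed_sum_diff[OF sub(1,3)] by simp
  qed
  ultimately show False using eq by (auto simp: signed_sum_compl power2_eq_iff)
qed

lemma laurent_if [intro]: "laurent f \<Longrightarrow> laurent g \<Longrightarrow> laurent (\<lambda>z. if P then f z else g z)"
  by (cases P) simp_all

lemma laurent_partial_sum:
  "(\<And>i. laurent (\<lambda>z. \<beta> z i)) \<Longrightarrow> laurent (\<lambda>z. partial_sum I J (\<beta> z))"
  unfolding partial_sum_def by (intro laurent_sum laurent_if laurent_uminus)

lemma laurent_signed_sum:
  "(\<And>i. laurent (\<lambda>z. \<beta> z i)) \<Longrightarrow> laurent (\<lambda>z. signed_sum n I (\<beta> z))"
  unfolding signed_sum_def by (intro laurent_sum laurent_if laurent_uminus)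

text \<open>Take a frame with as few vanishing partial sums as possible. Rotating the planes of a frame
  makes a vanishing partial sum nonzero.\<close>

lemma frame_general_position:
  assumes "n > 0" and q: "q \<in> polyfuns UNIV (projs UNIV)" and "frame n p0" "q (frame_assign n \<theta> b p0) \<noteq> 0"
    and \<phi>: "\<And>i. i < n \<Longrightarrow> \<phi> i \<noteq> 0"
  obtains p where "frame n p" "q (frame_assign n \<theta> b p) \<noteq> 0"
    "\<And>I J. I \<subseteq> {..<n} \<Longrightarrow> J \<subseteq> I \<Longrightarrow> I \<noteq> {} \<Longrightarrow> I \<noteq> {..<n} \<Longrightarrow>
      partial_sum I J (\<lambda>i. \<phi> i * p i (n - 1)) \<noteq> 0"
proof -
  let ?\<beta> = "\<lambda>p i. \<phi> i * p i (n - 1)"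
  define P where "P = {(I, J). I \<subseteq> {..<n} \<and> J \<subseteq> I \<and> I \<noteq> {} \<and> I \<noteq> {..<n}}"
  \<comment> \<open>The vanishing partial sums, over nonempty proper index sets only: the move below
    needs an index \<open>k\<close> inside and \<open>j\<close> outside.\<close>
  define R where "R p = {(I, J) \<in> P. partial_sum I J (?\<beta> p) = 0}" for p
  define good where "good p \<longleftrightarrow> frame n p \<and> q (frame_assign n \<theta> b p) \<noteq> 0" for p
  have "P \<subseteq> Pow {..<n} \<times> Pow {..<n}" by (auto simp: P_def)
  then have finP: "finite P" using finite_subset by blast
  have finR: "finite (R p)" for p using finP by (auto simp: R_def intro: finite_subset[of _ P])
  have "good p0" using assms by (simp add: good_def)
  then obtain p where p: "good p" and min: "\<And>p'. good p' \<Longrightarrow> card (R p) \<le> card (R p')"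
    using ex_has_least_nat[of good p0 "\<lambda>p. card (R p)"] by blast
  have frp: "frame n p" using p by (simp add: good_def)
  have "R p = {}"
  proof (rule ccontr)
    assume "R p \<noteq> {}"
    have "\<exists>I J k j z. (I, J) \<in> R p \<and> k < n \<and> j < n \<and> k \<noteq> j \<and> z \<noteq> 0 \<and>
        partial_sum I J (?\<beta> (rotate_frame k j z p)) \<noteq> 0"
    proof (cases "\<exists>k<n. p k (n - 1) = 0")
      \<comment> \<open>A zero last coordinate makes the singleton sum of \<open>k\<close> vanish; a
        quarter turn replaces it by a nonzero coordinate, which exists because the frame
        spans.\<close>
      case True
      then obtain k where k: "k < n" "p k (n - 1) = 0" by blast
      have "\<exists>j<n. p j (n - 1) \<noteq> 0"
      proof (rule ccontr)
        assume "\<not> ?thesis"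
        then have "(\<Sum>i<n. p i (n - 1) * p i (n - 1 - (n - 1))) = 0" by (intro sum.neutral) auto
        then show False using frame_complete[OF frp, of "n - 1" "n - 1"] assms(1) by simp
      qed
      then obtain j where j: "j < n" "p j (n - 1) \<noteq> 0" by blast
      then have "k \<noteq> j" using k by auto
      have "{k} \<noteq> {..<n}" using j \<open>k \<noteq> j\<close> by (metis lessThan_iff singletonD)
      then have "({k}, {}) \<in> R p" using k by (simp add: R_def P_def partial_sum_def)
      moreover have "partial_sum {k} {} (?\<beta> (rotate_frame k j \<i> p)) \<noteq> 0"
        using k j \<open>k \<noteq> j\<close> \<phi>[OF k(1)] by (simp add: partial_sum_def rotate_frame_def)
      ultimately show ?thesis using k j \<open>k \<noteq> j\<close>
        by (intro exI[of _ "{k}"] exI[of _ "{}"] exI[of _ k] exI[of _ j] exI[of _ \<i>]) simp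
    next
      \<comment> \<open>A half turn in the plane of \<open>k\<close> and \<open>j\<close> changes
        the sign of exactly one summand, which is nonzero, so the sum leaves 0.\<close>
      case False
      from \<open>R p \<noteq> {}\<close> obtain I J where IJ: "(I, J) \<in> R p" by auto
      then obtain k j where k: "k \<in> I" "j < n" "j \<notin> I" by (auto simp: R_def P_def)
      have I: "I \<subseteq> {..<n}" "finite I" and 0: "partial_sum I J (?\<beta> p) = 0"
        using IJ by (auto simp: R_def P_def intro: finite_subset)
      have kj: "k < n" "k \<noteq> j" using k I by auto
      let ?r = "rotate_frame k j (-1) p"
      have "(\<Sum>i\<in>I - {k}. if i \<in> J then - ?\<beta> ?r i else ?\<beta> ?r i) = (\<Sum>i\<in>I - {k}. if i \<in> J then - ?\<beta> p i else ?\<beta> p i)"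
        using k kj by (intro sum.cong) (auto simp: rotate_frame_minus_1)
      moreover have "partial_sum I J (?\<beta> ?r) = (if k \<in> J then ?\<beta> p k else - ?\<beta> p k) +
          (\<Sum>i\<in>I - {k}. if i \<in> J then - ?\<beta> ?r i else ?\<beta> ?r i)"
        unfolding partial_sum_def using k I kj by (subst sum.remove[of I k]) (auto simp: rotate_frame_minus_1)
      moreover have "partial_sum I J (?\<beta> p) = (if k \<in> J then - ?\<beta> p k else ?\<beta> p k) +
          (\<Sum>i\<in>I - {k}. if i \<in> J then - ?\<beta> p i else ?\<beta> p i)"
        unfolding partial_sum_def using k I by (subst sum.remove[of I k]) auto
      moreover have "?\<beta> p k \<noteq> 0" using False kj \<phi>[OF kj(1)] by auto
      ultimately have "partial_sum I J (?\<beta> ?r) \<noteq> 0" using 0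
        by (cases "k \<in> J") (auto simp: add_eq_0_iff)
      then show ?thesis using IJ k kj
        by (intro exI[of _ I] exI[of _ J] exI[of _ k] exI[of _ j] exI[of _ "-1"]) simp
    qed
    then obtain I J k j z1 where IJ: "(I, J) \<in> R p" and kj: "k < n" "j < n" "k \<noteq> j" and z1: "z1 \<noteq> 0"
      "partial_sum I J (?\<beta> (rotate_frame k j z1 p)) \<noteq> 0" by blast
    let ?g = "\<lambda>(I, J) z. partial_sum I J (?\<beta> (rotate_frame k j z p))"
    let ?Q = "\<lambda>z. q (frame_assign n \<theta> b (rotate_frame k j z p))"
    have lau: "laurent (?g x)" for x
      by (cases x) (auto intro!: laurent_partial_sum laurent_mult laurent_rotate_frame)
    \<comment> \<open>A generic rotation gains the sum over \<open>I\<close>, nonzero at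
      \<open>z1\<close>, and loses nothing: \<open>q\<close> and the sums that did not vanish before
      are nonzero at \<open>z = 1\<close>.\<close>
    have "\<exists>z. z \<noteq> 0 \<and> (\<forall>f \<in> insert ?Q (?g ` insert (I, J) (P - R p)). f z \<noteq> 0)"
    proof (rule laurent_nonzero_common)
      fix f assume f: "f \<in> insert ?Q (?g ` insert (I, J) (P - R p))"
      then show "laurent f"
        using lau laurent_polyfuns[OF q laurent_frame_assign] by auto
      show "\<exists>z. z \<noteq> 0 \<and> f z \<noteq> 0"
      proof (cases "f = ?g (I, J)")
        case True
        then show ?thesis using z1 by auto
      next
        case False
        then consider "f = ?Q" | x where "x \<in> P - R p" "f = ?g x" using f by auto
        then have "f 1 \<noteq> 0"
          using p by cases (auto simp: good_def R_def rotate_frame_1)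
        then show ?thesis by (intro exI[of _ 1]) simp
      qed
    qed (use finP in simp)
    then obtain z where z0: "z \<noteq> 0" and zf: "\<forall>f \<in> insert ?Q (?g ` insert (I, J) (P - R p)). f z \<noteq> 0"
      by blast
    have z: "z \<noteq> 0" "?Q z \<noteq> 0" "?g (I, J) z \<noteq> 0" by (rule z0 bspec[OF zf] insertI1 insertI2 imageI)+
    have z4: "?g x z \<noteq> 0" if "x \<in> P - R p" for x
      by (rule bspec[OF zf]) (intro insertI2 imageI that)
    let ?p = "rotate_frame k j z p"
    have "good ?p" using frame_rotate_frame[OF frp kj z(1)] z(2) by (simp add: good_def)
    have "R ?p \<subseteq> R p"
    proof
      fix x assume x: "x \<in> R ?p"
      then have "x \<in> P" "?g x z = 0" by (auto simp: R_def)
      then show "x \<in> R p" using z4[of x] by blast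
    qed
    moreover have "(I, J) \<notin> R ?p" using z(3) by (simp add: R_def)
    ultimately have "R ?p \<subset> R p" using IJ by blast
    then have "card (R ?p) < card (R p)" by (rule psubset_card_mono[OF finR])
    then show False using min[OF \<open>good ?p\<close>] by simp
  qed
  then show ?thesis
    using p by (intro that[of p]) (auto simp: good_def R_def P_def)
qed


section \<open>Factorizations and the distribution of roots\<close>

interpretation eval_mpoly_hom: comm_ring_hom "eval_mpoly b" for b
  by unfold_locales auto

interpretation eval_mpoly_poly_hom: map_poly_comm_ring_hom "eval_mpoly b" for b ..

lemma laurent_eval:
  assumes "\<And>x. laurent (\<lambda>z. b z x)" "laurent f"
  shows "laurent (\<lambda>z. poly (map_poly (eval_mpoly (b z)) F) (f z))"
proof -
  have "poly (map_poly (eval_mpoly (b z)) F) (f z) = (\<Sum>k\<le>degree F. eval_mpoly (b z) (coeff F k) * f z ^ k)" for z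
    unfolding poly_altdef
    by (rule sum.mono_neutral_cong_left) (auto simp: coeff_map_poly degree_map_poly_le coeff_eq_0 intro: le_degree)
  then show ?thesis
    using assms by (auto intro!: laurent_sum laurent_mult laurent_power laurent_polyfuns[OF eval_mpoly_polyfuns])
qed

lemma linear_square_dvd_prod_distinct:
  fixes r :: "'b \<Rightarrow> 'a :: field"
  assumes "finite A" "inj_on r A" "[:-x, 1:] ^ 2 dvd (\<Prod>i\<in>A. [:- r i, 1:])"
  shows False
proof -
  have "[:-x, 1:] dvd (\<Prod>i\<in>A. [:- r i, 1:])"
    using assms(3) by (metis dvd_trans dvd_triv_left power2_eq_square)
  then have "poly (\<Prod>i\<in>A. [:- r i, 1:]) x = 0" by (simp add: poly_eq_0_iff_dvd)
  then obtain i where i: "i \<in> A" "x = r i" using assms(1) by (auto simp: poly_prod)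
  have eq: "(\<Prod>i\<in>A. [:- r i, 1:]) = [:-x, 1:] * (\<Prod>j\<in>A - {i}. [:- r j, 1:])"
    unfolding i(2) by (rule prod.remove[OF assms(1) i(1)])
  have "[:-x, 1:] dvd (\<Prod>j\<in>A - {i}. [:- r j, 1:])"
  proof (rule iffD1[OF dvd_times_left_cancel_iff])
    show "[:-x, 1:] * [:-x, 1:] dvd [:-x, 1:] * (\<Prod>j\<in>A - {i}. [:- r j, 1:])"
      using assms(3) unfolding power2_eq_square eq .
  qed simp
  then have "poly (\<Prod>j\<in>A - {i}. [:- r j, 1:]) x = 0" by (simp add: poly_eq_0_iff_dvd)
  then obtain j where "j \<in> A - {i}" "x = r j" using assms(1) by (auto simp: poly_prod)
  then show False using i assms(2) by (auto dest: inj_onD)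
qed

text \<open>At a frame in general position the \<open>2 ^ (n - 1)\<close> roots are distinct, so
  each belongs to exactly one factor. Rotations carry a root of one factor to another root of the
  same factor until all signs are reached, and that factor has all the roots. \<open>Q\<close>
  allows for a common denominator; the frame is chosen where it does not vanish.\<close>

theorem orbit_mpoly_factor_degree:
  fixes F G H :: "mpoly poly"
  assumes n: "odd n"
    and F: "\<And>b \<theta> p \<beta>. frame n p \<Longrightarrow>
      (\<And>i j. i < n \<Longrightarrow> j < n \<Longrightarrow> entry_mat n b $$ (i, j) = frame_entry n \<theta> p i j) \<Longrightarrow>
      (\<And>i. i < n \<Longrightarrow> (\<beta> i)\<^sup>2 = (p i (n - 1))\<^sup>2 * (\<Prod>j\<in>{..<n} - {i}. \<theta> i - \<theta> j)) \<Longrightarrow>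
      map_poly (eval_mpoly b) F = orbit_poly n \<beta>"
    and Q: "Q \<noteq> 0" and GH: "smult Q F = G * H"
  shows "2 ^ (n - 1) \<le> degree G \<or> 2 ^ (n - 1) \<le> degree H"
proof -
  have n0: "n > 0" using n by (cases n) auto
  let ?q = "\<lambda>b. eval_mpoly b Q"
  obtain b1 where "?q b1 \<noteq> 0" using mpoly_nonzero_eval[OF Q] by blast
  then obtain b0 \<theta> p0 where b0: "?q b0 \<noteq> 0" "inj_on \<theta> {..<n}" "frame n p0"
    "\<And>i j. i < n \<Longrightarrow> j < n \<Longrightarrow> entry_mat n b0 $$ (i, j) = frame_entry n \<theta> p0 i j"
    using generic_frame[OF n0 eval_mpoly_polyfuns] by metis
  define \<phi> where "\<phi> i = csqrt (\<Prod>j\<in>{..<n} - {i}. \<theta> i - \<theta> j)" for i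
  have \<phi>: "\<phi> i \<noteq> 0" if "i < n" for i
    using b0(2) that by (auto simp: \<phi>_def inj_on_def)
  define \<beta> where "\<beta> p i = \<phi> i * p i (n - 1)" for p i
  let ?b = "frame_assign n \<theta> b0"
  obtain p where p: "frame n p" "?q (?b p) \<noteq> 0"
    and nz: "\<And>I J. I \<subseteq> {..<n} \<Longrightarrow> J \<subseteq> I \<Longrightarrow> I \<noteq> {} \<Longrightarrow> I \<noteq> {..<n} \<Longrightarrow> partial_sum I J (\<beta> p) \<noteq> 0"
  proof (rule frame_general_position[OF n0 eval_mpoly_polyfuns[of Q] b0(3),
        where \<theta> = \<theta> and b = b0 and \<phi> = \<phi>])
    show "eval_mpoly (?b p0) Q \<noteq> 0" using b0(1) frame_assign_same[OF b0(4)] by simp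
  qed (use \<phi> that in \<open>auto simp: \<beta>_def[abs_def]\<close>)
  have Fb: "map_poly (eval_mpoly (?b p)) F = orbit_poly n (\<beta> p)" if "frame n p" for p
    by (rule F[OF that, where \<theta> = \<theta>]) (simp_all add: entry_mat_frame_assign \<beta>_def \<phi>_def power_mult_distrib)
  let ?P = "\<lambda>G p. map_poly (eval_mpoly (?b p)) G" and ?r = "\<lambda>p I. (signed_sum n I (\<beta> p))\<^sup>2"
  have prod: "?P G p * ?P H p = smult (?q (?b p)) (orbit_poly n (\<beta> p))" if "frame n p" for p
    using arg_cong[OF GH, of "\<lambda>G. ?P G p"] Fb[OF that]
    by (simp add: eval_mpoly_poly_hom.hom_mult eval_mpoly_hom.map_poly_hom_smult)
  have root: "poly (orbit_poly n (\<beta> p)) (?r p I) = 0" if "I \<subseteq> {..<n}" for p I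
  proof -
    have "poly ((orbit_poly n (\<beta> p))\<^sup>2) (?r p I) = 0"
      unfolding orbit_poly_square[OF n0] poly_prod by (rule prod_zero) (use that in auto)
    then show ?thesis by simp
  qed
  have distinct: "inj_on (?r p) (Pow {..<n-1})"
    by (rule signed_squares_distinct[OF n0]) (use nz in auto)
  have exclusive: "poly (?P G p) x \<noteq> 0 \<or> poly (?P H p) x \<noteq> 0" for x
  proof (rule ccontr)
    assume "\<not> ?thesis"
    then have "[:-x, 1:] * [:-x, 1:] dvd ?P G p * ?P H p"
      by (intro mult_dvd_mono) (simp_all add: poly_eq_0_iff_dvd)
    then have "[:-x, 1:] ^ 2 dvd orbit_poly n (\<beta> p)"
      using prod[OF p(1)] p(2) by (simp add: power2_eq_square dvd_smult_iff del: mult_pCons_left)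
    then show False
      unfolding orbit_poly_def
      by (intro linear_square_dvd_prod_distinct[OF _ distinct]) simp_all
  qed
  \<comment> \<open>Along the rotation the moving root annihilates the product for every nonzero
    \<open>z\<close>. \<open>H\<close> does not vanish on it at \<open>z = 1\<close>, so
    \<open>G\<close> does for all \<open>z\<close>; at \<open>z = -1\<close> the point is the old
    one and two signs have changed. \<open>G\<close> and \<open>H\<close> are bound afresh because
    the factors are exchanged at the end.\<close>
  have flip: "poly (?P G p) (?r p (sym_diff (sym_diff I {k}) {j})) = 0"
    if I: "I \<subseteq> {..<n}" and kj: "k < n" "j < n" "k \<noteq> j" and G0: "poly (?P G p) (?r p I) = 0"
      and prod: "\<And>p. frame n p \<Longrightarrow> ?P G p * ?P H p = smult (?q (?b p)) (orbit_poly n (\<beta> p))"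
      and excl: "poly (?P G p) (?r p I) \<noteq> 0 \<or> poly (?P H p) (?r p I) \<noteq> 0" for G H I k j
  proof -
    let ?R = "\<lambda>z. rotate_frame k j z p"
    let ?g = "\<lambda>G z. poly (?P G (?R z)) (?r (?R z) I)"
    have lau: "laurent (?g G)" for G
      unfolding \<beta>_def
      by (intro laurent_eval laurent_power laurent_signed_sum laurent_mult laurent_const
          laurent_frame_assign laurent_rotate_frame)
    have zero: "?g G z * ?g H z = 0" if "z \<noteq> 0" for z
      using arg_cong[OF prod[OF frame_rotate_frame[OF p(1) kj that]], of "\<lambda>f. poly f (?r (?R z) I)"] root[OF I]
      by simp
    have H1: "?g H 1 \<noteq> 0" using excl G0 by (simp add: rotate_frame_1)
    have "?g G (-1) = 0"
    proof (rule ccontr)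
      assume "?g G (-1) \<noteq> 0"
      then have "\<exists>z. z \<noteq> 0 \<and> (\<forall>f\<in>{?g G, ?g H}. f z \<noteq> 0)"
        using H1 lau by (intro laurent_nonzero_common)
          (auto intro: exI[of _ 1] exI[of _ "-1"])
      then show False using zero by auto
    qed
    moreover have "signed_sum n I (\<beta> (?R (-1))) = signed_sum n (sym_diff (sym_diff I {k}) {j}) (\<beta> p)"
    proof -
      have "\<beta> (?R (-1)) = (\<beta> p)(j := - \<beta> p j, k := - ((\<beta> p)(j := - \<beta> p j)) k)"
        using kj(3) by (auto simp: \<beta>_def rotate_frame_minus_1 fun_eq_iff)
      then show ?thesis by (simp only: signed_sum_flip)
    qed
    ultimately show ?thesis by (simp add: frame_assign_rotate_minus_1[OF kj(3)])
  qed
  have all: "poly (?P G p) (?r p J) = 0"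
    if "poly (?P G p) (?r p {}) = 0" and J: "J \<subseteq> {..<n}"
      and prod: "\<And>p. frame n p \<Longrightarrow> ?P G p * ?P H p = smult (?q (?b p)) (orbit_poly n (\<beta> p))"
      and excl: "\<And>x. poly (?P G p) x \<noteq> 0 \<or> poly (?P H p) x \<noteq> 0" for G H J
  proof -
    define Z where "Z I \<longleftrightarrow> I \<subseteq> {..<n} \<and> poly (?P G p) (?r p I) = 0" for I
    have "Z J"
    proof (rule toggle_closed[OF n])
      show "Z {}" using that by (simp add: Z_def)
      show "Z (sym_diff (sym_diff I {k}) {j})" if "Z I" "k < n" "j < n" "k \<noteq> j" for I k j
      proof -
        have "I \<subseteq> {..<n}" "poly (?P G p) (?r p I) = 0" using that(1) by (auto simp: Z_def)
        moreover from this have "sym_diff (sym_diff I {k}) {j} \<subseteq> {..<n}" using that(2,3) by blast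
        ultimately show ?thesis using flip[OF _ that(2-4) _ prod excl] by (simp add: Z_def)
      qed
      show "Z ({..<n} - I)" if "Z I" for I
        using that by (auto simp: Z_def signed_sum_compl)
    qed (use J in \<open>auto simp: Z_def\<close>)
    then show ?thesis by (simp add: Z_def)
  qed
  have big: "2 ^ (n - 1) \<le> degree G"
    if "poly (?P G p) (?r p {}) = 0"
      and prod: "\<And>p. frame n p \<Longrightarrow> ?P G p * ?P H p = smult (?q (?b p)) (orbit_poly n (\<beta> p))"
      and excl: "\<And>x. poly (?P G p) x \<noteq> 0 \<or> poly (?P H p) x \<noteq> 0" for G H
  proof -
    have "?P G p \<noteq> 0" using excl[of 0] prod[OF p(1)] p(2) lead_coeff_orbit_poly[of n "\<beta> p"] by auto
    then have "card {x. poly (?P G p) x = 0} \<le> degree (?P G p)" "finite {x. poly (?P G p) x = 0}"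
      by (auto intro: poly_roots_finite poly_roots_degree)
    moreover have "?r p ` Pow {..<n-1} \<subseteq> {x. poly (?P G p) x = 0}"
    proof (rule image_subsetI)
      fix I assume "I \<in> Pow {..<n-1}"
      then have "I \<subseteq> {..<n}" by auto
      then show "?r p I \<in> {x. poly (?P G p) x = 0}" using all[OF that(1) _ prod excl] by simp
    qed
    ultimately have "card (?r p ` Pow {..<n-1}) \<le> degree (?P G p)"
      by (meson card_mono le_trans)
    then have "2 ^ (n - 1) \<le> degree (?P G p)"
      using card_image[OF distinct] by (simp add: card_Pow)
    then show ?thesis using degree_map_poly_le[of "eval_mpoly (?b p)" G] by simp
  qed
  have "poly (?P G p * ?P H p) (?r p {}) = 0" using prod[OF p(1)] root[of "{}" p] by simp
  then have "poly (?P G p) (?r p {}) = 0 \<or> poly (?P H p) (?r p {}) = 0" by simp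
  then show ?thesis
    using big[of G H] big[of H G] prod exclusive by (auto simp: mult.commute)
qed

subsection \<open>Irreducibility over the field of rational functions\<close>

lemma clear_denominators:
  fixes G :: "'a :: idom fract poly"
  shows "\<exists>q G'. q \<noteq> 0 \<and> smult (to_fract q) G = map_poly to_fract G'"
proof (induction G)
  case 0
  show ?case by (intro exI[of _ 1] exI[of _ 0]) simp
next
  case (pCons a G)
  then obtain q G' where q: "q \<noteq> 0" "smult (to_fract q) G = map_poly to_fract G'" by blast
  obtain x y where a: "a = to_fract x / to_fract y" "y \<noteq> 0"
    by (cases a) (auto simp: Fract_conv_to_fract)
  have "smult (to_fract (q * y)) (pCons a G) = map_poly to_fract (pCons (q * x) (smult y G'))"
  proof (rule poly_eqI)
    fix k
    have "to_fract q * coeff G m = to_fract (coeff G' m)" for m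
      using arg_cong[OF q(2), of "\<lambda>p. coeff p m"] by (simp add: coeff_map_poly)
    then show "coeff (smult (to_fract (q * y)) (pCons a G)) k
        = coeff (map_poly to_fract (pCons (q * x) (smult y G'))) k"
      using a(2) by (cases k) (simp_all add: a(1) coeff_map_poly mult.left_commute mult.commute)
  qed
  then show ?case using q(1) a(2) by (intro exI[of _ "q * y"] exI[of _ "pCons (q * x) (smult y G')"]) simp
qed

lemma degree_map_poly_to_fract [simp]: "degree (map_poly to_fract G) = degree G"
  by (rule degree_map_poly) simp

lemma map_poly_to_fract_eq_iff: "map_poly to_fract G = map_poly to_fract H \<longleftrightarrow> G = H"
  by (auto simp: poly_eq_iff coeff_map_poly)

lemma poly_ring_over_simps [simp]:
  "carrier (poly_ring_over K) = {p. range (coeff p) \<subseteq> K}"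
  "p \<otimes>\<^bsub>poly_ring_over K\<^esub> q = p * q" "\<one>\<^bsub>poly_ring_over K\<^esub> = 1" "\<zero>\<^bsub>poly_ring_over K\<^esub> = 0"
  by (simp_all add: poly_ring_over_def)

lemma ratfuns_inverse:
  assumes "k \<in> ratfuns R X" "k \<noteq> 0"
  shows "inverse k \<in> ratfuns R X"
proof -
  obtain p q where "k = to_fract p / to_fract q" "p \<in> mpolys R X" "q \<in> mpolys R X" "q \<noteq> 0"
    using assms(1) by (auto simp: ratfuns_def)
  then show ?thesis using assms(2) unfolding ratfuns_def
    by (intro CollectI exI[of _ q] exI[of _ p]) auto
qed

text \<open>Units of the polynomial ring must have their inverses over the subfield, not merely over
  the ambient field of fractions.\<close>

lemma const_in_poly_ring_over:
  assumes "b = [:k:]" "range (coeff b) \<subseteq> ratfuns R X" "b \<noteq> 0" "0 \<in> R" "1 \<in> R"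
  shows "range (coeff [:inverse k:]) \<subseteq> ratfuns R X"
proof -
  have "k = coeff b 0" using assms(1) by simp
  then have "k \<in> ratfuns R X" using assms(2) by (metis rangeI subsetD)
  then have "inverse k \<in> ratfuns R X"
    using assms(1,3) by (intro ratfuns_inverse) auto
  moreover have "0 = to_fract 0 / to_fract (1 :: mpoly)" by simp
  then have "0 \<in> ratfuns R X"
    unfolding ratfuns_def using assms(4,5)
    by (intro CollectI exI[of _ 0] exI[of _ 1]) (auto simp: mpolys_def)
  ultimately show ?thesis by (auto simp: coeff_pCons split: nat.splits)
qed

text \<open>Clearing denominators turns a factorization over the field into one of
  \<open>smult Q F\<close>; hence the multiplier in \<open>factor\<close>. As the degrees add up,
  one factor is constant, that is a unit.\<close>

lemma ring_irreducible_mpoly: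
  fixes F :: "mpoly poly"
  assumes "degree F > 0" and R: "0 \<in> R" "1 \<in> R"
    and factor: "\<And>Q G H. Q \<noteq> 0 \<Longrightarrow> smult Q F = G * H \<Longrightarrow> degree F \<le> degree G \<or> degree F \<le> degree H"
  shows "ring_irreducible\<^bsub>poly_ring_over (ratfuns R X)\<^esub> (map_poly to_fract F)"
  unfolding ring_irreducible_def Divisibility.irreducible_def
proof (intro conjI ballI impI)
  let ?R = "poly_ring_over (ratfuns R X)" and ?F = "map_poly to_fract F"
  have degF: "degree ?F = degree F" by simp
  show F0: "?F \<noteq> \<zero>\<^bsub>?R\<^esub>" using assms(1) by (metis degF degree_0 less_irrefl poly_ring_over_simps(4))
  show "?F \<notin> Units ?R"
  proof
    assume "?F \<in> Units ?R"
    then obtain x where "x * ?F = 1" by (auto simp: Units_def)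
    then have "?F dvd 1" by (metis dvd_triv_right)
    then have "degree ?F = 0" by (simp add: poly_dvd_1)
    then show False using assms(1) by simp
  qed
  fix b assume b: "b \<in> carrier ?R" and pf: "properfactor ?R b ?F"
  then obtain c where c: "range (coeff c) \<subseteq> ratfuns R X" "?F = b * c"
    by (auto simp: properfactor_def factor_def)
  have nz: "b \<noteq> 0" "c \<noteq> 0" using F0 c by auto
  obtain q1 b' where q1: "q1 \<noteq> 0" "smult (to_fract q1) b = map_poly to_fract b'"
    using clear_denominators by blast
  obtain q2 c' where q2: "q2 \<noteq> 0" "smult (to_fract q2) c = map_poly to_fract c'"
    using clear_denominators by blast
  have "map_poly to_fract (smult (q1 * q2) F) = smult (to_fract q1) b * smult (to_fract q2) c"
    by (simp add: fract_poly_smult c(2) mult.commute)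
  also have "\<dots> = map_poly to_fract (b' * c')" by (simp add: q1(2) q2(2))
  finally have "smult (q1 * q2) F = b' * c'" by (simp only: map_poly_to_fract_eq_iff)
  then have "degree F \<le> degree b' \<or> degree F \<le> degree c'"
    using q1(1) q2(1) by (intro factor) simp_all
  moreover have "degree b' = degree b" "degree c' = degree c"
    using q1 q2 by (metis degree_map_poly_to_fract degree_smult_eq to_fract_eq_0_iff)+
  moreover have "degree F = degree b + degree c"
    using degF c(2) nz by (simp add: degree_mult_eq)
  ultimately consider "degree c = 0" | "degree b = 0" by linarith
  then show "b \<in> Units ?R"
  proof cases
    case 1
    then obtain k where k: "c = [:k:]" by (rule degree_eq_zeroE)
    then have "b = ?F * [:inverse k:]" using c(2) nz by simp
    moreover have "[:inverse k:] \<in> carrier ?R"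
      using const_in_poly_ring_over[OF k c(1) nz(2) R] by simp
    ultimately have "?F divides\<^bsub>?R\<^esub> b"
      unfolding factor_def poly_ring_over_simps(2) by (rule bexI)
    then show ?thesis using pf by (simp add: properfactor_def)
  next
    case 2
    then obtain k where k: "b = [:k:]" by (rule degree_eq_zeroE)
    moreover have "[:inverse k:] \<in> carrier ?R"
      using const_in_poly_ring_over[OF k _ nz(1) R] b by simp
    moreover have "[:inverse k:] * b = 1" "b * [:inverse k:] = 1" using k nz(1) by simp_all
    ultimately show ?thesis using b unfolding Units_def poly_ring_over_simps(2,3) by blast
  qed
qed

subsection \<open>Linear algebra for a common isotropic subspace\<close>

text \<open>Fewer equations than unknowns: padding with zero rows gives a square matrix whose last
  row is zero, so it is singular.\<close>

lemma homogeneous_solution: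
  fixes a :: "nat \<Rightarrow> nat \<Rightarrow> 'a :: field"
  assumes "k < m"
  shows "\<exists>v. (\<exists>i<m. v i \<noteq> 0) \<and> (\<forall>r<k. (\<Sum>i<m. a r i * v i) = 0)"
proof -
  define M where "M = mat m m (\<lambda>(r, i). if r < k then a r i else 0)"
  have M: "M \<in> carrier_mat m m" by (simp add: M_def)
  let ?u = "unit_vec m (m - 1) :: 'a vec"
  have "transpose_mat M *\<^sub>v ?u = 0\<^sub>v m"
  proof (rule eq_vecI)
    fix i assume "i < dim_vec (0\<^sub>v m :: 'a vec)"
    then have i: "i < m" by simp
    then have "(transpose_mat M *\<^sub>v ?u) $ i = (\<Sum>r<m. M $$ (r, i) * (if r = m - 1 then 1 else 0))"
      by (simp add: M_def scalar_prod_def atLeast0LessThan unit_vec_def)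
    also have "\<dots> = 0" using i assms by (intro sum.neutral) (auto simp: M_def)
    finally show "(transpose_mat M *\<^sub>v ?u) $ i = 0\<^sub>v m $ i" using i by simp
  qed (simp add: M_def)
  moreover have "?u \<noteq> 0\<^sub>v m"
  proof
    assume "?u = 0\<^sub>v m"
    then have "?u $ (m - 1) = 0" using assms by simp
    then show False using assms by simp
  qed
  moreover have "transpose_mat M \<in> carrier_mat m m" "?u \<in> carrier_vec m" using M by auto
  ultimately have "det (transpose_mat M) = 0"
    using det_0_iff_vec_prod_zero by blast
  then have "det M = 0" using det_transpose[OF M] by simp
  then obtain v where v: "v \<in> carrier_vec m" "v \<noteq> 0\<^sub>v m" "M *\<^sub>v v = 0\<^sub>v m"
    using det_0_iff_vec_prod_zero[OF M] by blast
  have "\<exists>i<m. v $ i \<noteq> 0" using v(1,2) by (metis carrier_vecD eq_vecI index_zero_vec)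
  moreover have "(\<Sum>i<m. a r i * v $ i) = 0" if "r < k" for r
  proof -
    have "(M *\<^sub>v v) $ r = (\<Sum>i<m. a r i * v $ i)"
      using that assms v(1) by (auto simp: M_def scalar_prod_def atLeast0LessThan)
    then show ?thesis using v(3) that assms by simp
  qed
  ultimately show ?thesis by (intro exI[of _ "\<lambda>i. v $ i"]) auto
qed

text \<open>Over an ordered field, the span of the functionals \<open>u\<^sub>i\<close> meets their common kernel trivially.\<close>

lemma isotropic_orthogonal_complement:
  fixes y :: "nat \<Rightarrow> nat \<Rightarrow> rat"
  assumes indep: "\<And>c. (\<And>a. a < 2 * g + 1 \<Longrightarrow> (\<Sum>i<g. c i * y i a) = 0) \<Longrightarrow> \<forall>i<g. c i = 0"
    and iso: "\<And>i j. i < g \<Longrightarrow> j < g \<Longrightarrow> aform (2 * g + 1) (y i) (y j) = 0"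
  shows "\<exists>z. \<forall>v. (\<forall>i<g. aform (2 * g + 1) (y i) v = 0) \<longrightarrow>
    (\<exists>c d. \<forall>a<2 * g + 1. v a = (\<Sum>i<g. c i * y i a) + d * z a)"
proof (cases "\<forall>v. (\<forall>i<g. aform (2 * g + 1) (y i) v = 0) \<longrightarrow> (\<exists>c. \<forall>a<2 * g + 1. v a = (\<Sum>i<g. c i * y i a))")
  case True
  then show ?thesis by (intro exI[of _ "\<lambda>_. 0"]) simp
next
  case False
  then obtain z where z: "\<And>i. i < g \<Longrightarrow> aform (2 * g + 1) (y i) z = 0"
    "\<And>c. \<exists>a<2 * g + 1. z a \<noteq> (\<Sum>i<g. c i * y i a)" by blast
  show ?thesis
  proof (rule exI[of _ z], intro allI impI)
    let ?n = "2 * g + 1"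
    fix v assume v: "\<forall>i<g. aform ?n (y i) v = 0"
    \<comment> \<open>The \<open>A\<^sub>0 y\<^sub>i\<close>, the \<open>y\<^sub>i\<close>,
      \<open>z\<close> and \<open>v\<close> are \<open>2 * g + 2\<close> vectors in dimension
      \<open>2 * g + 1\<close>, hence dependent.\<close>
    define w where "w i a = (if i < g then y i (?n - 1 - a) else if i < 2 * g then y (i - g) a
        else if i = 2 * g then z a else v a)" for i a
    obtain x where x: "\<exists>i<2 * g + 2. x i \<noteq> 0" "\<And>a. a < ?n \<Longrightarrow> (\<Sum>i<2 * g + 2. w i a * x i) = 0"
      using homogeneous_solution[of ?n "2 * g + 2" "\<lambda>a i. w i a"] by auto
    define p q where "p a = (\<Sum>i<g. x i * y i (?n - 1 - a))"
      and "q a = (\<Sum>i<g. x (g + i) * y i a) + x (2 * g) * z a + x (2 * g + 1) * v a" for a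
    have pq: "p a + q a = 0" if "a < ?n" for a
    proof -
      have split: "(\<Sum>i<2 * g + 2. f i) = (\<Sum>i<g. f i) + (\<Sum>i<g. f (g + i)) + f (2 * g) + f (2 * g + 1)" for f :: "nat \<Rightarrow> rat"
      proof -
        have "(\<Sum>i<g + m. f i) = (\<Sum>i<g. f i) + (\<Sum>i<m. f (g + i))" for m
          by (induction m) (simp_all add: add.assoc)
        from this[of g] show ?thesis by (simp add: mult_2)
      qed
      have "(\<Sum>i<2 * g + 2. w i a * x i) = p a + q a"
        unfolding split by (simp add: w_def p_def q_def mult.commute)
      then show ?thesis using x(2)[OF that] by simp
    qed
    have pform: "(\<Sum>a<?n. p a * u a) = (\<Sum>i<g. x i * aform ?n (y i) u)" for u
    proof -
      have flip: "(\<Sum>a<?n. y i (?n - 1 - a) * u a) = aform ?n (y i) u" for i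
      proof -
        have "(\<Sum>a<?n. y i (?n - 1 - a) * u a) = (\<Sum>a<?n. (\<lambda>a. y i a * u (?n - 1 - a)) (?n - 1 - a))"
          by (intro sum.cong) auto
        also have "\<dots> = (\<Sum>a<?n. (\<lambda>a. y i a * u (?n - 1 - a)) a)" by (rule sum_flip)
        finally show ?thesis by (simp add: aform_def)
      qed
      have "(\<Sum>a<?n. p a * u a) = (\<Sum>i<g. x i * (\<Sum>a<?n. y i (?n - 1 - a) * u a))"
        unfolding p_def sum_distrib_right sum_distrib_left by (subst sum.swap) (simp add: mult.assoc)
      then show ?thesis by (simp only: flip)
    qed
    have yq: "aform ?n (y i) q = 0" if i: "i < g" for i
    proof -
      have "aform ?n (y i) q = aform ?n q (y i)" by (rule aform_commute)
      also have "\<dots> = (\<Sum>j<g. x (g + j) * aform ?n (y j) (y i)) + x (2 * g) * aform ?n z (y i) + x (2 * g + 1) * aform ?n v (y i)"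
        unfolding q_def by (simp add: aform_add_left aform_sum_left aform_scale_left)
      also have "\<dots> = 0" using iso i z(1) v by (simp add: aform_commute[of _ _ "y i"])
      finally show ?thesis .
    qed
    \<comment> \<open>Pairing with \<open>p\<close> combines the values of the form with the
      \<open>y i\<close>, all of which vanish on \<open>q = - p\<close>. So the sum of squares of
      \<open>p\<close> is 0.\<close>
    have "(\<Sum>a<?n. p a * p a) = (\<Sum>a<?n. - (p a * q a))"
      using pq by (intro sum.cong) (auto simp: eq_neg_iff_add_eq_0 simp flip: distrib_left)
    also have "\<dots> = - (\<Sum>i<g. x i * aform ?n (y i) q)" by (simp only: sum_negf pform)
    also have "\<dots> = 0" using yq by simp
    finally have p0: "p a = 0" if "a < ?n" for a
      using that sum_nonneg_eq_0_iff[of "{..<?n}" "\<lambda>a. p a * p a"] by auto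
    have "(\<Sum>i<g. x i * y i a) = 0" if "a < ?n" for a
      using p0[of "?n - 1 - a"] that by (simp add: p_def)
    then have xg: "\<forall>i<g. x i = 0" by (rule indep)
    have q0: "q a = 0" if "a < ?n" for a using pq[OF that] p0[OF that] by simp
    \<comment> \<open>Otherwise \<open>z\<close> would lie in the span of the \<open>y i\<close>, or
      these would be dependent.\<close>
    have "x (2 * g + 1) \<noteq> 0"
    proof
      assume t: "x (2 * g + 1) = 0"
      have s: "x (2 * g) = 0"
      proof (rule ccontr)
        assume s: "x (2 * g) \<noteq> 0"
        obtain a where "a < ?n" "z a \<noteq> (\<Sum>i<g. (- x (g + i) / x (2 * g)) * y i a)"
          using z(2)[of "\<lambda>i. - x (g + i) / x (2 * g)"] by blast
        moreover have "(\<Sum>i<g. (- x (g + i) / x (2 * g)) * y i a) = - (\<Sum>i<g. x (g + i) * y i a) / x (2 * g)"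
          by (simp add: sum_divide_distrib sum_negf)
        moreover have "z a = - (\<Sum>i<g. x (g + i) * y i a) / x (2 * g)"
          using q0[OF \<open>a < ?n\<close>] s t by (simp add: q_def field_simps)
        ultimately show False by simp
      qed
      have "\<forall>i<g. x (g + i) = 0"
        by (rule indep) (use q0 s t in \<open>simp add: q_def\<close>)
      then have "x i = 0" if "i < 2 * g + 2" for i
        using that xg s t by (cases "i < g"; cases "i < 2 * g"; cases "i = 2 * g")
          (auto dest: spec[of _ "i - g"] simp: less_Suc_eq)
      then show False using x(1) by blast
    qed
    then have "v a = (\<Sum>i<g. (- x (g + i) / x (2 * g + 1)) * y i a) + (- x (2 * g) / x (2 * g + 1)) * z a" if "a < ?n" for a
    proof -
      have "(\<Sum>i<g. (- x (g + i) / x (2 * g + 1)) * y i a) = - (\<Sum>i<g. x (g + i) * y i a) / x (2 * g + 1)"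
        by (simp add: sum_divide_distrib sum_negf)
      then show ?thesis
        using q0[OF that] \<open>x (2 * g + 1) \<noteq> 0\<close> by (simp add: q_def field_simps)
    qed
    then show "\<exists>c d. \<forall>a<?n. v a = (\<Sum>i<g. c i * y i a) + d * z a"
      by (intro exI[of _ "\<lambda>i. - x (g + i) / x (2 * g + 1)"] exI[of _ "- x (2 * g) / x (2 * g + 1)"]) blast
  qed
qed

text \<open>\<open>A\<^sub>0 B\<close> again, acting on functions so that it can be iterated with
  \<open>^^\<close>.\<close>

definition flip_op :: "nat \<Rightarrow> 'a :: comm_ring_1 mat \<Rightarrow> (nat \<Rightarrow> 'a) \<Rightarrow> nat \<Rightarrow> 'a" where
  "flip_op n B v a = (\<Sum>b<n. B $$ (n - 1 - a, b) * v b)"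

lemma flip_op_cong: "(\<And>a. a < n \<Longrightarrow> u a = v a) \<Longrightarrow> flip_op n B u = flip_op n B v"
  unfolding flip_op_def by (intro ext sum.cong) auto

lemma flip_op_sum: "flip_op n B (\<lambda>a. \<Sum>i\<in>I. c i * f i a) = (\<lambda>a. \<Sum>i\<in>I. c i * flip_op n B (f i) a)"
  unfolding flip_op_def sum_distrib_left by (subst sum.swap) (simp add: mult.left_commute)

lemma aform_flip_op:
  "aform n u (flip_op n B v) = (\<Sum>a<n. \<Sum>b<n. u a * B $$ (a, b) * v b)"
  unfolding aform_def flip_op_def sum_distrib_left by (intro sum.cong) (auto simp: mult.assoc)

lemma aform_flip_op_commute:
  assumes "\<And>a b. a < n \<Longrightarrow> b < n \<Longrightarrow> B $$ (a, b) = B $$ (b, a)"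
  shows "aform n (flip_op n B u) v = aform n u (flip_op n B v)"
proof -
  have "aform n (flip_op n B u) v = (\<Sum>a<n. \<Sum>b<n. v a * B $$ (a, b) * u b)"
    unfolding aform_commute[of n _ v] by (rule aform_flip_op)
  also have "\<dots> = (\<Sum>b<n. \<Sum>a<n. v a * B $$ (a, b) * u b)" by (rule sum.swap)
  also have "\<dots> = (\<Sum>b<n. \<Sum>a<n. u b * B $$ (b, a) * v a)"
    using assms by (intro sum.cong) auto
  finally show ?thesis by (simp add: aform_flip_op)
qed

text \<open>\<open>T = A\<^sub>0 B\<close> maps \<open>Y\<close> into its orthogonal complement, which contains \<open>Y\<close> with codimension one,
  so each condition \<open>T ^ j e \<in> Y\<close> is a single linear equation.\<close>

lemma isotropic_cyclic_vector:
  fixes y :: "nat \<Rightarrow> nat \<Rightarrow> rat" and B :: "rat mat"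
  assumes n: "n = 2 * g + 1"
    and indep: "\<And>c. (\<And>a. a < n \<Longrightarrow> (\<Sum>i<g. c i * y i a) = 0) \<Longrightarrow> \<forall>i<g. c i = 0"
    and isoA: "\<And>i j. i < g \<Longrightarrow> j < g \<Longrightarrow> aform n (y i) (y j) = 0"
    and isoB: "\<And>i j. i < g \<Longrightarrow> j < g \<Longrightarrow> aform n (y i) (flip_op n B (y j)) = 0"
    and B: "\<And>a b. a < n \<Longrightarrow> b < n \<Longrightarrow> B $$ (a, b) = B $$ (b, a)"
  shows "\<exists>e. (\<exists>a<n. e a \<noteq> 0) \<and> (\<forall>k<2 * g. aform n e ((flip_op n B ^^ k) e) = 0)"
proof (cases "g = 0")
  case True
  then show ?thesis using n by (intro exI[of _ "\<lambda>_. 1"]) auto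
next
  case False
  let ?T = "flip_op n B"
  obtain z where z: "\<And>v. (\<forall>i<g. aform n (y i) v = 0) \<Longrightarrow> \<exists>c d. \<forall>a<n. v a = (\<Sum>i<g. c i * y i a) + d * z a"
    using isotropic_orthogonal_complement[of g y] indep isoA unfolding n by blast
  have "\<forall>i. \<exists>c d. i < g \<longrightarrow> (\<forall>a<n. ?T (y i) a = (\<Sum>k<g. c k * y k a) + d * z a)"
    using z isoB by blast
  then obtain t \<mu> where t: "\<And>i a. i < g \<Longrightarrow> a < n \<Longrightarrow> ?T (y i) a = (\<Sum>k<g. t i k * y k a) + \<mu> i * z a"
    by metis
  \<comment> \<open>\<open>L r\<close> sends the coefficients of \<open>e\<close> to the
    \<open>z\<close>-coefficient of \<open>T ^ (r + 1) e\<close>, as long as the earlier ones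
    vanish. Keeping \<open>T ^ j e\<close> in the span for \<open>j < g\<close> takes
    \<open>g - 1\<close> equations in \<open>g\<close> unknowns.\<close>
  define L where "L = rec_nat \<mu> (\<lambda>_ l i. \<Sum>k<g. l k * t i k)"
  have L: "L 0 = \<mu>" "L (Suc m) i = (\<Sum>k<g. L m k * t i k)" for m i by (simp_all add: L_def)
  obtain c where c: "\<exists>i<g. c i \<noteq> 0" "\<And>r. r < g - 1 \<Longrightarrow> (\<Sum>i<g. L r i * c i) = 0"
    using homogeneous_solution[of "g - 1" g L] False by auto
  \<comment> \<open>The coefficients of \<open>T ^ j e\<close> in the \<open>y k\<close>, found
    without regard to the \<open>z\<close>-component.\<close>
  define C where "C = rec_nat c (\<lambda>_ l k. \<Sum>i<g. t i k * l i)"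
  have C: "C 0 = c" "C (Suc m) k = (\<Sum>i<g. t i k * C m i)" for m k by (simp_all add: C_def)
  have LC: "(\<Sum>k<g. L m k * C r k) = (\<Sum>k<g. L (m + r) k * c k)" for m r
  proof (induction r arbitrary: m)
    case (Suc r)
    have "(\<Sum>k<g. L m k * C (Suc r) k) = (\<Sum>i<g. (\<Sum>k<g. L m k * t i k) * C r i)"
      unfolding C sum_distrib_left sum_distrib_right by (subst sum.swap) (simp add: mult.assoc)
    also have "\<dots> = (\<Sum>k<g. L (Suc m) k * C r k)" by (simp add: L)
    finally show ?case using Suc.IH[of "Suc m"] by simp
  qed (simp add: C)
  define e where "e a = (\<Sum>i<g. c i * y i a)" for a
  have Te: "(?T ^^ j) e a = (\<Sum>k<g. C j k * y k a)" if "j < g" "a < n" for j a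
    using that
  proof (induction j arbitrary: a)
    case (Suc j)
    have "(?T ^^ Suc j) e a = ?T (\<lambda>a. \<Sum>k<g. C j k * y k a) a"
      using flip_op_cong[of n "(?T ^^ j) e" "\<lambda>a. \<Sum>k<g. C j k * y k a" B] Suc by simp
    also have "\<dots> = (\<Sum>i<g. C j i * ?T (y i) a)" by (simp add: flip_op_sum)
    also have "\<dots> = (\<Sum>i<g. C j i * (\<Sum>k<g. t i k * y k a)) + (\<Sum>i<g. C j i * \<mu> i) * z a"
      using Suc.prems t by (simp add: distrib_left sum.distrib sum_distrib_right mult.assoc)
    also have "(\<Sum>i<g. C j i * \<mu> i) = 0"
      using LC[of 0 j] c(2)[of j] Suc.prems by (simp add: L mult.commute)
    also have "(\<Sum>i<g. C j i * (\<Sum>k<g. t i k * y k a)) = (\<Sum>k<g. C (Suc j) k * y k a)"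
      unfolding C sum_distrib_left sum_distrib_right by (subst sum.swap) (simp add: mult_ac)
    finally show ?case by simp
  qed (simp add: e_def C)
  have e0: "\<exists>a<n. e a \<noteq> 0" using indep[of c] c(1) unfolding e_def by blast
  have aform_cong: "aform n u v = aform n u' v'" if "\<And>a. a < n \<Longrightarrow> u a = u' a" "\<And>a. a < n \<Longrightarrow> v a = v' a" for u u' v v' :: "nat \<Rightarrow> rat"
    unfolding aform_def using that by (intro sum.cong) auto
  have A0: "aform n ((?T ^^ j) e) ((?T ^^ j) e) = 0" if "j < g" for j
  proof -
    have "aform n ((?T ^^ j) e) ((?T ^^ j) e) = aform n (\<lambda>a. \<Sum>k<g. C j k * y k a) (\<lambda>a. \<Sum>k<g. C j k * y k a)"
      using Te[OF that] by (intro aform_cong)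
    also have "\<dots> = (\<Sum>k<g. C j k * (\<Sum>l<g. C j l * aform n (y l) (y k)))"
      by (simp add: aform_sum_left aform_scale_left aform_commute[of n "y _" "\<lambda>a. \<Sum>k<g. C j k * y k a"])
    also have "\<dots> = 0" using isoA by simp
    finally show ?thesis .
  qed
  have B0: "aform n ((?T ^^ j) e) (?T ((?T ^^ j) e)) = 0" if "j < g" for j
  proof -
    have "aform n ((?T ^^ j) e) (?T ((?T ^^ j) e)) = aform n (\<lambda>a. \<Sum>k<g. C j k * y k a) (?T (\<lambda>a. \<Sum>k<g. C j k * y k a))"
      using Te[OF that] flip_op_cong[of n "(?T ^^ j) e" "\<lambda>a. \<Sum>k<g. C j k * y k a" B] by (intro aform_cong) auto
    also have "\<dots> = (\<Sum>k<g. C j k * (\<Sum>l<g. C j l * aform n (y k) (?T (y l))))"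
      by (simp add: aform_sum_left aform_scale_left flip_op_sum aform_commute[of n "y _" "\<lambda>a. \<Sum>k<g. C j k * ?T (y k) a"])
        (simp add: aform_commute)
    also have "\<dots> = 0" using isoB by simp
    finally show ?thesis .
  qed
  have shift: "aform n e ((?T ^^ (j + k)) e) = aform n ((?T ^^ j) e) ((?T ^^ k) e)" for j k
  proof (induction j arbitrary: k)
    case (Suc j)
    have "aform n e ((?T ^^ (Suc j + k)) e) = aform n ((?T ^^ j) e) ((?T ^^ Suc k) e)"
      using Suc.IH[of "Suc k"] by simp
    then show ?case by (simp add: aform_flip_op_commute[OF B])
  qed simp
  \<comment> \<open>Self-adjointness splits the power evenly: \<open>k = 2 * j\<close> is the form
    of \<open>A\<^sub>0\<close> at \<open>T ^ j e\<close>, and \<open>k = 2 * j + 1\<close> is the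
    form of \<open>B\<close> there.\<close>
  have "aform n e ((?T ^^ k) e) = 0" if k: "k < 2 * g" for k
  proof (cases "even k")
    case True
    then obtain j where "k = j + j" by (metis evenE mult_2)
    then show ?thesis using k shift[of j j] A0[of j] by simp
  next
    case False
    then obtain j where "k = j + Suc j" by (metis oddE mult_2 add_Suc_right Suc_eq_plus1)
    then show ?thesis using k shift[of j "Suc j"] B0[of j] by simp
  qed
  with e0 show ?thesis by blast
qed

text \<open>Puts \<open>dim\<close> into coordinates. Independence in \<open>Y\<close> is
  independence in the whole space, so independent sets have at most \<open>n\<close> elements; a
  maximal one exists and is a finite basis.\<close>

lemma subspace_independent_vectors:
  fixes Y :: "'a :: field vec set"
  assumes "subspace class_ring Y (module_vec TYPE('a) n)"
    and dim: "vectorspace.dim class_ring ((module_vec TYPE('a) n)\<lparr>carrier := Y\<rparr>) = g"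
  shows "\<exists>y :: nat \<Rightarrow> 'a vec. (\<forall>i<g. y i \<in> Y) \<and>
    (\<forall>c. (\<forall>a<n. (\<Sum>i<g. c i * y i $ a) = 0) \<longrightarrow> (\<forall>i<g. c i = 0))"
proof -
  interpret vec_space "TYPE('a)" n .
  have sub: "submodule class_ring Y V" using assms(1) by (simp add: subspace_def)
  then have Y: "Y \<subseteq> carrier_vec n" using submodule.subset by fastforce
  interpret W: vectorspace class_ring "vs Y" by (rule subspace_is_vs[OF assms(1)])
  have lin: "W.lin_dep S \<longleftrightarrow> lin_dep S" if "S \<subseteq> Y" for S
    by (rule span_li_not_depend(2)[OF that sub])
  have "\<exists>A. finite A \<and> maximal A (\<lambda>S. S \<subseteq> carrier (vs Y) \<and> W.lin_indpt S)"
  proof (rule maximal_exists)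
    show "finite A \<and> card A \<le> n" if "A \<subseteq> carrier (vs Y) \<and> W.lin_indpt A" for A
      using that li_le_dim[of A] Y lin[of A] by (auto simp: dim_is_n)
    show "{} \<subseteq> carrier (vs Y) \<and> W.lin_indpt {}" by (auto simp: W.lin_dep_def)
  qed
  then obtain A where A: "finite A" "maximal A (\<lambda>S. S \<subseteq> carrier (vs Y) \<and> W.lin_indpt S)" by blast
  then have AY: "A \<subseteq> Y" "\<not> lin_dep A" using lin[of A] by (auto simp: maximal_def)
  have "W.basis A" by (rule W.max_li_is_basis[OF A(2)])
  then have "card A = g" using W.dim_basis[OF A(1)] dim by simp
  then obtain f where f: "bij_betw f {..<g} A"
    using ex_bij_betw_nat_finite[OF A(1)] by (auto simp: atLeast0LessThan)
  have "\<forall>i<g. c i = 0" if c: "\<forall>a<n. (\<Sum>i<g. c i * f i $ a) = 0" for c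
  proof (rule ccontr)
    assume "\<not> ?thesis"
    then obtain i where i: "i < g" "c i \<noteq> 0" by blast
    define d where "d v = c (the_inv_into {..<g} f v)" for v
    have df: "d (f i) = c i" if "i < g" for i
      using the_inv_into_f_f[of f "{..<g}" i] f that by (auto simp: d_def bij_betw_def)
    have Ac: "A \<subseteq> carrier_vec n" using AY Y by blast
    have "lincomb d A = 0\<^sub>v n"
    proof (rule eq_vecI)
      fix a assume "a < dim_vec (0\<^sub>v n :: 'a vec)"
      then have a: "a < n" by simp
      have "lincomb d A $ a = (\<Sum>x\<in>A. d x * x $ a)" by (rule lincomb_index[OF a Ac])
      also have "\<dots> = (\<Sum>i<g. d (f i) * f i $ a)" by (rule sum.reindex_bij_betw[OF f, symmetric])
      also have "\<dots> = 0" using c a df by simp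
      finally show "lincomb d A $ a = 0\<^sub>v n $ a" using a by simp
    qed (simp add: lincomb_dim[OF A(1) Ac])
    moreover have "f i \<in> A" using f i by (auto simp: bij_betw_def)
    ultimately have "lin_dep A"
      unfolding lin_dep_def using A(1) i df[OF i(1)]
      by (intro exI[of _ A] exI[of _ d] exI[of _ "f i"]) auto
    then show False using AY by simp
  qed
  moreover have "\<forall>i<g. f i \<in> Y" using f AY by (auto simp: bij_betw_def)
  ultimately show ?thesis by blast
qed

subsection \<open>Distinguished pencils\<close>

text \<open>Expansion in the eigenframe: the coordinate of \<open>e\<close> at \<open>p i\<close> is
  their value under the form, and each application of the operator multiplies it by
  \<open>\<theta> i\<close>.\<close>

lemma flip_op_frame:
  fixes p :: "nat \<Rightarrow> nat \<Rightarrow> complex" and B :: "rat mat"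
  assumes p: "frame n p" and B: "\<And>a b. a < n \<Longrightarrow> b < n \<Longrightarrow> of_rat (B $$ (a, b)) = frame_entry n \<theta> p a b"
    and "a < n"
  shows "of_rat ((flip_op n B ^^ k) e a) = (\<Sum>i<n. aform n (\<lambda>a. of_rat (e a)) (p i) * \<theta> i ^ k * p i a)"
  using assms(3)
proof (induction k arbitrary: a)
  case 0
  have "(\<Sum>i<n. aform n (\<lambda>a. of_rat (e a)) (p i) * p i a) = (\<Sum>b<n. of_rat (e b) * (\<Sum>i<n. p i a * p i (n - 1 - b)))"
    unfolding aform_def sum_distrib_left sum_distrib_right by (subst sum.swap) (simp add: mult_ac)
  also have "\<dots> = (\<Sum>b<n. if b = a then of_rat (e b) else 0)"
    using frame_complete[OF p 0] by (intro sum.cong) auto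
  finally show ?case using 0 by simp
next
  case (Suc k)
  let ?\<epsilon> = "\<lambda>i. aform n (\<lambda>a. of_rat (e a)) (p i)" and ?v = "(flip_op n B ^^ k) e"
  have a: "n - 1 - a < n" "n - 1 - (n - 1 - a) = a" using Suc.prems by auto
  have "of_rat ((flip_op n B ^^ Suc k) e a) = (\<Sum>b<n. of_rat (B $$ (n - 1 - a, b)) * of_rat (?v b))"
    by (simp add: flip_op_def of_rat_sum of_rat_mult)
  also have "\<dots> = (\<Sum>b<n. (\<Sum>j<n. \<theta> j * p j a * p j (n - 1 - b)) * (\<Sum>i<n. ?\<epsilon> i * \<theta> i ^ k * p i b))"
    using Suc.IH B[OF a(1)] a(2) by (intro sum.cong) (auto simp: frame_entry_def)
  also have "\<dots> = (\<Sum>j<n. \<theta> j * p j a * (\<Sum>b<n. (\<Sum>i<n. ?\<epsilon> i * \<theta> i ^ k * p i b) * p j (n - 1 - b)))"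
    unfolding sum_distrib_left[of "\<theta> _ * _"] sum_distrib_right[of _ "{..<n}" "(\<Sum>i<n. ?\<epsilon> i * \<theta> i ^ k * p i _)"]
    by (subst sum.swap) (simp add: mult_ac)
  also have "\<dots> = (\<Sum>j<n. \<theta> j * p j a * (\<Sum>i<n. ?\<epsilon> i * \<theta> i ^ k * aform n (p i) (p j)))"
  proof (rule sum.cong[OF refl])
    fix j
    have "(\<Sum>b<n. (\<Sum>i<n. ?\<epsilon> i * \<theta> i ^ k * p i b) * p j (n - 1 - b)) =
        aform n (\<lambda>b. \<Sum>i<n. ?\<epsilon> i * \<theta> i ^ k * p i b) (p j)"
      by (rule aform_def[symmetric])
    then show "\<theta> j * p j a * (\<Sum>b<n. (\<Sum>i<n. ?\<epsilon> i * \<theta> i ^ k * p i b) * p j (n - 1 - b)) =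
        \<theta> j * p j a * (\<Sum>i<n. ?\<epsilon> i * \<theta> i ^ k * aform n (p i) (p j))"
      by (simp only: aform_sum_left aform_scale_left)
  qed
  also have "\<dots> = (\<Sum>j<n. \<theta> j * p j a * (?\<epsilon> j * \<theta> j ^ k))"
  proof (rule sum.cong[OF refl])
    fix j assume j: "j \<in> {..<n}"
    have "(\<Sum>i<n. ?\<epsilon> i * \<theta> i ^ k * aform n (p i) (p j)) = (\<Sum>i<n. if i = j then ?\<epsilon> i * \<theta> i ^ k else 0)"
      using p j by (intro sum.cong) (auto simp: frame_def)
    then show "\<theta> j * p j a * (\<Sum>i<n. ?\<epsilon> i * \<theta> i ^ k * aform n (p i) (p j)) = \<theta> j * p j a * (?\<epsilon> j * \<theta> j ^ k)"
      using j by simp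
  qed
  finally show ?case by (simp add: mult_ac)
qed

lemma aform_frame_coords:
  assumes "frame n p" "j < n"
  shows "aform n (\<lambda>a. \<Sum>i<n. x i * p i a) (p j) = x j"
proof -
  have "aform n (\<lambda>a. \<Sum>i<n. x i * p i a) (p j) = (\<Sum>i<n. x i * aform n (p i) (p j))"
    by (simp add: aform_sum_left aform_scale_left)
  also have "\<dots> = (\<Sum>i<n. if i = j then x i else 0)"
    using assms by (intro sum.cong) (auto simp: frame_def)
  finally show ?thesis using assms(2) by simp
qed

lemma aform_unit_left: "n > 0 \<Longrightarrow> c < n \<Longrightarrow> aform n (\<lambda>a. of_rat (if a = c then 1 else 0)) v = v (n - 1 - c)"
proof -
  assume "c < n"
  have "aform n (\<lambda>a. of_rat (if a = c then 1 else 0)) v = (\<Sum>a<n. if a = c then v (n - 1 - a) else 0)"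
    unfolding aform_def by (intro sum.cong) auto
  then show ?thesis using \<open>c < n\<close> by simp
qed

text \<open>The power sum is the trace of the \<open>k\<close>-th power of a rational operator,
  computed on the unit vectors.\<close>

lemma power_sums_rational:
  fixes p :: "nat \<Rightarrow> nat \<Rightarrow> complex" and B :: "rat mat"
  assumes p: "frame n p" and B: "\<And>a b. a < n \<Longrightarrow> b < n \<Longrightarrow> of_rat (B $$ (a, b)) = frame_entry n \<theta> p a b"
  shows "(\<Sum>i<n. \<theta> i ^ k) \<in> \<rat>"
proof -
  have "(\<Sum>c<n. of_rat ((flip_op n B ^^ k) (\<lambda>a. if a = c then 1 else 0) c)) =
      (\<Sum>c<n. \<Sum>i<n. p i (n - 1 - c) * \<theta> i ^ k * p i c)"
    using flip_op_frame[OF p B] by (intro sum.cong) (auto simp: aform_unit_left)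
  also have "\<dots> = (\<Sum>i<n. \<theta> i ^ k * aform n (p i) (p i))"
    unfolding aform_def sum_distrib_left by (subst sum.swap) (simp add: mult_ac)
  also have "\<dots> = (\<Sum>i<n. \<theta> i ^ k)"
    using p by (intro sum.cong) (auto simp: frame_def)
  finally have "(\<Sum>i<n. \<theta> i ^ k) = (\<Sum>c<n. of_rat ((flip_op n B ^^ k) (\<lambda>a. if a = c then 1 else 0) c))"
    by (rule sym)
  then show ?thesis by (simp only:) (intro Rats_sum Rats_of_rat)
qed

section \<open>Separability of the pencil polynomial\<close>

lemma antidiag_involution: "antidiag_mat n * antidiag_mat n = (1\<^sub>m n :: 'a :: comm_ring_1 mat)"
proof (rule eq_matI)
  fix i j assume "i < dim_row (1\<^sub>m n :: 'a mat)" "j < dim_col (1\<^sub>m n :: 'a mat)"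
  then have ij: "i < n" "j < n" by auto
  have "(antidiag_mat n * antidiag_mat n) $$ (i, j) =
      (\<Sum>k<n. (if i + k + 1 = n then 1 else 0) * (if k + j + 1 = n then 1 else 0) :: 'a)"
    using ij by (simp add: antidiag_mat_def scalar_prod_def atLeast0LessThan)
  also have "\<dots> = (\<Sum>k<n. if k = n - 1 - i then (if i = j then 1 else 0) else 0)"
    using ij by (intro sum.cong) auto
  also have "\<dots> = (if i = j then 1 else 0)" using ij by simp
  finally show "(antidiag_mat n * antidiag_mat n) $$ (i, j) = (1\<^sub>m n :: 'a mat) $$ (i, j)" using ij by simp
qed (auto simp: antidiag_mat_def)

lemma antidiag_carrier [simp]: "antidiag_mat n \<in> carrier_mat n n"
  by (simp add: antidiag_mat_def)

lemma det_antidiag: "det (antidiag_mat n) * det (antidiag_mat n) = (1 :: 'a :: comm_ring_1)"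
  using det_mult[of "antidiag_mat n :: 'a mat" n "antidiag_mat n"] by (simp add: antidiag_involution)

lemma antidiag_mult:
  fixes M :: "'a :: comm_ring_1 mat"
  assumes "M \<in> carrier_mat n n" "i < n" "j < n"
  shows "(antidiag_mat n * M) $$ (i, j) = M $$ (n - 1 - i, j)"
proof -
  have "(antidiag_mat n * M) $$ (i, j) = (\<Sum>k<n. (if i + k + 1 = n then 1 else 0) * M $$ (k, j))"
    using assms by (simp add: antidiag_mat_def scalar_prod_def atLeast0LessThan)
  also have "\<dots> = (\<Sum>k<n. if k = n - 1 - i then M $$ (k, j) else 0)"
    using assms by (intro sum.cong) auto
  finally show ?thesis using assms by simp
qed

text \<open>From \<open>x A\<^sub>0 - B = A\<^sub>0 (x - A\<^sub>0 B)\<close>.\<close>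

lemma pencil_poly_char_poly:
  fixes B :: "'a :: comm_ring_1 mat"
  assumes "B \<in> carrier_mat n n"
  shows "pencil_poly n B = det (antidiag_mat n) * char_poly (flip_rows n B)"
proof -
  let ?M = "char_poly_matrix (flip_rows n B)"
  have M: "?M \<in> carrier_mat n n" by simp
  have "[:0, 1:] \<cdot>\<^sub>m map_mat (\<lambda>a. [:a:]) (antidiag_mat n) - map_mat (\<lambda>a. [:a:]) B = antidiag_mat n * ?M"
  proof (rule eq_matI)
    fix i j assume "i < dim_row (antidiag_mat n * ?M)" "j < dim_col (antidiag_mat n * ?M)"
    then have ij: "i < n" "j < n" using M by (auto simp: antidiag_mat_def)
    have "(antidiag_mat n * ?M) $$ (i, j) = ?M $$ (n - 1 - i, j)" by (rule antidiag_mult[OF M ij])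
    then show "([:0, 1:] \<cdot>\<^sub>m map_mat (\<lambda>a. [:a:]) (antidiag_mat n) - map_mat (\<lambda>a. [:a:]) B) $$ (i, j) =
        (antidiag_mat n * ?M) $$ (i, j)"
      using ij assms by (auto simp: char_poly_matrix_def flip_rows_def antidiag_mat_def)
  qed (use assms carrier_matD[OF M] in \<open>auto simp: antidiag_mat_def\<close>)
  then show ?thesis
    unfolding pencil_poly_def char_poly_def by (simp add: det_mult[OF antidiag_carrier M])
qed

text \<open>A nonzero resultant makes the pencil polynomial coprime to its derivative over the
  rationals; at a double root the Bezout identity would give 0 for a nonzero constant.\<close>

lemma distinguished_separable:
  fixes B :: "rat mat"
  assumes B: "B \<in> carrier_mat n n" and disc: "discriminant (pencil_poly n B) \<noteq> 0"
    and roots: "char_poly (flip_rows n (map_mat of_rat B)) = root_poly n (\<theta> :: nat \<Rightarrow> complex)"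
  shows "inj_on \<theta> {..<n}"
proof (rule inj_onI, rule ccontr)
  fix i j assume ij: "i \<in> {..<n}" "j \<in> {..<n}" "\<theta> i = \<theta> j" "i \<noteq> j"
  let ?f = "char_poly (flip_rows n B)" and ?p = "pencil_poly n B"
  define d where "d = det (antidiag_mat n :: rat poly mat)"
  have dd: "d * d = 1" unfolding d_def by (rule det_antidiag)
  have p: "?p = d * ?f" unfolding d_def by (rule pencil_poly_char_poly[OF B])
  have "degree d = 0"
  proof -
    have "d dvd 1" using dd by (metis dvd_triv_left)
    then show ?thesis by (simp add: poly_dvd_1)
  qed
  then obtain \<delta> where \<delta>: "d = [:\<delta>:]" by (rule degree_eq_zeroE)
  have "degree (gcd ?p (pderiv ?p)) = 0"
    using disc resultant_0_gcd[of ?p "pderiv ?p"] by (auto simp: discriminant_def)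
  then obtain c where c: "gcd ?p (pderiv ?p) = [:c:]" by (rule degree_eq_zeroE)
  have "?p \<noteq> 0" using disc by (auto simp: discriminant_def)
  then have "c \<noteq> 0" using c by (metis gcd_eq_0_iff pCons_0_0)
  obtain u v where uv: "u * ?p + v * pderiv ?p = [:c:]"
    using bezout_coefficients_fst_snd[of ?p "pderiv ?p"] c by metis
  have "flip_rows n (map_mat of_rat B) = (map_mat of_rat (flip_rows n B) :: complex mat)"
    by (rule eq_matI) (use B in \<open>auto simp: flip_rows_def\<close>)
  then have "root_poly n \<theta> = char_poly (map_mat of_rat (flip_rows n B))" using roots by simp
  also have "\<dots> = map_poly of_rat ?f" by (rule of_rat_hom.char_poly_hom[of _ n]) simp
  finally have map_f: "map_poly of_rat ?f = root_poly n \<theta>" by (rule sym)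
  let ?g = "root_poly n \<theta>"
  have g: "?g = [:- \<theta> i, 1:] * ([:- \<theta> i, 1:] * (\<Prod>k\<in>{..<n} - {i} - {j}. [:- \<theta> k, 1:]))"
    unfolding root_poly_def using ij
    by (subst prod.remove[of _ i], simp, simp, subst prod.remove[of _ j]) auto
  have zero: "poly ?g (\<theta> i) = 0" "poly (pderiv ?g) (\<theta> i) = 0"
    unfolding g by (simp_all add: pderiv_mult del: mult_pCons_left)
  interpret mp: map_poly_comm_ring_hom "of_rat :: rat \<Rightarrow> complex" ..
  have "of_rat c = poly (map_poly of_rat (u * ?p + v * pderiv ?p)) (\<theta> i)"
    unfolding uv by (simp add: of_rat_hom.map_poly_pCons_hom)
  also have "\<dots> = 0"
    unfolding p \<delta> using zero
    by (simp add: mp.hom_mult mp.hom_add pderiv_smult of_rat_hom.map_poly_hom_smult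
        of_rat_hom.map_poly_pderiv map_f)
  finally show False using \<open>c \<noteq> 0\<close> by simp
qed

theorem cyclic_isotropic_rational_root:
  fixes p :: "nat \<Rightarrow> nat \<Rightarrow> complex" and B :: "rat mat"
  assumes n: "n = 2 * g + 1" and p: "frame n p" and inj: "inj_on \<theta> {..<n}"
    and B: "\<And>a b. a < n \<Longrightarrow> b < n \<Longrightarrow> of_rat (B $$ (a, b)) = frame_entry n \<theta> p a b"
    and sym: "\<And>a b. a < n \<Longrightarrow> b < n \<Longrightarrow> B $$ (a, b) = B $$ (b, a)"
    and e: "\<exists>a<n. e a \<noteq> 0" "\<And>k. k < 2 * g \<Longrightarrow> aform n e ((flip_op n B ^^ k) e) = 0"
  shows "\<exists>\<beta> r. (\<forall>i<n. (\<beta> i)\<^sup>2 = (p i (n - 1))\<^sup>2 * (\<Prod>j\<in>{..<n} - {i}. \<theta> i - \<theta> j)) \<and>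
    (\<Sum>i<n. \<beta> i) = of_rat r"
proof -
  have n0: "n > 0" using n by simp
  let ?T = "flip_op n B"
  define \<epsilon> where "\<epsilon> i = aform n (\<lambda>a. of_rat (e a)) (p i)" for i
  define M where "M k = aform n e ((?T ^^ k) e)" for k
  define h where "h = M (2 * g)"
  have T: "of_rat ((?T ^^ k) e a) = (\<Sum>i<n. \<epsilon> i * \<theta> i ^ k * p i a)" if "a < n" for k a
    unfolding \<epsilon>_def by (rule flip_op_frame[OF p B that])
  have M: "of_rat (M k) = (\<Sum>i<n. (\<epsilon> i)\<^sup>2 * \<theta> i ^ k)" for k
  proof -
    have "of_rat (M k) = aform n (\<lambda>a. of_rat (e a)) (\<lambda>a. of_rat ((?T ^^ k) e a))"
      by (simp add: M_def aform_def of_rat_sum of_rat_mult)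
    also have "\<dots> = aform n (\<lambda>a. of_rat (e a)) (\<lambda>a. \<Sum>i<n. \<epsilon> i * \<theta> i ^ k * p i a)"
      unfolding aform_def using T n0 by (intro sum.cong) auto
    also have "\<dots> = (\<Sum>i<n. \<epsilon> i * \<theta> i ^ k * aform n (\<lambda>a. of_rat (e a)) (p i))"
      by (subst aform_commute) (simp add: aform_sum_left aform_scale_left aform_commute)
    finally show ?thesis by (simp add: \<epsilon>_def power2_eq_square mult_ac)
  qed
  let ?D = "\<lambda>i. \<Prod>j\<in>{..<n} - {i}. \<theta> i - \<theta> j"
  have D0: "?D i \<noteq> 0" if "i < n" for i using inj that by (auto simp: inj_on_def)
  \<comment> \<open>The moments of \<open>e\<close> below \<open>2 * g\<close> vanish, so only the
    leading coefficient 1 of the polynomial with the other roots contributes to the residue.\<close>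
  have hD: "(\<epsilon> i)\<^sup>2 * ?D i = of_rat h" if i: "i < n" for i
  proof -
    define y where "y i = (if i < n then \<theta> i else of_rat (M (i - n)))" for i
    have "residue_at n y i = (\<epsilon> i)\<^sup>2 * (\<Prod>j\<in>{..<n} - {i}. y i - y j)"
      using i by (intro residue_at_eq) (auto simp: y_def M)
    also have "(\<Prod>j\<in>{..<n} - {i}. y i - y j) = ?D i"
      using i by (intro prod.cong) (auto simp: y_def)
    finally have r: "(\<epsilon> i)\<^sup>2 * ?D i = residue_at n y i" by simp
    let ?g = "\<Prod>j\<in>{..<n} - {i}. [:- y j, 1:]"
    have "degree ?g = n - 1" using i by (subst degree_prod_eq_sum_degree) auto
    moreover have "lead_coeff ?g = 1" by (simp add: lead_coeff_prod)
    ultimately have lc: "coeff ?g (2 * g) = 1" using n by simp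
    have "residue_at n y i = (\<Sum>l<n. if l = 2 * g then of_rat h else 0)"
      unfolding residue_at_def
    proof (rule sum.cong[OF refl])
      fix l assume "l \<in> {..<n}"
      then have "l = 2 * g \<or> l < 2 * g" using n by auto
      then show "coeff ?g l * y (n + l) = (if l = 2 * g then of_rat h else 0)"
        using lc e(2)[of l] by (auto simp: y_def h_def M_def)
    qed
    then show ?thesis using r n by simp
  qed
  have h0: "h \<noteq> 0"
  proof
    assume "h = 0"
    then have \<epsilon>0: "\<epsilon> i = 0" if "i < n" for i using hD[OF that] D0[OF that] by simp
    obtain a where a: "a < n" "e a \<noteq> 0" using e(1) by blast
    have "of_rat (e a) = (0 :: complex)" using T[OF a(1), of 0] \<epsilon>0 by simp
    then show False using a(2) by simp
  qed
  have \<epsilon>0: "\<epsilon> i \<noteq> 0" if "i < n" for i using hD[OF that] h0 by auto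
  \<comment> \<open>The columns are \<open>e\<close>, \<open>T e\<close>, ...,
    \<open>T ^ (2 * g) e\<close>.\<close>
  define E where "E = mat n n (\<lambda>(a, k). (?T ^^ k) e a)"
  have E: "E \<in> carrier_mat n n" by (simp add: E_def)
  have E_coords: "(\<Sum>k<n. of_rat (x k) * of_rat ((?T ^^ k) e a)) =
      (\<Sum>i<n. (\<epsilon> i * (\<Sum>k<n. of_rat (x k) * \<theta> i ^ k)) * p i a)" if "a < n" for x a
  proof -
    have "(\<Sum>k<n. of_rat (x k) * of_rat ((?T ^^ k) e a)) = (\<Sum>k<n. \<Sum>i<n. of_rat (x k) * (\<epsilon> i * \<theta> i ^ k * p i a))"
      by (simp only: T[OF that] sum_distrib_left)
    also have "\<dots> = (\<Sum>i<n. (\<epsilon> i * (\<Sum>k<n. of_rat (x k) * \<theta> i ^ k)) * p i a)"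
      by (subst sum.swap) (simp add: sum_distrib_left sum_distrib_right mult_ac)
    finally show ?thesis .
  qed
  have coords: "\<epsilon> i * (\<Sum>k<n. of_rat (x k) * \<theta> i ^ k) = aform n (\<lambda>a. of_rat (\<Sum>k<n. x k * (?T ^^ k) e a)) (p i)"
    if "i < n" for x i
  proof -
    have "aform n (\<lambda>a. of_rat (\<Sum>k<n. x k * (?T ^^ k) e a)) (p i) =
        aform n (\<lambda>a. \<Sum>i<n. (\<epsilon> i * (\<Sum>k<n. of_rat (x k) * \<theta> i ^ k)) * p i a) (p i)"
      unfolding aform_def using E_coords by (intro sum.cong) (auto simp: of_rat_sum of_rat_mult)
    then show ?thesis by (simp only: aform_frame_coords[OF p that])
  qed
  \<comment> \<open>As no \<open>\<epsilon> i\<close> vanishes, a dependency would be a nonzero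
    polynomial of degree below \<open>n\<close> with the \<open>n\<close> distinct roots
    \<open>\<theta> i\<close>.\<close>
  have "det E \<noteq> 0"
  proof
    assume "det E = 0"
    then obtain v where v: "v \<in> carrier_vec n" "v \<noteq> 0\<^sub>v n" "E *\<^sub>v v = 0\<^sub>v n"
      using det_0_iff_vec_prod_zero[OF E] by blast
    have "(\<Sum>k<n. v $ k * (?T ^^ k) e a) = 0" if "a < n" for a
    proof -
      have "(E *\<^sub>v v) $ a = (\<Sum>k<n. v $ k * (?T ^^ k) e a)"
        using that v(1) by (auto simp: E_def scalar_prod_def atLeast0LessThan mult.commute)
      then show ?thesis using v(3) that by simp
    qed
    then have z: "(\<Sum>k<n. of_rat (v $ k) * \<theta> i ^ k) = 0" if "i < n" for i
      using coords[OF that, of "\<lambda>k. v $ k"] \<epsilon>0[OF that] by (simp add: aform_def)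
    define P where "P = (\<Sum>k<n. Polynomial.monom (of_rat (v $ k)) k :: complex poly)"
    have "P = 0"
    proof (rule ccontr)
      assume "P \<noteq> 0"
      have "degree P < n"
        unfolding P_def using n0 by (intro degree_sum_less) (auto intro: le_less_trans[OF degree_monom_le])
      moreover have "\<theta> ` {..<n} \<subseteq> {x. poly P x = 0}" using z by (auto simp: P_def poly_sum poly_monom)
      then have "card (\<theta> ` {..<n}) \<le> card {x. poly P x = 0}"
        by (rule card_mono[OF poly_roots_finite[OF \<open>P \<noteq> 0\<close>]])
      then have "card (\<theta> ` {..<n}) \<le> degree P"
        using poly_roots_degree[OF \<open>P \<noteq> 0\<close>] by (rule order.trans)
      ultimately show False using card_image[OF inj] by simp
    qed
    moreover have "coeff P k = of_rat (v $ k)" if "k < n" for k using that by (simp add: P_def coeff_sum)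
    ultimately have "v $ k = 0" if "k < n" for k using that by simp
    then show False using v(1,2) by (metis carrier_vecD eq_vecI index_zero_vec)
  qed
  \<comment> \<open>\<open>E\<^sup>T A\<^sub>0 E\<close> is the Gram matrix with entries
    \<open>M (j + k)\<close>, zero above the antidiagonal and \<open>h\<close> on it. Reversing its
    rows by a second \<open>A\<^sub>0\<close> makes it upper triangular and cancels the sign of the
    determinant of the first.\<close>
  have hn: "h ^ n = (det E)\<^sup>2"
  proof -
    let ?A = "antidiag_mat n :: rat mat"
    define N where "N = ?A * (transpose_mat E * (?A * E))"
    have AE: "?A * E \<in> carrier_mat n n" by (rule mult_carrier_mat[OF antidiag_carrier E])
    have ET: "transpose_mat E \<in> carrier_mat n n" using E by simp
    have EAE: "transpose_mat E * (?A * E) \<in> carrier_mat n n"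
      by (rule mult_carrier_mat[OF ET AE])
    have N: "N \<in> carrier_mat n n" unfolding N_def by (rule mult_carrier_mat[OF antidiag_carrier EAE])
    have shift: "aform n ((?T ^^ j) e) ((?T ^^ k) e) = M (j + k)" for j k
    proof (induction j arbitrary: k)
      case (Suc j)
      show ?case using Suc.IH[of "Suc k"] by (simp add: aform_flip_op_commute[OF sym])
    qed (simp add: M_def)
    have tr: "(transpose_mat E * X) $$ (r, j) = (\<Sum>a<n. E $$ (a, r) * X $$ (a, j))"
      if "X \<in> carrier_mat n n" "r < n" "j < n" for X r j
      using that E by (simp add: scalar_prod_def atLeast0LessThan)
    have entry: "N $$ (i, j) = M (n - 1 - i + j)" if ij: "i < n" "j < n" for i j
    proof -
      have "N $$ (i, j) = (transpose_mat E * (?A * E)) $$ (n - 1 - i, j)"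
        unfolding N_def by (rule antidiag_mult[OF EAE ij])
      also have "\<dots> = (\<Sum>a<n. E $$ (a, n - 1 - i) * (?A * E) $$ (a, j))"
        using ij by (intro tr AE) auto
      also have "\<dots> = (\<Sum>a<n. E $$ (a, n - 1 - i) * E $$ (n - 1 - a, j))"
        using ij by (intro sum.cong) (auto simp: antidiag_mult[OF E])
      also have "\<dots> = aform n ((?T ^^ (n - 1 - i)) e) ((?T ^^ j) e)"
        using ij by (simp add: E_def aform_def)
      finally show ?thesis by (simp add: shift)
    qed
    have "upper_triangular N"
      using N n e(2) by (auto simp: entry M_def)
    then have "det N = prod_list (diag_mat N)" by (rule det_upper_triangular[OF _ N])
    also have "diag_mat N = map (\<lambda>_. h) [0..<n]"
      using N n by (auto simp: diag_mat_def entry h_def)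
    also have "prod_list \<dots> = h ^ n" by (simp add: map_replicate_const)
    finally have "h ^ n = det N" by simp
    also have "\<dots> = det ?A * det ?A * (det E)\<^sup>2"
      unfolding N_def det_mult[OF antidiag_carrier EAE] det_mult[OF ET AE] det_mult[OF antidiag_carrier E]
        det_transpose[OF E] by (simp only: power2_eq_square mult_ac)
    finally show ?thesis by (simp add: det_antidiag)
  qed
  \<comment> \<open>\<open>h ^ (2 * g + 1)\<close> is the square of \<open>det E\<close>, so
    dividing by \<open>h ^ g\<close> extracts the root of \<open>h\<close>; here the odd
    \<open>n\<close> matters.\<close>
  define \<kappa> where "\<kappa> = det E / h ^ g"
  have \<kappa>: "\<kappa>\<^sup>2 = h"
    using hn h0 by (simp add: \<kappa>_def power_divide n flip: power_mult) (simp add: field_simps power_add mult.commute)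
  \<comment> \<open>The coefficients of \<open>\<gamma>\<close>: the first unit vector in the basis
    of columns of \<open>E\<close>. Its value under the form with \<open>p i\<close> is the last
    coordinate of \<open>p i\<close>.\<close>
  obtain x where x: "\<And>a. a < n \<Longrightarrow> (\<Sum>k<n. x k * (?T ^^ k) e a) = (if a = 0 then 1 else 0)"
  proof -
    obtain R where R: "R \<in> carrier_mat n n" "E * R = 1\<^sub>m n"
      using det_non_zero_imp_unit[OF E \<open>det E \<noteq> 0\<close>] unfolding Units_def by (auto simp: ring_mat_def)
    have "(\<Sum>k<n. R $$ (k, 0) * (?T ^^ k) e a) = (if a = 0 then 1 else 0)" if "a < n" for a
    proof -
      have "(E * R) $$ (a, 0) = (\<Sum>k<n. R $$ (k, 0) * (?T ^^ k) e a)"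
        using that R(1) n0 by (simp add: E_def scalar_prod_def atLeast0LessThan mult.commute)
      then show ?thesis using R(2) that n0 by simp
    qed
    then show ?thesis by (rule that)
  qed
  define \<gamma> where "\<gamma> i = (\<Sum>k<n. of_rat (x k) * \<theta> i ^ k)" for i
  have w: "p i (n - 1) = \<epsilon> i * \<gamma> i" if "i < n" for i
  proof -
    have "\<epsilon> i * \<gamma> i = aform n (\<lambda>a. of_rat (if a = 0 then 1 else 0)) (p i)"
      unfolding \<gamma>_def coords[OF that] aform_def using x by (intro sum.cong) auto
    then show ?thesis using aform_unit_left[OF n0 n0, of "p i"] by simp
  qed
  have "(of_rat \<kappa> * \<gamma> i)\<^sup>2 = (p i (n - 1))\<^sup>2 * ?D i" if "i < n" for i
  proof -
    have "(of_rat \<kappa> * \<gamma> i)\<^sup>2 = of_rat h * (\<gamma> i)\<^sup>2"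
      by (simp add: power_mult_distrib flip: \<kappa> of_rat_power)
    then show ?thesis using hD[OF that] w[OF that] by (simp add: power_mult_distrib mult_ac)
  qed
  moreover have "\<exists>r. (\<Sum>i<n. of_rat \<kappa> * \<gamma> i) = of_rat r"
  proof -
    have "(\<Sum>i<n. of_rat \<kappa> * \<gamma> i) = of_rat \<kappa> * (\<Sum>k<n. of_rat (x k) * (\<Sum>i<n. \<theta> i ^ k))"
      unfolding \<gamma>_def sum_distrib_left by (rule sum.swap)
    also have "\<dots> \<in> \<rat>"
      by (intro Rats_mult Rats_sum Rats_of_rat power_sums_rational[OF p B])
    finally show ?thesis by (auto elim: Rats_cases)
  qed
  ultimately show ?thesis by (intro exI[of _ "\<lambda>i. of_rat \<kappa> * \<gamma> i"]) simp
qed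

section \<open>From the definition of distinguished elements to a rational root\<close>

lemma symmetric_matsD:
  assumes "B \<in> symmetric_mats n"
  shows "B \<in> carrier_mat n n" "a < n \<Longrightarrow> b < n \<Longrightarrow> B $$ (a, b) = B $$ (b, a)"
  using assms unfolding symmetric_mats_def by (auto, metis index_transpose_mat(1) carrier_matD)

text \<open>Polarization: the quadratic form vanishes at \<open>u\<close>, \<open>v\<close> and
  \<open>u + v\<close>, and 2 is invertible.\<close>

lemma isotropic_polar:
  fixes M :: "rat mat"
  assumes "isotropic M Y" "M \<in> carrier_mat n n" "\<And>a b. a < n \<Longrightarrow> b < n \<Longrightarrow> M $$ (a, b) = M $$ (b, a)"
    and "u \<in> Y" "v \<in> Y" "u + v \<in> Y" "u \<in> carrier_vec n" "v \<in> carrier_vec n"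
  shows "(\<Sum>a<n. \<Sum>b<n. u $ a * M $$ (a, b) * v $ b) = 0"
proof -
  let ?q = "\<lambda>u v. \<Sum>a<n. \<Sum>b<n. u $ a * M $$ (a, b) * v $ b"
  have q: "w \<bullet> (M *\<^sub>v w) = ?q w w" if "w \<in> carrier_vec n" for w
    using that assms(2) by (auto simp: scalar_prod_def atLeast0LessThan sum_distrib_left mult.assoc intro!: sum.cong)
  have "?q v u = (\<Sum>b<n. \<Sum>a<n. v $ a * M $$ (a, b) * u $ b)" by (rule sum.swap)
  also have "\<dots> = ?q u v" using assms(3) by (intro sum.cong) auto
  finally have "?q v u = ?q u v" .
  moreover have "?q (u + v) (u + v) = ?q u u + ?q u v + ?q v u + ?q v v"
    using assms(7,8) by (simp add: algebra_simps sum.distrib)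
  moreover have "?q (u + v) (u + v) = 0" "?q u u = 0" "?q v v = 0"
    using assms(1,4-8) q[of "u + v"] q[of u] q[of v] by (auto simp: isotropic_def)
  ultimately show ?thesis by simp
qed

lemma distinguished_cyclic_vector:
  assumes "distinguished g B" and n: "n = 2 * g + 1"
  shows "\<exists>e. (\<exists>a<n. e a \<noteq> 0) \<and> (\<forall>k<2 * g. aform n e ((flip_op n B ^^ k) e) = 0)"
proof -
  obtain Y where B: "B \<in> symmetric_mats n" and Y: "subspace class_ring Y (module_vec TYPE(rat) n)"
    "vectorspace.dim class_ring ((module_vec TYPE(rat) n)\<lparr>carrier := Y\<rparr>) = g"
    and iso: "isotropic (antidiag_mat n) Y" "isotropic B Y"
    using assms by (auto simp: distinguished_def Let_def)
  note BD = symmetric_matsD[OF B]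
  have sub: "submodule class_ring Y (module_vec TYPE(rat) n)" using Y(1) by (simp add: subspace_def)
  have Yc: "Y \<subseteq> carrier_vec n" using submodule.subset[OF sub] by (simp add: module_vec_def)
  have Yadd: "u + v \<in> Y" if "u \<in> Y" "v \<in> Y" for u v
    using submodule.m_closed[OF sub that] by (simp add: module_vec_def)
  obtain y where y: "\<And>i. i < g \<Longrightarrow> y i \<in> Y"
    "\<And>c. (\<forall>a<n. (\<Sum>i<g. c i * y i $ a) = 0) \<Longrightarrow> (\<forall>i<g. c i = 0)"
    using subspace_independent_vectors[OF Y] by blast
  have polar: "(\<Sum>a<n. \<Sum>b<n. y i $ a * M $$ (a, b) * y j $ b) = 0"
    if "isotropic M Y" "M \<in> carrier_mat n n" "\<And>a b. a < n \<Longrightarrow> b < n \<Longrightarrow> M $$ (a, b) = M $$ (b, a)" "i < g" "j < g" for M i j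
    using y(1)[OF that(4)] y(1)[OF that(5)] Yc by (intro isotropic_polar[OF that(1-3)] Yadd) auto
  show ?thesis
  proof (rule isotropic_cyclic_vector[OF n, of "\<lambda>i a. y i $ a"])
    show "\<forall>i<g. c i = 0" if "\<And>a. a < n \<Longrightarrow> (\<Sum>i<g. c i * y i $ a) = 0" for c
      using y(2) that by blast
    show "aform n (\<lambda>a. y i $ a) (\<lambda>a. y j $ a) = 0" if "i < g" "j < g" for i j
    proof -
      have "(\<Sum>a<n. \<Sum>b<n. y i $ a * antidiag_mat n $$ (a, b) * y j $ b) = 0"
        by (rule polar[OF iso(1) _ _ that]) (auto simp: antidiag_mat_def add.commute)
      also have "(\<Sum>a<n. \<Sum>b<n. y i $ a * antidiag_mat n $$ (a, b) * y j $ b) = (\<Sum>a<n. y i $ a * y j $ (n - 1 - a))"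
      proof (rule sum.cong[OF refl])
        fix a assume a: "a \<in> {..<n}"
        have "(\<Sum>b<n. y i $ a * antidiag_mat n $$ (a, b) * y j $ b) = (\<Sum>b<n. if b = n - 1 - a then y i $ a * y j $ b else 0)"
          using a by (intro sum.cong) (auto simp: antidiag_mat_def)
        then show "(\<Sum>b<n. y i $ a * antidiag_mat n $$ (a, b) * y j $ b) = y i $ a * y j $ (n - 1 - a)"
          using a by simp
      qed
      finally show ?thesis by (simp add: aform_def)
    qed
    show "aform n (\<lambda>a. y i $ a) (flip_op n B (\<lambda>a. y j $ a)) = 0" if "i < g" "j < g" for i j
      unfolding aform_flip_op by (rule polar[OF iso(2) BD that])
  qed (rule BD(2))
qed

theorem distinguished_rational_root:
  assumes "distinguished g B" and n: "n = 2 * g + 1"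
    and F: "\<And>b \<theta> p \<beta>. frame n p \<Longrightarrow>
      (\<And>i j. i < n \<Longrightarrow> j < n \<Longrightarrow> entry_mat n b $$ (i, j) = frame_entry n \<theta> p i j) \<Longrightarrow>
      (\<And>i. i < n \<Longrightarrow> (\<beta> i)\<^sup>2 = (p i (n - 1))\<^sup>2 * (\<Prod>j\<in>{..<n} - {i}. \<theta> i - \<theta> j)) \<Longrightarrow>
      map_poly (eval_mpoly b) F = orbit_poly n \<beta>"
  shows "\<exists>r :: rat. poly (specialize B F) (of_rat r) = 0"
proof -
  have n0: "n > 0" using n by simp
  have B: "B \<in> symmetric_mats n" and disc: "discriminant (pencil_poly n B) \<noteq> 0"
    using assms by (auto simp: distinguished_def Let_def)
  note BD = symmetric_matsD[OF B]
  define b :: "nat \<Rightarrow> complex" where "b x = of_rat (B $$ prod_decode x)" for x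
  have entry: "entry_mat n b $$ (i, j) = of_rat (B $$ (i, j))" if "i < n" "j < n" for i j
    using that BD(2)[OF that] by (simp add: entry_mat_def b_def min_def max_def)
  have "entry_mat n b = map_mat of_rat B"
    by (rule eq_matI) (use entry BD(1) in \<open>auto simp: entry_mat_def\<close>)
  moreover obtain \<theta> where \<theta>: "char_poly (flip_rows n (entry_mat n b)) = root_poly n \<theta>"
    using char_poly_roots[of "flip_rows n (entry_mat n b)" n] by auto
  ultimately have inj: "inj_on \<theta> {..<n}"
    using distinguished_separable[OF BD(1) disc] by simp
  obtain p where p: "frame n p" "\<And>i j. i < n \<Longrightarrow> j < n \<Longrightarrow> entry_mat n b $$ (i, j) = frame_entry n \<theta> p i j"
    by (rule frame_exists[of n "entry_mat n b" \<theta>, OF entry_mat_sym \<theta> inj])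
      (assumption+, erule that, simp)
  obtain e where e: "\<exists>a<n. e a \<noteq> 0" "\<And>k. k < 2 * g \<Longrightarrow> aform n e ((flip_op n B ^^ k) e) = 0"
    using distinguished_cyclic_vector[OF assms(1) n] by blast
  have "of_rat (B $$ (i, j)) = frame_entry n \<theta> p i j" if "i < n" "j < n" for i j
    using p(2)[OF that] entry[OF that] by simp
  from cyclic_isotropic_rational_root[OF n p(1) inj this BD(2) e]
  obtain \<beta> r where \<beta>: "\<forall>i<n. (\<beta> i)\<^sup>2 = (p i (n - 1))\<^sup>2 * (\<Prod>j\<in>{..<n} - {i}. \<theta> i - \<theta> j)"
    and r: "(\<Sum>i<n. \<beta> i) = of_rat r" by auto
  have "specialize B F = orbit_poly n \<beta>"
    unfolding specialize_def b_def[symmetric, abs_def] using F[OF p] \<beta> by blast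
  moreover have "signed_sum n {} \<beta> = of_rat r" using r by (simp add: signed_sum_def)
  \<comment> \<open>The empty set of minus signs is one of the chosen representatives, and its sum
    is the rational \<open>r\<close>.\<close>
  then have "poly (orbit_poly n \<beta>) (of_rat (r\<^sup>2)) = 0"
    unfolding orbit_poly_def poly_prod by (intro prod_zero bexI[of _ "{}"]) (auto simp: of_rat_power)
  ultimately show ?thesis by (intro exI[of _ "r\<^sup>2"]) simp
qed

theorem theorem4p1:
  fixes g n :: nat
  assumes "n = 2 * g + 1"
  shows "\<exists>F :: mpoly poly.
           range (coeff F) \<subseteq> mpolys gauss_ints (entry_vars n) \<and>
           degree F = 2 ^ (2 * g) \<and>
           ring_irreducible\<^bsub>poly_ring_over (ratfuns gauss_rats (entry_vars n))\<^esub> (map_poly to_fract F) \<and>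
           (\<forall>B0. distinguished g B0 \<longrightarrow>
              (\<exists>r :: rat. poly (specialize B0 F) (of_rat r) = 0))"
proof -
  have n0: "n > 0" "odd n" "n - 1 = 2 * g" using assms by auto
  obtain F :: "mpoly poly" where F: "range (coeff F) \<subseteq> mpolys gauss_ints (entry_vars n)" "degree F = 2 ^ (n - 1)"
    and F_orbit: "\<forall>b \<theta> p \<beta>. frame n p \<longrightarrow> (\<forall>i<n. \<forall>j<n. entry_mat n b $$ (i, j) = frame_entry n \<theta> p i j) \<longrightarrow>
      (\<forall>i<n. (\<beta> i)\<^sup>2 = (p i (n - 1))\<^sup>2 * (\<Prod>j\<in>{..<n} - {i}. \<theta> i - \<theta> j)) \<longrightarrow>
      map_poly (eval_mpoly b) F = orbit_poly n \<beta>"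
    using orbit_mpoly_frames[OF n0(1)] by (elim exE conjE)
  have orbit: "map_poly (eval_mpoly b) F = orbit_poly n \<beta>"
    if "frame n p" "\<And>i j. i < n \<Longrightarrow> j < n \<Longrightarrow> entry_mat n b $$ (i, j) = frame_entry n \<theta> p i j"
      "\<And>i. i < n \<Longrightarrow> (\<beta> i)\<^sup>2 = (p i (n - 1))\<^sup>2 * (\<Prod>j\<in>{..<n} - {i}. \<theta> i - \<theta> j)" for b \<theta> p \<beta>
    using F_orbit[THEN spec, of b, THEN spec, of \<theta>, THEN spec, of p, THEN spec, of \<beta>] that by simp
  show ?thesis
  proof (intro exI[of _ F] conjI allI impI)
    show "range (coeff F) \<subseteq> mpolys gauss_ints (entry_vars n)" by (rule F(1))
    show "degree F = 2 ^ (2 * g)" using F(2) n0(3) by simp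
    show "ring_irreducible\<^bsub>poly_ring_over (ratfuns gauss_rats (entry_vars n))\<^esub> (map_poly to_fract F)"
    proof (rule ring_irreducible_mpoly)
      show "degree F \<le> degree G \<or> degree F \<le> degree H" if "Q \<noteq> 0" "smult Q F = G * H" for Q G H
        unfolding F(2) by (rule orbit_mpoly_factor_degree[OF n0(2) orbit that])
    qed (simp_all add: F(2) gauss_rats_def)
    show "\<exists>r :: rat. poly (specialize B0 F) (of_rat r) = 0" if "distinguished g B0" for B0
      by (rule distinguished_rational_root[OF that assms orbit])
  qed
qed

end
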